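(* Let $D=(V,E)$ be a finite digraph (orientation of a simple graph) and $k$ a positive integer. For each $v\in V$ let $S(v)$ be a set of size $k(d^+_D(v)+1)$, where $d^+_D(v)$ is the outdegree of $v$. If $D$ contains no odd directed simple cycle, then there exist subsets $C(v)\subseteq S(v)$ with $|C(v)|=k$ for all $v\in V$ and $C(u)\cap C(v)=\emptyset$ for every two adjacent vertices $u,v$. Moreover, such subsets $C(v)$ can be found in time polynomial in $|V|$ and $k$. *)

theory Defs
  imports "Graph_Theory.Pair_Digraph" "HOL-Computational_Algebra.Polynomial"
begin

definition oriented_graph :: "'a pair_pre_digraph \<Rightarrow> bool" where
  "oriented_graph D \<longleftrightarrow> pair_digraph D \<and> asym (parcs D)"

definition no_odd_cycle :: "'a pair_pre_digraph \<Rightarrow> bool" where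
  "no_odd_cycle D \<longleftrightarrow> \<not> (\<exists>p. pre_digraph.cycle (with_proj D) p \<and> odd (length p))"

definition choice_instance :: "'a pair_pre_digraph \<Rightarrow> nat \<Rightarrow> ('a \<Rightarrow> 'c set) \<Rightarrow> bool" where
  "choice_instance D k S \<longleftrightarrow>
     oriented_graph D \<and> no_odd_cycle D \<and> k > 0 \<and>
     (\<forall>v\<in>pverts D. finite (S v) \<and> card (S v) = k * (out_degree (with_proj D) v + 1))"

definition proper_choice ::
    "'a pair_pre_digraph \<Rightarrow> nat \<Rightarrow> ('a \<Rightarrow> 'c set) \<Rightarrow> ('a \<Rightarrow> 'c set) \<Rightarrow> bool" where
  "proper_choice D k S C \<longleftrightarrow>
     (\<forall>v\<in>pverts D. C v \<subseteq> S v \<and> card (C v) = k) \<and>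
     (\<forall>u\<in>pverts D. \<forall>v\<in>pverts D.
        (u, v) \<in> parcs D \<or> (v, u) \<in> parcs D \<longrightarrow> C u \<inter> C v = {})"


text \<open>
  Running time is measured on the random access machine of Cook and Reckhow
  (Time bounded random access machines, 1973) with uniform cost: every instruction takes one
  step. Addition and (truncated) subtraction are the only arithmetic operations; in particular
  there is no unit-cost multiplication, so that the machine is polynomially equivalent to Turing
  machines. Input is read from, and output is appended to, a list of natural numbers.
\<close>

datatype instr =
    Const nat nat       \<comment> \<open>\<open>X\<^sub>i := c\<close>\<close>
  | Add nat nat nat     \<comment> \<open>\<open>X\<^sub>i := X\<^sub>j + X\<^sub>l\<close>\<close>
  | Sub nat nat nat     \<comment> \<open>\<open>X\<^sub>i := X\<^sub>j - X\<^sub>l\<close>\<close>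
  | Load nat nat        \<comment> \<open>\<open>X\<^sub>i := X\<close> at address \<open>X\<^sub>j\<close>\<close>
  | Store nat nat       \<comment> \<open>\<open>X\<close> at address \<open>X\<^sub>i\<close> \<open>:= X\<^sub>j\<close>\<close>
  | Jump_pos nat nat    \<comment> \<open>if \<open>X\<^sub>j > 0\<close>, continue at instruction \<open>q\<close>\<close>
  | Read nat
  | Print nat

text \<open>Program counter, memory, remaining input, output so far.\<close>

type_synonym config = "nat \<times> (nat \<Rightarrow> nat) \<times> nat list \<times> nat list"

fun exec :: "instr \<Rightarrow> config \<Rightarrow> config" where
  "exec (Const i c) (pc, X, ins, outs) = (pc + 1, X(i := c), ins, outs)"
| "exec (Add i j l) (pc, X, ins, outs) = (pc + 1, X(i := X j + X l), ins, outs)"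
| "exec (Sub i j l) (pc, X, ins, outs) = (pc + 1, X(i := X j - X l), ins, outs)"
| "exec (Load i j) (pc, X, ins, outs) = (pc + 1, X(i := X (X j)), ins, outs)"
| "exec (Store i j) (pc, X, ins, outs) = (pc + 1, X(X i := X j), ins, outs)"
| "exec (Jump_pos j q) (pc, X, ins, outs) = (if X j > 0 then q else pc + 1, X, ins, outs)"
| "exec (Read i) (pc, X, ins, outs) =
     (pc + 1, X(i := (case ins of [] \<Rightarrow> 0 | a # _ \<Rightarrow> a)), tl ins, outs)"
| "exec (Print i) (pc, X, ins, outs) = (pc + 1, X, ins, outs @ [X i])"

text \<open>
  The machine halts when the program counter leaves the program; a halted configuration is a
  fixed point of \<open>step\<close>, so \<open>ram_outputs P xs ys t\<close> says that on input \<open>xs\<close> the program halts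
  after at most \<open>t\<close> steps with output \<open>ys\<close>.
\<close>

definition step :: "instr list \<Rightarrow> config \<Rightarrow> config" where
  "step P c = (if fst c < length P then exec (P ! fst c) c else c)"

definition ram_outputs :: "instr list \<Rightarrow> nat list \<Rightarrow> nat list \<Rightarrow> nat \<Rightarrow> bool" where
  "ram_outputs P xs ys t \<longleftrightarrow>
     (\<exists>pc X ins. (step P ^^ t) (0, \<lambda>_. 0, xs, []) = (pc, X, ins, ys) \<and> length P \<le> pc)"

text \<open>
  An instance with vertex set \<open>{..<n}\<close> and colours in \<open>nat\<close> is presented as \<open>n\<close>, \<open>k\<close>, the rows of
  the adjacency matrix, and for each vertex the length of a list of its colours followed by that
  list.
\<close>

definition encode_instance ::
    "nat \<Rightarrow> nat \<Rightarrow> nat pair_pre_digraph \<Rightarrow> nat list list \<Rightarrow> nat list" where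
  "encode_instance n k D L =
     [n, k]
     @ concat (map (\<lambda>u. map (\<lambda>v. if (u, v) \<in> parcs D then 1 else 0) [0..<n]) [0..<n])
     @ concat (map (\<lambda>l. length l # l) L)"

end

theory Submission
  imports Defs
begin

text \<open>
  Process the colours one at a time. For colour \<open>c\<close> take a kernel of the subdigraph induced by the
  vertices that have \<open>c\<close> in their list and still need colours, and give \<open>c\<close> to the kernel. A vertex
  that is offered \<open>c\<close> but does not get it has an out-neighbour that does. Every out-neighbour gets at
  most \<open>k\<close> colours, so a vertex \<open>v\<close> misses at most \<open>k * d\<^sup>+(v)\<close> colours and ends up with \<open>k\<close>.

  Kernels exist by Richardson's theorem. Without odd closed walks every strong component is
  bipartite. Ordering the components by the number of vertices of the bipartite double cover that
  can be reached gives a rank and a parity such that every arc decreases the rank, or keeps the rank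
  and flips the parity. Within a rank, the kernel conditions describe a fixed point of an operator
  that is monotone once the two parities are ordered oppositely, so it is found by iterating from the
  least element.

  For the running time, this algorithm is written in a language of bounded loops and compiled to the
  random access machine. All loops run over values bounded by a fixed polynomial in \<open>n\<close> and \<open>k\<close>, and
  the nesting depth is constant.
\<close>

text \<open>Everything is shaped so that loops whose number of rounds is fixed by \<open>n\<close>
  and \<open>k\<close> suffice. Strong components are never computed: a vertex reaches at least as
  much of the cover as each of its out-neighbours does, and equally much only if it can be reached
  back, so the mere number of reachable nodes already orders the components. The parity within a
  component is read off from the same reachability relation, relative to the last vertex in the list
  that belongs to the component. The kernel iteration has no stopping test: starting from the parity
  pattern, a vertex changes its membership at most once, so as many sweeps as there are vertices are
  enough for each rank. Colours are arbitrary natural numbers, unrelated to \<open>n\<close> and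
  \<open>k\<close>, so no loop may run over a range of colours. The program runs over list entries
  instead and meets a colour once for every list that contains it; after the first time the set of
  vertices to which the colour is offered is empty, so the repetition changes nothing.\<close>

section \<open>Odd closed walks\<close>

text \<open>Cutting a closed subwalk out of an odd closed walk leaves two closed walks, exactly one
  of which is odd, and both are shorter. The first arc is split off because \<open>cycle\<close>
  asks for distinctness only of the vertices after the first one.\<close>

lemma (in wf_digraph) odd_closed_awalk_imp_odd_cycle:
  assumes "awalk u p u" and "odd (length p)"
  shows "\<exists>c. cycle c \<and> odd (length c)"
  using assms
proof (induction "length p" arbitrary: u p rule: less_induct)
  case less
  then obtain e es where p: "p = e # es" by (cases p) auto
  then have walk: "tail G e = u" "e \<in> arcs G" "awalk (head G e) es u"
    using less.prems(1) by (auto simp: awalk_simps)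
  show ?case
  proof (cases "distinct (awalk_verts (head G e) es)")
    case True
    then have "cycle p"
      unfolding cycle_def using less.prems(1) p by (intro exI[of _ u]) auto
    then show ?thesis using less.prems(2) by blast
  next
    case False
    then obtain q r s w where split: "es = q @ r @ s" "0 < length r"
      "awalk (head G e) q w" "awalk w r w" "awalk w s u"
      using awalk_not_distinct_decomp[OF walk(3)] by blast
    show ?thesis
    proof (cases "odd (length r)")
      case True
      show ?thesis
        by (rule less.hyps[OF _ split(4) True]) (simp add: p split(1))
    next
      case False
      have "awalk u (e # q @ s) u"
        using walk(1,2) split(3,5) awalk_hd_in_verts by (fastforce simp: awalk_simps)
      moreover have "odd (length (e # q @ s))"
        using less.prems(2) False by (simp add: p split(1))
      ultimately show ?thesis
        using split(2) by (intro less.hyps[of "e # q @ s"]) (simp_all add: p split(1))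
    qed
  qed
qed

section \<open>The bipartite double cover and parities of walks\<close>

text \<open>Every arc changes the sheet, so walks from \<open>(u, b)\<close> to
  \<open>(v, c)\<close> correspond to walks from \<open>u\<close> to \<open>v\<close> whose length
  is odd iff \<open>b \<noteq> c\<close>. Questions about parity become plain reachability.\<close>

definition double_cover :: "'a rel \<Rightarrow> ('a \<times> bool) rel" where
  "double_cover A = {((u, b), (v, \<not> b)) | u v b. (u, v) \<in> A}"

text \<open>Exchanging the two sheets is an automorphism of the cover.\<close>

lemma double_cover_rtrancl_flip:
  assumes "((u, b), (v, c)) \<in> (double_cover A)\<^sup>*"
  shows "((u, \<not> b), (v, \<not> c)) \<in> (double_cover A)\<^sup>*"
  using assms
proof (induction "(v, c)" arbitrary: v c rule: rtrancl_induct)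
  case (step y)
  obtain w d where y: "y = (w, d)" by (cases y)
  with step have "((u, \<not> b), (w, \<not> d)) \<in> (double_cover A)\<^sup>*" by blast
  moreover have "((w, \<not> d), (v, \<not> c)) \<in> double_cover A"
    using step(2) y unfolding double_cover_def by auto
  ultimately show ?case by (rule rtrancl_into_rtrancl)
qed simp

lemma double_cover_rtrancl_flip_iff:
  "((u, \<not> b), (v, \<not> c)) \<in> (double_cover A)\<^sup>* \<longleftrightarrow> ((u, b), (v, c)) \<in> (double_cover A)\<^sup>*"
  using double_cover_rtrancl_flip[of u b v c A] double_cover_rtrancl_flip[of u "\<not> b" v "\<not> c" A]
  by auto

lemma (in wf_digraph) double_cover_imp_awalk:
  assumes "((u, b), (v, c)) \<in> (double_cover (arcs_ends G))\<^sup>*" and "u \<in> verts G"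
  shows "\<exists>p. awalk u p v \<and> (odd (length p) \<longleftrightarrow> b \<noteq> c)"
  using assms(1)
proof (induction "(v, c)" arbitrary: v c rule: rtrancl_induct)
  case base
  then show ?case using assms(2) by (intro exI[of _ "[]"]) (simp add: awalk_Nil_iff)
next
  case (step y)
  obtain w d where y: "y = (w, d)" by (cases y)
  with step obtain p where p: "awalk u p w" "odd (length p) \<longleftrightarrow> b \<noteq> d" by blast
  from step(2) y obtain e where e: "e \<in> arcs G" "tail G e = w" "head G e = v" "c = (\<not> d)"
    by (auto simp: double_cover_def arcs_ends_def arc_to_ends_def)
  have "awalk u (p @ [e]) v"
    using p(1) e by (auto simp: awalk_simps)
  then show ?case using p(2) e(4) by (intro exI[of _ "p @ [e]"]) auto
qed

lemma no_odd_cycle_double_cover: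
  assumes "pair_wf_digraph D" and "no_odd_cycle D" and "u \<in> pverts D"
  shows "((u, b), (u, \<not> b)) \<notin> (double_cover (parcs D))\<^sup>*"
proof
  interpret pair_wf_digraph D by fact
  interpret wf_digraph "with_proj D" by (rule wf_digraph)
  assume "((u, b), (u, \<not> b)) \<in> (double_cover (parcs D))\<^sup>*"
  then obtain p where "awalk u p u" "odd (length p)"
    using double_cover_imp_awalk[of u b u "\<not> b"] assms(3) by auto
  with assms(2) odd_closed_awalk_imp_odd_cycle show False
    unfolding no_odd_cycle_def by blast
qed

section \<open>Ranking and two-colouring strong components by reachability\<close>

section \<open>Labellings\<close>

text \<open>A relaxed form of an acyclic order of the strong components with a two-colouring of
  each: vertices of equal rank may lie in different components, as long as arcs between them change
  the parity.\<close>

definition kernel_labelling :: "'a rel \<Rightarrow> ('a \<Rightarrow> nat) \<Rightarrow> ('a \<Rightarrow> bool) \<Rightarrow> bool" where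
  "kernel_labelling A rank par \<longleftrightarrow>
     (\<forall>(x, y)\<in>A. rank y < rank x \<or> rank y = rank x \<and> par x \<noteq> par y)"

definition reach_rank :: "('a \<times> bool) rel \<Rightarrow> 'a \<Rightarrow> nat" where
  "reach_rank R v = card {z. ((v, False), z) \<in> R}"

definition mutual :: "('a \<times> bool) rel \<Rightarrow> bool \<Rightarrow> 'a \<Rightarrow> 'a \<Rightarrow> bool" where
  "mutual R b u v \<longleftrightarrow> ((u, False), (v, b)) \<in> R \<and> ((v, False), (u, b)) \<in> R"

text \<open>Later vertices overwrite earlier ones, so without odd closed walks the value is the
  parity of the walks between \<open>v\<close> and the last \<open>u\<close> of the list in the
  component of \<open>v\<close>. This form is a loop that overwrites one array cell.\<close>

definition reach_par :: "('a \<times> bool) rel \<Rightarrow> 'a list \<Rightarrow> 'a \<Rightarrow> bool" where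
  "reach_par R us v =
     fold (\<lambda>u p. if mutual R True u v then True else if mutual R False u v then False else p) us False"

lemma double_cover_rtrancl_fst:
  assumes "(x, y) \<in> (double_cover A)\<^sup>*" "A \<subseteq> V \<times> V" "fst x \<in> V"
  shows "fst y \<in> V"
  using assms(1,3) by (induction rule: rtrancl_induct) (use assms(2) in \<open>auto simp: double_cover_def\<close>)

text \<open>For an arc from \<open>x\<close> to \<open>y\<close>, all that \<open>(y, True)\<close>
  reaches is reached from \<open>(x, False)\<close>, and by exchanging sheets it is as much as
  \<open>(y, False)\<close> reaches. So the rank cannot increase along the arc. If it stays equal,
  the two reachable sets coincide, \<open>(y, True)\<close> reaches \<open>(x, False)\<close>, and
  there is an odd way back: \<open>x\<close> and \<open>y\<close> share a component and have
  opposite parities.\<close>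

lemma reach_labelling:
  assumes "finite V" "A \<subseteq> V \<times> V" "set us = V"
    and no_odd: "\<And>u b. u \<in> V \<Longrightarrow> ((u, b), (u, \<not> b)) \<notin> (double_cover A)\<^sup>*"
  defines "R \<equiv> (double_cover A)\<^sup>*"
  shows "kernel_labelling A (reach_rank R) (reach_par R us)"
proof -
  have "reach_rank R y = reach_rank R x \<and> reach_par R us x \<noteq> reach_par R us y"
    if xy: "(x, y) \<in> A" and nless: "\<not> reach_rank R y < reach_rank R x" for x y
  proof -
    have V: "x \<in> V" "y \<in> V" using assms(2) xy by auto
    let ?X = "{z. ((x, False), z) \<in> R}" and ?Y = "{z. ((y, False), z) \<in> R}" and ?Y' = "{z. ((y, True), z) \<in> R}"
    have fin: "finite ?X" 
      by (rule finite_subset[of _ "V \<times> UNIV"])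
         (use double_cover_rtrancl_fst[OF _ assms(2)] V assms(1) in \<open>fastforce simp: R_def\<close>)+
    have flip: "((u, \<not> b), (v, \<not> c)) \<in> R \<longleftrightarrow> ((u, b), (v, c)) \<in> R" for u v b c
      unfolding R_def by (rule double_cover_rtrancl_flip_iff)
    have tr: "(a, b) \<in> R \<Longrightarrow> (b, c) \<in> R \<Longrightarrow> (a, c) \<in> R" for a b c
      unfolding R_def by (rule rtrancl_trans)
    have arc: "((x, b), (y, \<not> b)) \<in> R" for b
      unfolding R_def by (rule r_into_rtrancl) (use xy in \<open>auto simp: double_cover_def\<close>)
    have "?Y' = (\<lambda>(v, b). (v, \<not> b)) ` ?Y"
      using flip[of y False] by (force simp: image_iff)
    then have card: "card ?Y' = reach_rank R y"
      unfolding reach_rank_def by (simp add: card_image inj_on_def split_beta prod_eq_iff)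
    have sub: "?Y' \<subseteq> ?X" using tr[OF arc[of False]] by auto
    then have "reach_rank R y \<le> reach_rank R x"
      unfolding card[symmetric] unfolding reach_rank_def by (rule card_mono[OF fin])
    with nless have eq: "reach_rank R y = reach_rank R x" by simp
    then have "?Y' = ?X"
      using card_subset_eq[OF fin sub] card by (simp add: reach_rank_def)
    moreover have "(x, False) \<in> ?X" unfolding R_def by simp
    ultimately have yx: "((y, True), (x, False)) \<in> R" by auto
    have yx': "((y, b), (x, \<not> b)) \<in> R" for b
      using yx flip[of y False x True] by (cases b) auto
    have odd: "((u, b), (u, \<not> b)) \<notin> R" if "u \<in> V" for u b
      using no_odd that unfolding R_def by blast
    \<comment> \<open>The arc and the way back are both odd, so extending a walk by either of them
      changes its parity.\<close>
    have mut: "mutual R b u x \<longleftrightarrow> mutual R (\<not> b) u y" for b u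
    proof
      assume m: "mutual R b u x"
      have "((u, False), (y, \<not> b)) \<in> R" using tr[OF _ arc[of b]] m unfolding mutual_def by blast
      moreover have "((x, True), (u, \<not> b)) \<in> R" using m flip[of x False u b] unfolding mutual_def by simp
      then have "((y, False), (u, \<not> b)) \<in> R" using tr[OF yx'[of False]] by simp
      ultimately show "mutual R (\<not> b) u y" unfolding mutual_def by simp
    next
      assume m: "mutual R (\<not> b) u y"
      have "((u, False), (x, b)) \<in> R" using tr[OF _ yx'[of "\<not> b"]] m unfolding mutual_def by simp
      moreover have "((y, True), (u, b)) \<in> R" using m flip[of y False u "\<not> b"] unfolding mutual_def by simp
      then have "((x, False), (u, b)) \<in> R" using tr[OF arc[of False]] by simp
      ultimately show "mutual R b u x" unfolding mutual_def by simp
    qed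
    have excl: "\<not> (mutual R True u y \<and> mutual R False u y)" for u
    proof
      assume "mutual R True u y \<and> mutual R False u y"
      then have "((y, False), (u, False)) \<in> R" "((u, False), (y, True)) \<in> R" unfolding mutual_def by auto
      with tr odd[OF V(2), of False] show False by auto
    qed
    let ?f = "\<lambda>v u p. if mutual R True u v then True else if mutual R False u v then False else p"
    \<comment> \<open>A round preserves being complementary; if \<open>u\<close> is tied to
      \<open>y\<close> by even walks it even produces complementary values from arbitrary
      ones.\<close>
    have step: "?f x u p = (\<not> ?f y u q)" if "p = (\<not> q) \<or> mutual R False u y" for u p q
      using mut[of True u] mut[of False u] excl[of u] that by auto
    have neg: "p = (\<not> q) \<Longrightarrow> fold (?f x) us p = (\<not> fold (?f y) us q)" for us p q
    proof (induction us arbitrary: p q)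
      case (Cons u us)
      show ?case using Cons.IH[OF step] Cons.prems by simp
    qed simp
    \<comment> \<open>Both folds start from \<open>False\<close>, so they are not complementary at
      first; the round for \<open>y\<close> itself makes them so.\<close>
    have "mutual R False y y" unfolding mutual_def R_def by simp
    moreover have "y \<in> set us" using V assms(3) by simp
    ultimately have "fold (?f x) us p = (\<not> fold (?f y) us q)" for p q
    proof (induction us arbitrary: p q)
      case (Cons u us)
      then show ?case
      proof (cases "y = u")
        case True
        show ?thesis using neg[OF step, of p q u us] Cons.prems(1) True by simp
      qed simp
    qed simp
    then have "reach_par R us x \<noteq> reach_par R us y" unfolding reach_par_def by simp
    with eq show ?thesis by simp
  qed
  then show ?thesis unfolding kernel_labelling_def by blast
qed

section \<open>Richardson's theorem through a monotone iteration\<close>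

section \<open>Kernels\<close>

text \<open>Because \<open>K\<close> lies in \<open>W\<close>, arcs leaving \<open>W\<close> have no
  influence: this is a kernel of the subdigraph induced by \<open>W\<close>, independent and reached
  by an arc from every other vertex of \<open>W\<close>.\<close>

definition is_kernel :: "'a rel \<Rightarrow> 'a set \<Rightarrow> 'a set \<Rightarrow> bool" where
  "is_kernel A W K \<longleftrightarrow> K \<subseteq> W \<and> (\<forall>v\<in>W. v \<in> K \<longleftrightarrow> A `` {v} \<inter> K = {})"

definition kernel_update :: "'a rel \<Rightarrow> 'a set \<Rightarrow> 'a \<Rightarrow> 'a set \<Rightarrow> 'a set" where
  "kernel_update A W v K = (if v \<in> W \<and> A `` {v} \<inter> K = {} then insert v K else K - {v})"

definition kernel_sweep :: "'a rel \<Rightarrow> ('a \<Rightarrow> nat) \<Rightarrow> 'a set \<Rightarrow> 'a list \<Rightarrow> nat \<Rightarrow> 'a set \<Rightarrow> 'a set" where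
  "kernel_sweep A rank W vs r = fold (\<lambda>v K. if rank v = r then kernel_update A W v K else K) vs"

text \<open>The start set is the least element of the order in which vertices with
  \<open>par\<close> ascend by leaving the set and the others by entering it. The number of sweeps
  is fixed, so that no test for stability is made.\<close>

definition kernel_iter :: "'a rel \<Rightarrow> ('a \<Rightarrow> nat) \<Rightarrow> ('a \<Rightarrow> bool) \<Rightarrow> 'a list \<Rightarrow> nat \<Rightarrow> 'a set \<Rightarrow> 'a set" where
  "kernel_iter A rank par vs m W =
     fold (\<lambda>r. kernel_sweep A rank W vs r ^^ length vs) [0..<m] {v \<in> W. par v}"

context
  fixes A :: "'a rel" and rank :: "'a \<Rightarrow> nat" and par :: "'a \<Rightarrow> bool" and W :: "'a set"
  assumes lab: "kernel_labelling A rank par"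
begin

text \<open>Progress measure of a phase: in the order that makes the kernel operator monotone,
  ascending means that this set grows.\<close>

definition flipped :: "nat \<Rightarrow> 'a set \<Rightarrow> 'a set" where
  "flipped r K = {v \<in> W. rank v = r \<and> (v \<in> K) \<noteq> par v}"

text \<open>The state during phase \<open>r\<close>. Lower ranks are settled, higher ranks
  untouched, and at rank \<open>r\<close> only a vertex that still has its initial status may
  violate its condition.\<close>

definition kernel_inv :: "nat \<Rightarrow> 'a set \<Rightarrow> bool" where
  "kernel_inv r K \<longleftrightarrow> K \<subseteq> W
     \<and> (\<forall>v\<in>W. rank v < r \<longrightarrow> (v \<in> K \<longleftrightarrow> A `` {v} \<inter> K = {}))
     \<and> (\<forall>v\<in>flipped r K. v \<in> K \<longleftrightarrow> A `` {v} \<inter> K = {})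
     \<and> (\<forall>v\<in>W. r < rank v \<longrightarrow> (v \<in> K \<longleftrightarrow> par v))"

lemma arc_labels: "(x, y) \<in> A \<Longrightarrow> rank y < rank x \<or> rank y = rank x \<and> par x \<noteq> par y"
  using lab unfolding kernel_labelling_def by blast

text \<open>A flipped vertex already satisfies its condition, so an update that changes something
  flips a vertex for the first time. Vertices of lower rank have no arc to \<open>v\<close> and
  notice nothing; the flipped vertices of rank \<open>r\<close> with an arc to \<open>v\<close> are
  the critical ones.\<close>

lemma kernel_inv_update:
  assumes inv: "kernel_inv r K" and r: "rank v = r"
  defines "K' \<equiv> kernel_update A W v K"
  shows "kernel_inv r K'" "flipped r K \<subseteq> flipped r K'" "v \<in> W \<Longrightarrow> K' = K \<Longrightarrow> v \<in> K \<longleftrightarrow> A `` {v} \<inter> K = {}"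
    "\<forall>w. rank w \<noteq> r \<longrightarrow> (w \<in> K' \<longleftrightarrow> w \<in> K)"
proof -
  have KW: "K \<subseteq> W" using inv unfolding kernel_inv_def by blast
  have others: "w \<in> K' \<longleftrightarrow> w \<in> K" if "w \<noteq> v" for w
    using that unfolding K'_def kernel_update_def by auto
  then show "\<forall>w. rank w \<noteq> r \<longrightarrow> (w \<in> K' \<longleftrightarrow> w \<in> K)" using r by metis
  have irr: "(v, v) \<notin> A" using arc_labels[of v v] by blast
  show triv: "v \<in> K \<longleftrightarrow> A `` {v} \<inter> K = {}" if "v \<in> W" "K' = K"
    using that unfolding K'_def kernel_update_def by (auto split: if_splits)
  have "kernel_inv r K' \<and> flipped r K \<subseteq> flipped r K'"
  proof (cases "K' = K")
    case True then show ?thesis using inv by simp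
  next
    case False
    then have v: "v \<in> W" "v \<in> K \<longleftrightarrow> A `` {v} \<inter> K \<noteq> {}" "v \<in> K' \<longleftrightarrow> v \<notin> K"
      unfolding K'_def kernel_update_def using KW by (auto split: if_splits)
    then have unflipped: "v \<in> K \<longleftrightarrow> par v"
      using inv r unfolding kernel_inv_def flipped_def by blast
    have K'W: "K' \<subseteq> W" using KW others v(1) by (metis subsetD subsetI)
    have fl: "flipped r K' = insert v (flipped r K)"
    proof (rule set_eqI)
      show "w \<in> flipped r K' \<longleftrightarrow> w \<in> insert v (flipped r K)" for w
        using others[of w] unflipped v r unfolding flipped_def by (cases "w = v") auto
    qed
    have others': "K' - {v} = K - {v}" using others by blast
    have c1: "w \<in> K' \<longleftrightarrow> A `` {w} \<inter> K' = {}" if "w \<in> W" "rank w < r" for w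
    proof -
      have "(w, v) \<notin> A" using arc_labels[of w v] that r by auto
      then have "A `` {w} \<inter> K' = A `` {w} \<inter> K" using others' by blast
      moreover have "w \<in> K' \<longleftrightarrow> w \<in> K" using others[of w] that r by auto
      ultimately show ?thesis using inv that unfolding kernel_inv_def by blast
    qed
    have c2: "w \<in> K' \<longleftrightarrow> A `` {w} \<inter> K' = {}" if "w \<in> flipped r K'" for w
    proof (cases "w = v")
      case True
      have "A `` {v} \<inter> K' = A `` {v} \<inter> K" using others' irr by blast
      then show ?thesis using True v by blast
    next
      case False
      then have w: "w \<in> flipped r K" using that fl by blast
      then have cons: "w \<in> K \<longleftrightarrow> A `` {w} \<inter> K = {}" using inv unfolding kernel_inv_def by blast
      have wK: "w \<in> K' \<longleftrightarrow> w \<in> K" using others False by blast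
      have wp: "(w \<in> K) \<noteq> par w" "rank w = r" using w unfolding flipped_def by auto
      show ?thesis
      proof (cases "(w, v) \<in> A")
        case True
        \<comment> \<open>As \<open>w\<close> is flipped, \<open>v\<close> was not, and their
          parities differ, \<open>w\<close> and \<open>v\<close> were both in \<open>K\<close> or
          both outside. The condition of \<open>w\<close> excludes the former because of the arc. So
          \<open>v\<close> now enters, and \<open>w\<close> stays outside with one more
          reason.\<close>
        then have "par w \<noteq> par v" using arc_labels[of w v] wp r by auto
        then have "w \<in> K \<longleftrightarrow> v \<in> K" using wp unflipped by blast
        then show ?thesis using cons wK True v(3) by blast
      next
        case nA: False
        then have "A `` {w} \<inter> K' = A `` {w} \<inter> K" using others' by blast
        then show ?thesis using cons wK by blast
      qed
    qed
    have c3: "w \<in> K' \<longleftrightarrow> par w" if "w \<in> W" "r < rank w" for w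
      using others[of w] that r inv unfolding kernel_inv_def by auto
    show ?thesis using K'W c1 c2 c3 fl unfolding kernel_inv_def by blast
  qed
  then show "kernel_inv r K'" "flipped r K \<subseteq> flipped r K'" by auto
qed

lemma flipped_determines:
  assumes "kernel_inv r K" "kernel_inv r K'" "flipped r K = flipped r K'"
    "\<forall>w. rank w \<noteq> r \<longrightarrow> (w \<in> K' \<longleftrightarrow> w \<in> K)"
  shows "K' = K"
proof -
  have "w \<in> K' \<longleftrightarrow> w \<in> K" for w
  proof (cases "rank w = r \<and> w \<in> W")
    case True
    then show ?thesis using assms(3) unfolding flipped_def by blast
  next
    case False
    then show ?thesis using assms(1,2,4) unfolding kernel_inv_def by blast
  qed
  then show ?thesis by blast
qed

text \<open>The last conjunct extracts kernel conditions from a stationary sweep: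
  \<open>flipped\<close> never shrinks, so a sweep that ends where it began changed nothing in
  between, and each of its updates confirmed the vertex it visited.\<close>

lemma kernel_inv_sweep:
  assumes "kernel_inv r K"
  shows "kernel_inv r (kernel_sweep A rank W vs r K)
    \<and> flipped r K \<subseteq> flipped r (kernel_sweep A rank W vs r K)
    \<and> (\<forall>w. rank w \<noteq> r \<longrightarrow> (w \<in> kernel_sweep A rank W vs r K \<longleftrightarrow> w \<in> K))
    \<and> (kernel_sweep A rank W vs r K = K \<longrightarrow>
        (\<forall>v\<in>set vs. v \<in> W \<longrightarrow> rank v = r \<longrightarrow> (v \<in> K \<longleftrightarrow> A `` {v} \<inter> K = {})))"
  using assms
proof (induction vs arbitrary: K)
  case Nil
  then show ?case by (simp add: kernel_sweep_def)
next
  case (Cons v vs)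
  let ?L = "if rank v = r then kernel_update A W v K else K"
  have S: "kernel_sweep A rank W (v # vs) r K = kernel_sweep A rank W vs r ?L"
    by (simp add: kernel_sweep_def)
  have L: "kernel_inv r ?L" "flipped r K \<subseteq> flipped r ?L"
    "\<forall>w. rank w \<noteq> r \<longrightarrow> (w \<in> ?L \<longleftrightarrow> w \<in> K)"
    using kernel_inv_update[OF Cons.prems, of v] Cons.prems by auto
  note IH = Cons.IH[OF L(1)]
  have "v' \<in> K \<longleftrightarrow> A `` {v'} \<inter> K = {}"
    if "kernel_sweep A rank W vs r ?L = K" "v' \<in> set (v # vs)" "v' \<in> W" "rank v' = r" for v'
  proof -
    have "flipped r ?L \<subseteq> flipped r K" using IH that(1) by metis
    then have "?L = K" using flipped_determines[OF Cons.prems L(1)] L(2,3) by blast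
    then show ?thesis
      using IH that kernel_inv_update(3)[OF Cons.prems, of v] by (cases "v' = v") auto
  qed
  then show ?case unfolding S using IH L by blast
qed

text \<open>Each sweep that changes something flips a new vertex, and at most
  \<open>length vs\<close> vertices can be flipped. Hence the sweep after \<open>length vs\<close>
  sweeps would be stationary.\<close>

lemma kernel_inv_phase:
  assumes inv: "kernel_inv r K" and W: "W \<subseteq> set vs"
  shows "kernel_inv (Suc r) ((kernel_sweep A rank W vs r ^^ length vs) K)"
proof -
  let ?S = "kernel_sweep A rank W vs r"
  let ?K = "\<lambda>t. (?S ^^ t) K"
  have I: "kernel_inv r (?K t)" for t
    by (induction t) (use inv kernel_inv_sweep in auto)
  have fin: "finite (flipped r L)" "card (flipped r L) \<le> length vs" for L
  proof -
    have sub: "flipped r L \<subseteq> set vs" using W unfolding flipped_def by blast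
    then show "finite (flipped r L)" by (rule finite_subset) simp
    have "card (flipped r L) \<le> card (set vs)" using sub by (intro card_mono) auto
    then show "card (flipped r L) \<le> length vs" using card_length[of vs] by linarith
  qed
  have grow: "t \<le> card (flipped r (?K t)) \<or> ?S (?K t) = ?K t" for t
  proof (induction t)
    case (Suc t)
    show ?case
    proof (cases "?S (?K t) = ?K t")
      case False
      note sw = kernel_inv_sweep[OF I[of t], of vs]
      have "flipped r (?K t) \<noteq> flipped r (?S (?K t))"
        using flipped_determines[OF I[of t], of "?S (?K t)"] sw False by blast
      then have "card (flipped r (?K t)) < card (flipped r (?S (?K t)))"
        using sw fin by (intro psubset_card_mono) auto
      then show ?thesis using Suc False by auto
    qed simp
  qed simp
  have fix': "?S (?K (length vs)) = ?K (length vs)"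
  proof (rule ccontr)
    assume ne: "?S (?K (length vs)) \<noteq> ?K (length vs)"
    then have "length vs \<le> card (flipped r (?K (length vs)))" using grow by blast
    moreover note sw = kernel_inv_sweep[OF I[of "length vs"], of vs]
    have "flipped r (?K (length vs)) \<noteq> flipped r (?S (?K (length vs)))"
      using flipped_determines[OF I[of "length vs"], of "?S (?K (length vs))"] sw ne by blast
    then have "card (flipped r (?K (length vs))) < card (flipped r (?S (?K (length vs))))"
      using sw fin by (intro psubset_card_mono) auto
    ultimately show False using fin(2)[of "?S (?K (length vs))"] by simp
  qed
  have "\<forall>v\<in>W. rank v = r \<longrightarrow> (v \<in> ?K (length vs) \<longleftrightarrow> A `` {v} \<inter> ?K (length vs) = {})"
    using kernel_inv_sweep[OF I[of "length vs"], of vs] fix' W by blast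
  moreover define L where "L = ?K (length vs)"
  ultimately have at_r: "\<forall>v\<in>W. rank v = r \<longrightarrow> (v \<in> L \<longleftrightarrow> A `` {v} \<inter> L = {})" by simp
  have L: "L \<subseteq> W" "\<forall>v\<in>W. rank v < r \<longrightarrow> (v \<in> L \<longleftrightarrow> A `` {v} \<inter> L = {})"
    "\<forall>v\<in>W. r < rank v \<longrightarrow> (v \<in> L \<longleftrightarrow> par v)"
    using I[of "length vs"] unfolding kernel_inv_def L_def by blast+
  \<comment> \<open>Rank \<open>Suc r\<close> is still at its initial status, so the clause about
    flipped vertices holds vacuously at the start of the next phase.\<close>
  have "flipped (Suc r) L = {}" using L(3) unfolding flipped_def by auto
  moreover have "\<forall>v\<in>W. rank v < Suc r \<longrightarrow> (v \<in> L \<longleftrightarrow> A `` {v} \<inter> L = {})"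
    using at_r L(2) unfolding less_Suc_eq by blast
  moreover have "\<forall>v\<in>W. Suc r < rank v \<longrightarrow> (v \<in> L \<longleftrightarrow> par v)" using L(3) Suc_lessD by blast
  ultimately show ?thesis using L(1) unfolding kernel_inv_def L_def[symmetric] by blast
qed

end

lemma is_kernel_kernel_iter:
  assumes "kernel_labelling A rank par" "W \<subseteq> set vs" "\<forall>v\<in>W. rank v < m"
  shows "is_kernel A W (kernel_iter A rank par vs m W)"
proof -
  have "kernel_inv A rank par W r (fold (\<lambda>r. kernel_sweep A rank W vs r ^^ length vs) [0..<r] {v \<in> W. par v})" for r
  proof (induction r)
    case 0
    then show ?case
      by (auto simp: kernel_inv_def[OF assms(1)] flipped_def[OF assms(1)])
  next
    case (Suc r)
    then show ?case using kernel_inv_phase[OF assms(1) _ assms(2)] by simp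
  qed
  from this[of m] show ?thesis
    using assms(3) unfolding kernel_inv_def[OF assms(1)] is_kernel_def kernel_iter_def by blast
qed

section \<open>The accounting of missed colours, and existence of the choice\<close>

section \<open>Colouring with kernels\<close>

text \<open>Taking away \<open>P\<close> makes a second visit to a colour harmless, since its class
  is then empty. The program depends on this, as it meets the same colour in several lists.\<close>

definition colour_class :: "'a set \<Rightarrow> nat \<Rightarrow> ('a \<Rightarrow> 'c set) \<Rightarrow> 'c \<Rightarrow> ('a \<Rightarrow> 'c set) \<times> 'c set \<Rightarrow> 'a set" where
  "colour_class V k S c = (\<lambda>(C, P). {v \<in> V. c \<in> S v - P \<and> card (C v) < k})"

definition colour_step ::
  "('a set \<Rightarrow> 'a set) \<Rightarrow> 'a set \<Rightarrow> nat \<Rightarrow> ('a \<Rightarrow> 'c set) \<Rightarrow> 'c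
     \<Rightarrow> ('a \<Rightarrow> 'c set) \<times> 'c set \<Rightarrow> ('a \<Rightarrow> 'c set) \<times> 'c set" where
  "colour_step ker V k S c = (\<lambda>(C, P).
     (\<lambda>v. if v \<in> ker (colour_class V k S c (C, P)) then insert c (C v) else C v, insert c P))"

text \<open>The clause for vertices with fewer than \<open>k\<close> colours carries the count:
  whatever such a vertex missed is charged to an out-neighbour that holds it.\<close>

definition colour_inv :: "'a pair_pre_digraph \<Rightarrow> nat \<Rightarrow> ('a \<Rightarrow> 'c set) \<Rightarrow> ('a \<Rightarrow> 'c set) \<times> 'c set \<Rightarrow> bool" where
  "colour_inv D k S = (\<lambda>(C, P).
     (\<forall>v\<in>pverts D. C v \<subseteq> S v \<inter> P \<and> card (C v) \<le> k
        \<and> (card (C v) < k \<longrightarrow> S v \<inter> P \<subseteq> C v \<union> (\<Union>w\<in>parcs D `` {v}. C w)))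
     \<and> (\<forall>(u, v)\<in>parcs D. C u \<inter> C v = {}))"

text \<open>A vertex of the class that is outside the kernel has an out-neighbour inside, to which
  the loss of \<open>c\<close> is charged. Adjacent vertices do not come to share \<open>c\<close>:
  the kernel is independent, and when it is nonempty \<open>c\<close> is not yet in any
  \<open>C v\<close>.\<close>

lemma colour_inv_step:
  assumes "pair_wf_digraph D"
    and ker: "is_kernel (parcs D) (colour_class (pverts D) k S c CP) (ker (colour_class (pverts D) k S c CP))"
    and fin: "\<forall>v\<in>pverts D. finite (S v)"
    and inv: "colour_inv D k S CP"
  shows "colour_inv D k S (colour_step ker (pverts D) k S c CP)"
proof -
  obtain C P where CP: "CP = (C, P)" by (cases CP)
  define W where "W = colour_class (pverts D) k S c (C, P)"
  define K where "K = ker W"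
  define C' where "C' = (\<lambda>v. if v \<in> K then insert c (C v) else C v)"
  have W: "v \<in> W \<longleftrightarrow> v \<in> pverts D \<and> c \<in> S v \<and> c \<notin> P \<and> card (C v) < k" for v
    unfolding W_def colour_class_def by auto
  have K: "K \<subseteq> W" "\<And>v. v \<in> W \<Longrightarrow> v \<in> K \<longleftrightarrow> parcs D `` {v} \<inter> K = {}"
    using ker unfolding is_kernel_def K_def W_def CP by auto
  have I: "C v \<subseteq> S v" "C v \<subseteq> P" "card (C v) \<le> k"
    "card (C v) < k \<Longrightarrow> S v \<inter> P \<subseteq> C v \<union> (\<Union>w\<in>parcs D `` {v}. C w)" if "v \<in> pverts D" for v
    using inv that unfolding colour_inv_def CP by auto
  have disj: "C u \<inter> C v = {}" if "(u, v) \<in> parcs D" for u v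
    using inv that unfolding colour_inv_def CP by auto
  have verts: "u \<in> pverts D" "v \<in> pverts D" if "(u, v) \<in> parcs D" for u v
    using pair_wf_digraph.in_arcsD1[OF assms(1) that] pair_wf_digraph.in_arcsD2[OF assms(1) that] .
  have one: "C' v \<subseteq> S v \<inter> insert c P \<and> card (C' v) \<le> k
        \<and> (card (C' v) < k \<longrightarrow> S v \<inter> insert c P \<subseteq> C' v \<union> (\<Union>w\<in>parcs D `` {v}. C' w))"
    if v: "v \<in> pverts D" for v
  proof (cases "v \<in> K")
    case True
    then have vW: "v \<in> W" using K by blast
    have "c \<notin> C v" using vW W I(2)[OF v] by blast
    moreover have "finite (C v)" using I(1)[OF v] fin v finite_subset by blast
    ultimately have card': "card (C' v) = Suc (card (C v))"
      using True unfolding C'_def by simp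
    have "S v \<inter> P \<subseteq> C v \<union> (\<Union>w\<in>parcs D `` {v}. C w)"
      using I(4)[OF v] vW W by blast
    moreover have C_le: "C w \<subseteq> C' w" for w unfolding C'_def by auto
    then have "C v \<union> (\<Union>w\<in>parcs D `` {v}. C w) \<subseteq> C' v \<union> (\<Union>w\<in>parcs D `` {v}. C' w)" by blast
    moreover have "c \<in> C' v" using True unfolding C'_def by simp
    ultimately have "S v \<inter> insert c P \<subseteq> C' v \<union> (\<Union>w\<in>parcs D `` {v}. C' w)" by blast
    then show ?thesis using card' vW W True I[OF v] unfolding C'_def by auto
  next
    case False
    then have C'v: "C' v = C v" unfolding C'_def by simp
    have "S v \<inter> insert c P \<subseteq> C v \<union> (\<Union>w\<in>parcs D `` {v}. C' w)" if less: "card (C v) < k"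
    proof
      fix x assume x: "x \<in> S v \<inter> insert c P"
      show "x \<in> C v \<union> (\<Union>w\<in>parcs D `` {v}. C' w)"
      proof (cases "x \<in> P")
        case True
        then show ?thesis using x I(4)[OF v less] unfolding C'_def by auto
      next
        case xP: False
        then have "v \<in> W" "x = c" using x v W less by auto
        then obtain w where "w \<in> parcs D `` {v} \<inter> K" using K(2) False by blast
        then show ?thesis using \<open>x = c\<close> unfolding C'_def by auto
      qed
    qed
    then show ?thesis using C'v I[OF v] by auto
  qed
  have "C' u \<inter> C' v = {}" if uv: "(u, v) \<in> parcs D" for u v
  proof -
    have "\<not> (u \<in> K \<and> v \<in> K)" using K uv by blast
    moreover have "u \<in> K \<Longrightarrow> c \<notin> C v" "v \<in> K \<Longrightarrow> c \<notin> C u"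
      using K(1) W I(2) verts[OF uv] by blast+
    ultimately show ?thesis using disj[OF uv] unfolding C'_def by auto
  qed
  moreover have "colour_step ker (pverts D) k S c CP = (C', insert c P)"
    unfolding colour_step_def CP prod.case C'_def K_def W_def ..
  ultimately show ?thesis using one unfolding colour_inv_def by simp blast
qed

lemma colour_inv_fold:
  assumes "pair_wf_digraph D"
    and "\<And>W. W \<subseteq> pverts D \<Longrightarrow> is_kernel (parcs D) W (ker W)"
    and "\<forall>v\<in>pverts D. finite (S v)"
  shows "colour_inv D k S (fold (colour_step ker (pverts D) k S) cs (\<lambda>_. {}, {}))"
    and "snd (fold (colour_step ker (pverts D) k S) cs (\<lambda>_. {}, {})) = set cs"
proof (induction cs rule: rev_induct)
  case Nil
  { case 1 then show ?case by (auto simp: colour_inv_def) }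
  { case 2 then show ?case by simp }
next
  case (snoc c cs)
  { case 1 then show ?case
      using colour_inv_step[OF assms(1) _ assms(3) snoc(1), of c ker] assms(2)
      by (simp add: colour_class_def split_beta subset_iff) }
  { case 2 then show ?case using snoc(2) by (simp add: colour_step_def split_beta) }
qed

lemma out_degree_with_proj: "out_degree (with_proj D) v = card (parcs D `` {v})"
proof -
  have "out_arcs (with_proj D) v = Pair v ` (parcs D `` {v})" by (auto simp: out_arcs_def)
  then show ?thesis unfolding out_degree_def by (simp add: card_image inj_on_def)
qed

lemma colour_inv_proper_choice:
  assumes "choice_instance D k S" "colour_inv D k S (C, P)" "\<forall>v\<in>pverts D. S v \<subseteq> P"
  shows "proper_choice D k S C"
proof -
  interpret pair_digraph D using assms(1) unfolding choice_instance_def oriented_graph_def by simp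
  have fin: "finite (S v)" and card_S: "card (S v) = k * (out_degree (with_proj D) v + 1)"
    if "v \<in> pverts D" for v
    using that assms(1) unfolding choice_instance_def by auto
  have I: "C v \<subseteq> S v" "card (C v) \<le> k"
    "card (C v) < k \<Longrightarrow> S v \<subseteq> C v \<union> (\<Union>w\<in>parcs D `` {v}. C w)" if "v \<in> pverts D" for v
    using assms(2,3) that unfolding colour_inv_def by blast+
  have "card (C v) = k" if v: "v \<in> pverts D" for v
  proof (rule ccontr)
    assume "card (C v) \<noteq> k"
    then have less: "card (C v) < k" using I(2)[OF v] by simp
    have nb: "parcs D `` {v} \<subseteq> pverts D" using in_arcsD2 by blast
    have fin_nb: "finite (parcs D `` {v})" using finite_subset[OF nb] by simp
    have fin_C: "finite (C w)" if "w \<in> pverts D" for w using I(1)[OF that] fin[OF that] finite_subset by blast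
    have "card (S v) \<le> card (C v \<union> (\<Union>w\<in>parcs D `` {v}. C w))"
      using I(3)[OF v less] fin_nb fin_C nb v by (intro card_mono) auto
    also have "\<dots> \<le> card (C v) + card (\<Union>w\<in>parcs D `` {v}. C w)" by (rule card_Un_le)
    also have "card (\<Union>w\<in>parcs D `` {v}. C w) \<le> (\<Sum>w\<in>parcs D `` {v}. card (C w))"
      by (rule card_UN_le[OF fin_nb])
    also have "\<dots> \<le> (\<Sum>w\<in>parcs D `` {v}. k)" using I(2) nb by (intro sum_mono) blast
    also have "\<dots> = k * out_degree (with_proj D) v" by (simp add: out_degree_with_proj)
    finally show False using card_S[OF v] less by simp
  qed
  moreover have "C u \<inter> C v = {}" if "(u, v) \<in> parcs D \<or> (v, u) \<in> parcs D" for u v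
    using assms(2) that unfolding colour_inv_def by auto
  ultimately show ?thesis using I(1) unfolding proper_choice_def by blast
qed

text \<open>The cover has two nodes for each vertex, so the ranks lie between 0 and
  \<open>2 * length vs\<close>; this gives the number of phases.\<close>

definition reach_kernel :: "'a rel \<Rightarrow> 'a list \<Rightarrow> 'a set \<Rightarrow> 'a set" where
  "reach_kernel A vs =
     (let R = (double_cover A)\<^sup>* in
      kernel_iter A (reach_rank R) (reach_par R vs) vs (Suc (2 * length vs)))"

lemma reach_rank_le:
  assumes "A \<subseteq> V \<times> V" "finite V" "v \<in> V"
  shows "reach_rank ((double_cover A)\<^sup>*) v \<le> 2 * card V"
proof -
  have "{z. ((v, False), z) \<in> (double_cover A)\<^sup>*} \<subseteq> V \<times> UNIV"
    using double_cover_rtrancl_fst[OF _ assms(1)] assms(3) by fastforce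
  then have "reach_rank ((double_cover A)\<^sup>*) v \<le> card (V \<times> (UNIV :: bool set))"
    unfolding reach_rank_def using assms(2) by (intro card_mono) auto
  then show ?thesis by (simp add: card_cartesian_product)
qed

lemma is_kernel_reach_kernel:
  assumes "pair_wf_digraph D" "no_odd_cycle D" "set vs = pverts D" "W \<subseteq> pverts D"
  shows "is_kernel (parcs D) W (reach_kernel (parcs D) vs W)"
proof -
  interpret pair_wf_digraph D by fact
  have A: "parcs D \<subseteq> pverts D \<times> pverts D" using in_arcsD1 in_arcsD2 by auto
  have fin: "finite (pverts D)" using assms(3) finite_set by metis
  have "reach_rank ((double_cover (parcs D))\<^sup>*) v < Suc (2 * length vs)" if "v \<in> W" for v
    using reach_rank_le[OF A fin, of v] that assms(3,4) card_length[of vs] by auto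
  then show ?thesis
    unfolding reach_kernel_def Let_def
    using reach_labelling[OF fin A assms(3)] no_odd_cycle_double_cover[OF assms(1,2)] assms(3,4)
    by (intro is_kernel_kernel_iter) auto
qed

lemma choice_instance_imp_proper_choice:
  assumes "choice_instance D k S"
  shows "\<exists>C. proper_choice D k S C"
proof -
  interpret pair_digraph D using assms(1) unfolding choice_instance_def oriented_graph_def by simp
  have D: "pair_wf_digraph D" "no_odd_cycle D" "\<forall>v\<in>pverts D. finite (S v)"
    using assms unfolding choice_instance_def by (auto intro: pair_wf_digraph_axioms)
  obtain vs where vs: "set vs = pverts D" using finite_list finite_verts by (metis with_proj_simps(1))
  obtain cs where cs: "set cs = (\<Union>v\<in>pverts D. S v)"
    using finite_list[of "\<Union>v\<in>pverts D. S v"] D(3) by auto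
  obtain C P where CP: "fold (colour_step (reach_kernel (parcs D) vs) (pverts D) k S) cs (\<lambda>_. {}, {}) = (C, P)"
    by (meson surj_pair)
  then have "colour_inv D k S (C, P)" "P = set cs"
    using colour_inv_fold[OF D(1) is_kernel_reach_kernel[OF D(1,2) vs] D(3), of k cs] by auto
  then have "proper_choice D k S C" using colour_inv_proper_choice[OF assms] cs by auto
  then show ?thesis by blast
qed

section \<open>Warshall's algorithm\<close>

definition warshall_step :: "'a \<Rightarrow> 'a rel \<Rightarrow> 'a rel" where
  "warshall_step k r = r \<union> {(i, j). (i, k) \<in> r \<and> (k, j) \<in> r}"

text \<open>The invariant does not mention paths: after \<open>ks\<close> the relation is closed
  under composition at every vertex of \<open>ks\<close>. Once \<open>ks\<close> covers the field
  this is transitivity, and a transitive relation between \<open>r\<close> and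
  \<open>r\<^sup>+\<close> equals \<open>r\<^sup>+\<close>.\<close>

lemma warshall:
  assumes "Field r \<subseteq> set ks"
  shows "fold warshall_step ks r = r\<^sup>+"
proof -
  have main: "r \<subseteq> fold warshall_step ks r \<and> fold warshall_step ks r \<subseteq> r\<^sup>+
      \<and> (\<forall>m\<in>set ks. \<forall>i j. (i, m) \<in> fold warshall_step ks r \<longrightarrow> (m, j) \<in> fold warshall_step ks r
            \<longrightarrow> (i, j) \<in> fold warshall_step ks r)" for ks
  proof (induction ks rule: rev_induct)
    case (snoc k ks)
    define f where "f = fold warshall_step ks r"
    have IH: "r \<subseteq> f" "f \<subseteq> r\<^sup>+" "\<And>m i j. m \<in> set ks \<Longrightarrow> (i, m) \<in> f \<Longrightarrow> (m, j) \<in> f \<Longrightarrow> (i, j) \<in> f"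
      using snoc unfolding f_def by blast+
    have F: "fold warshall_step (ks @ [k]) r = warshall_step k f" by (simp add: f_def)
    have "r \<subseteq> warshall_step k f" using IH(1) unfolding warshall_step_def by blast
    moreover have "warshall_step k f \<subseteq> r\<^sup>+"
      using IH(2) unfolding warshall_step_def by (blast intro: trancl_trans)
    moreover have "(i, j) \<in> warshall_step k f"
      if "m \<in> set (ks @ [k])" "(i, m) \<in> warshall_step k f" "(m, j) \<in> warshall_step k f" for m i j
      using that IH(3) unfolding warshall_step_def by auto
    ultimately show ?case unfolding F by blast
  qed (auto intro: r_into_trancl')
  have "trans (fold warshall_step ks r)"
  proof (rule transI)
    fix i m j assume *: "(i, m) \<in> fold warshall_step ks r" "(m, j) \<in> fold warshall_step ks r"
    then have "m \<in> Field (r\<^sup>+)" using main[of ks] by (auto intro: FieldI1)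
    then have "m \<in> set ks" using assms by (auto simp: Field_def)
    with main[of ks] * show "(i, j) \<in> fold warshall_step ks r" by blast
  qed
  then have "r\<^sup>+ \<subseteq> fold warshall_step ks r"
    using main[of ks] trancl_mono_subset trancl_id by metis
  then show ?thesis using main[of ks] by blast
qed

section \<open>Loop programs, their meaning, and what they leave unchanged\<close>

section \<open>A language of bounded loops\<close>

datatype aexp = Num nat | Var nat | Arr nat aexp | Plus aexp aexp | Minus aexp aexp

text \<open>With counted loops only, termination is automatic, and the running time is controlled by
  the values of the bounding variables and the nesting depth.\<close>

datatype com =
    Assign nat aexp
  | Update nat aexp aexp
  | Input nat
  | Output aexp
  | Seq com com (infixr ";;" 60)
  | Cond aexp com com
  | For nat nat com

record state =
  vars :: "nat \<Rightarrow> nat"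
  arrs :: "nat \<Rightarrow> nat \<Rightarrow> nat"
  inp :: "nat list"
  outp :: "nat list"

fun aval :: "aexp \<Rightarrow> state \<Rightarrow> nat" where
  "aval (Num c) s = c"
| "aval (Var x) s = vars s x"
| "aval (Arr a e) s = arrs s a (aval e s)"
| "aval (Plus e f) s = aval e s + aval f s"
| "aval (Minus e f) s = aval e s - aval f s"

definition set_var :: "nat \<Rightarrow> nat \<Rightarrow> state \<Rightarrow> state" where
  "set_var x c s = s\<lparr>vars := (vars s)(x := c)\<rparr>"

definition set_arr :: "nat \<Rightarrow> nat \<Rightarrow> nat \<Rightarrow> state \<Rightarrow> state" where
  "set_arr a i c s = s\<lparr>arrs := (arrs s)(a := (arrs s a)(i := c))\<rparr>"

lemma set_var_simps [simp]:
  "vars (set_var x c s) = (vars s)(x := c)" "arrs (set_var x c s) = arrs s"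
  "inp (set_var x c s) = inp s" "outp (set_var x c s) = outp s"
  by (simp_all add: set_var_def)

lemma set_arr_simps [simp]:
  "arrs (set_arr a i c s) = (arrs s)(a := (arrs s a)(i := c))" "vars (set_arr a i c s) = vars s"
  "inp (set_arr a i c s) = inp s" "outp (set_arr a i c s) = outp s"
  by (simp_all add: set_arr_def)

fun sem :: "com \<Rightarrow> state \<Rightarrow> state" where
  "sem (Assign x e) s = set_var x (aval e s) s"
| "sem (Update a e f) s = set_arr a (aval e s) (aval f s) s"
| "sem (Input x) s = set_var x (case inp s of [] \<Rightarrow> 0 | c # _ \<Rightarrow> c) (s\<lparr>inp := tl (inp s)\<rparr>)"
| "sem (Output e) s = s\<lparr>outp := outp s @ [aval e s]\<rparr>"
| "sem (c ;; d) s = sem d (sem c s)"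
| "sem (Cond e c d) s = (if 0 < aval e s then sem c s else sem d s)"
| "sem (For i b c) s =
     ((\<lambda>s. set_var i (Suc (vars s i)) (sem c s)) ^^ vars s b) (set_var i 0 s)"

fun var_writes :: "com \<Rightarrow> nat set" where
  "var_writes (Assign x e) = {x}"
| "var_writes (Update a e f) = {}"
| "var_writes (Input x) = {x}"
| "var_writes (Output e) = {}"
| "var_writes (c ;; d) = var_writes c \<union> var_writes d"
| "var_writes (Cond e c d) = var_writes c \<union> var_writes d"
| "var_writes (For i b c) = insert i (var_writes c)"

fun arr_writes :: "com \<Rightarrow> nat set" where
  "arr_writes (Assign x e) = {}"
| "arr_writes (Update a e f) = {a}"
| "arr_writes (Input x) = {}"
| "arr_writes (Output e) = {}"
| "arr_writes (c ;; d) = arr_writes c \<union> arr_writes d"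
| "arr_writes (Cond e c d) = arr_writes c \<union> arr_writes d"
| "arr_writes (For i b c) = arr_writes c"

fun reads :: "com \<Rightarrow> bool" where
  "reads (Input x) = True"
| "reads (c ;; d) = (reads c \<or> reads d)"
| "reads (Cond e c d) = (reads c \<or> reads d)"
| "reads (For i b c) = reads c"
| "reads _ = False"

fun writes :: "com \<Rightarrow> bool" where
  "writes (Output x) = True"
| "writes (c ;; d) = (writes c \<or> writes d)"
| "writes (Cond e c d) = (writes c \<or> writes d)"
| "writes (For i b c) = writes c"
| "writes _ = False"

lemma sem_frame:
  shows sem_vars: "x \<notin> var_writes c \<Longrightarrow> vars (sem c s) x = vars s x"
    and sem_arrs: "a \<notin> arr_writes c \<Longrightarrow> arrs (sem c s) a = arrs s a"
    and sem_inp: "\<not> reads c \<Longrightarrow> inp (sem c s) = inp s"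
    and sem_outp: "\<not> writes c \<Longrightarrow> outp (sem c s) = outp s"
proof (induction c arbitrary: s)
  case (For i b c)
  let ?body = "\<lambda>s. set_var i (Suc (vars s i)) (sem c s)"
  { case 1
    then have "vars ((?body ^^ n) t) x = vars t x" for n t
      by (induction n) (use For(1) in auto)
    with 1 show ?case by simp }
  { case 2
    then have "arrs ((?body ^^ n) t) a = arrs t a" for n t
      by (induction n) (use For(2) in auto)
    then show ?case by simp }
  { case 3
    then have "inp ((?body ^^ n) t) = inp t" for n t
      by (induction n) (use For(3) in auto)
    then show ?case by simp }
  { case 4
    then have "outp ((?body ^^ n) t) = outp t" for n t
      by (induction n) (use For(4) in auto)
    then show ?case by simp }
qed auto

definition agree_outside :: "nat \<Rightarrow> com \<Rightarrow> state \<Rightarrow> state \<Rightarrow> bool" where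
  "agree_outside i c s t \<longleftrightarrow> (\<forall>x. x \<notin> insert i (var_writes c) \<longrightarrow> vars t x = vars s x)
     \<and> (\<forall>a. a \<notin> arr_writes c \<longrightarrow> arrs t a = arrs s a)
     \<and> (\<not> reads c \<longrightarrow> inp t = inp s) \<and> (\<not> writes c \<longrightarrow> outp t = outp s)"

lemma agree_outsideD:
  assumes "agree_outside i c s t"
  shows "x \<notin> insert i (var_writes c) \<Longrightarrow> vars t x = vars s x"
    and "a \<notin> arr_writes c \<Longrightarrow> arrs t a = arrs s a"
    and "\<not> reads c \<Longrightarrow> inp t = inp s"
    and "\<not> writes c \<Longrightarrow> outp t = outp s"
  using assms unfolding agree_outside_def by auto

text \<open>The step may also assume the value of the counter and that the state agrees with the
  initial one outside what the body writes. So \<open>I\<close> has to describe only what the loop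
  changes.\<close>

lemma For_invariant:
  assumes "i \<notin> var_writes c"
    and base: "I 0 (set_var i 0 s)"
    and step: "\<And>j t. j < vars s b \<Longrightarrow> I j t \<Longrightarrow> vars t i = j \<Longrightarrow> agree_outside i c s t
        \<Longrightarrow> I (Suc j) (set_var i (Suc j) (sem c t))"
  shows "I (vars s b) (sem (For i b c) s)"
proof -
  let ?body = "\<lambda>s. set_var i (Suc (vars s i)) (sem c s)"
  let ?t = "\<lambda>j. (?body ^^ j) (set_var i 0 s)"
  have frame: "vars (?t j) i = j" "agree_outside i c s (?t j)" for j
    unfolding agree_outside_def by (induction j) (auto simp: sem_frame)
  have "j \<le> vars s b \<Longrightarrow> I j (?t j)" for j
  proof (induction j)
    case (Suc j)
    have "I (Suc j) (set_var i (Suc j) (sem c (?t j)))"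
      using Suc by (intro step frame) auto
    then show ?case using frame(1)[of j] by simp
  qed (simp add: base)
  then show ?thesis by simp
qed

section \<open>Exact simulation of loop programs on the machine\<close>

section \<open>Compilation to the random access machine\<close>

text \<open>Address \<open>32 * i + a\<close> holds variable \<open>i\<close> if \<open>a = 0\<close>, the \<open>i\<close>-th temporary if \<open>a = 1\<close>, and
  entry \<open>i\<close> of array \<open>a\<close> if \<open>a \<ge> 2\<close>; interleaving the arrays keeps them unbounded without
  memory management.\<close>

definition reg :: "nat \<Rightarrow> nat" where "reg x = 32 * x"
definition tmp :: "nat \<Rightarrow> nat" where "tmp d = 32 * d + 1"

text \<open>Five doublings multiply the index by 32. The next temporary is used as scratch for the
  array number.\<close>

definition addr_code :: "nat \<Rightarrow> nat \<Rightarrow> instr list" where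
  "addr_code a d =
     [Add (tmp d) (tmp d) (tmp d), Add (tmp d) (tmp d) (tmp d), Add (tmp d) (tmp d) (tmp d),
      Add (tmp d) (tmp d) (tmp d), Add (tmp d) (tmp d) (tmp d),
      Const (tmp (Suc d)) a, Add (tmp d) (tmp d) (tmp (Suc d))]"

text \<open>The temporaries form a stack: code at height \<open>d\<close> preserves all below
  \<open>d\<close>, so a left operand survives the evaluation of the right one.\<close>

fun aexp_code :: "aexp \<Rightarrow> nat \<Rightarrow> instr list" where
  "aexp_code (Num c) d = [Const (tmp d) c]"
| "aexp_code (Var x) d = [Const (tmp d) 0, Add (tmp d) (tmp d) (reg x)]"
| "aexp_code (Arr a e) d = aexp_code e d @ addr_code a d @ [Load (tmp d) (tmp d)]"
| "aexp_code (Plus e f) d = aexp_code e d @ aexp_code f (Suc d) @ [Add (tmp d) (tmp d) (tmp (Suc d))]"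
| "aexp_code (Minus e f) d = aexp_code e d @ aexp_code f (Suc d) @ [Sub (tmp d) (tmp d) (tmp (Suc d))]"

text \<open>The length of the code does not depend on its position. Defining it separately lets
  \<open>com_code\<close> compute forward jump targets.\<close>

fun com_size :: "com \<Rightarrow> nat" where
  "com_size (Assign x e) = length (aexp_code e 0) + 2"
| "com_size (Update a e f) = length (aexp_code e 0) + 8 + length (aexp_code f 1)"
| "com_size (Input x) = 1"
| "com_size (Output e) = length (aexp_code e 0) + 1"
| "com_size (c ;; d) = com_size c + com_size d"
| "com_size (Cond e c d) = length (aexp_code e 0) + com_size d + com_size c + 3"
| "com_size (For i b c) = com_size c + 8"

text \<open>An unconditional jump is a \<open>Jump_pos\<close> on a temporary that has just been set
  to 1. In a conditional the code of the false branch comes first.\<close>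

fun com_code :: "nat \<Rightarrow> com \<Rightarrow> instr list" where
  "com_code q (Assign x e) = aexp_code e 0 @ [Const (tmp 1) 0, Add (reg x) (tmp 0) (tmp 1)]"
| "com_code q (Update a e f) =
     aexp_code e 0 @ addr_code a 0 @ aexp_code f 1 @ [Store (tmp 0) (tmp 1)]"
| "com_code q (Input x) = [Read (reg x)]"
| "com_code q (Output e) = aexp_code e 0 @ [Print (tmp 0)]"
| "com_code q (c ;; d) = com_code q c @ com_code (q + com_size c) d"
| "com_code q (Cond e c d) =
     (let q1 = q + length (aexp_code e 0) + 1; q2 = q1 + com_size d + 2 in
      aexp_code e 0 @ [Jump_pos (tmp 0) q2] @ com_code q1 d
      @ [Const (tmp 0) 1, Jump_pos (tmp 0) (q2 + com_size c)] @ com_code q2 c)"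
| "com_code q (For i b c) =
     [Const (reg i) 0, Sub (tmp 0) (reg b) (reg i), Jump_pos (tmp 0) (q + 5), Const (tmp 0) 1,
      Jump_pos (tmp 0) (q + com_size c + 8)]
     @ com_code (q + 5) c
     @ [Const (tmp 0) 1, Add (reg i) (reg i) (tmp 0), Jump_pos (tmp 0) (q + 1)]"

lemma length_com_code [simp]: "length (com_code q c) = com_size c"
  by (induction c arbitrary: q) (simp_all add: addr_code_def Let_def)

fun arrays_ok_exp :: "aexp \<Rightarrow> bool" where
  "arrays_ok_exp (Num c) = True"
| "arrays_ok_exp (Var x) = True"
| "arrays_ok_exp (Arr a e) = (2 \<le> a \<and> a < 32 \<and> arrays_ok_exp e)"
| "arrays_ok_exp (Plus e f) = (arrays_ok_exp e \<and> arrays_ok_exp f)"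
| "arrays_ok_exp (Minus e f) = (arrays_ok_exp e \<and> arrays_ok_exp f)"

text \<open>The compiled loop rereads its bound and counter in every round, whereas
  \<open>sem\<close> fixes the number of rounds at entry; they agree because the body writes
  neither. Array numbers 0 and 1 would collide with variables and temporaries.\<close>

fun com_ok :: "com \<Rightarrow> bool" where
  "com_ok (Assign x e) = arrays_ok_exp e"
| "com_ok (Update a e f) = (2 \<le> a \<and> a < 32 \<and> arrays_ok_exp e \<and> arrays_ok_exp f)"
| "com_ok (Input x) = True"
| "com_ok (Output e) = arrays_ok_exp e"
| "com_ok (c ;; d) = (com_ok c \<and> com_ok d)"
| "com_ok (Cond e c d) = (arrays_ok_exp e \<and> com_ok c \<and> com_ok d)"
| "com_ok (For i b c) = (i \<noteq> b \<and> i \<notin> var_writes c \<and> b \<notin> var_writes c \<and> com_ok c)"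

text \<open>These are exact step counts. A round of a loop costs 5 steps besides its body: 2 for the
  test, 3 for advancing the counter and jumping back. The other 5 are the initialisation and the
  final test with its exit jump.\<close>

fun run_time :: "com \<Rightarrow> state \<Rightarrow> nat" where
  "run_time (Assign x e) s = com_size (Assign x e)"
| "run_time (Update a e f) s = com_size (Update a e f)"
| "run_time (Input x) s = 1"
| "run_time (Output e) s = com_size (Output e)"
| "run_time (c ;; d) s = run_time c s + run_time d (sem c s)"
| "run_time (Cond e c d) s =
     length (aexp_code e 0) + 1 + (if 0 < aval e s then run_time c s else run_time d s + 2)"
| "run_time (For i b c) s =
     5 + (\<Sum>j<vars s b. run_time c (((\<lambda>s. set_var i (Suc (vars s i)) (sem c s)) ^^ j) (set_var i 0 s)) + 5)"

text \<open>Temporaries are left free, so writing to them never disturbs the correspondence.\<close>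

definition represents :: "(nat \<Rightarrow> nat) \<Rightarrow> state \<Rightarrow> bool" where
  "represents X s \<longleftrightarrow> (\<forall>x. X (reg x) = vars s x)
     \<and> (\<forall>a i. 2 \<le> a \<longrightarrow> a < 32 \<longrightarrow> X (32 * i + a) = arrs s a i)"

definition embedded :: "instr list \<Rightarrow> nat \<Rightarrow> instr list \<Rightarrow> bool" where
  "embedded P q code \<longleftrightarrow> (\<exists>pre post. P = pre @ code @ post \<and> q = length pre)"

lemma embedded_append:
  "embedded P q (c @ d) \<longleftrightarrow> embedded P q c \<and> embedded P (q + length c) d"
proof
  assume "embedded P q (c @ d)"
  then obtain pre post where P: "P = pre @ (c @ d) @ post" "q = length pre" unfolding embedded_def by blast
  then have "P = pre @ c @ (d @ post)" "P = (pre @ c) @ d @ post" by auto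
  then show "embedded P q c \<and> embedded P (q + length c) d"
    unfolding embedded_def using P(2) length_append by metis
next
  assume "embedded P q c \<and> embedded P (q + length c) d"
  then obtain pre post pre' post' where P: "P = pre @ c @ post" "q = length pre"
    "P = pre' @ d @ post'" "q + length c = length pre'" unfolding embedded_def by blast
  then have "pre' = pre @ c"
    by (metis append.assoc append_eq_append_conv length_append)
  then show "embedded P q (c @ d)" unfolding embedded_def using P by auto
qed

text \<open>Splits off one instruction. Only three shapes of tail are listed, because as a rewrite
  rule the version for an arbitrary tail would apply to \<open>[x]\<close> again and again.\<close>

lemma embedded_Cons:
  "embedded P q (x # y # d) \<longleftrightarrow> embedded P q [x] \<and> embedded P (Suc q) (y # d)"
  "embedded P q (x # c @ d) \<longleftrightarrow> embedded P q [x] \<and> embedded P (Suc q) (c @ d)"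
  "embedded P q (x # com_code q' a) \<longleftrightarrow> embedded P q [x] \<and> embedded P (Suc q) (com_code q' a)"
  using embedded_append[of P q "[x]" "y # d"] embedded_append[of P q "[x]" "c @ d"]
    embedded_append[of P q "[x]" "com_code q' a"] by simp_all

lemma step_embedded:
  assumes "embedded P q [x]"
  shows "step P (q, X, ins, outs) = exec x (q, X, ins, outs)"
  using assms unfolding embedded_def step_def by (auto simp: nth_append)

definition reaches :: "instr list \<Rightarrow> config \<Rightarrow> nat \<Rightarrow> config \<Rightarrow> bool" where
  "reaches P c t c' \<longleftrightarrow> (step P ^^ t) c = c'"

lemma reaches_trans:
  "reaches P c t c' \<Longrightarrow> reaches P c' t' c'' \<Longrightarrow> reaches P c (t + t') c''"
  unfolding reaches_def by (simp add: add.commute[of t] funpow_add)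

lemma array_address_eq:
  assumes "a < 32" "b < 32"
  shows "32 * i + a = 32 * j + b \<longleftrightarrow> i = j \<and> a = (b :: nat)"
proof
  assume eq: "32 * i + a = 32 * j + b"
  have "a = (32 * i + a) mod 32" using assms by simp
  also have "\<dots> = (32 * j + b) mod 32" by (simp only: eq)
  also have "\<dots> = b" using assms by simp
  finally show "i = j \<and> a = b" using eq by simp
qed simp

lemma tmp_eq [simp]: "tmp d = tmp e \<longleftrightarrow> d = e" "tmp d \<noteq> reg x" "reg x \<noteq> tmp d" "reg x = reg y \<longleftrightarrow> x = y"
  using array_address_eq[of 1 1 d e] array_address_eq[of 1 0 d x] array_address_eq[of 0 0 x y]
  unfolding tmp_def reg_def by auto

lemma array_address_neq:
  assumes "2 \<le> a" "a < 32"
  shows "32 * i + a \<noteq> tmp d" "32 * i + a \<noteq> reg x" "reg x \<noteq> 32 * i + a"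
  using array_address_eq[of a 1 i d] array_address_eq[of a 0 i x] assms unfolding tmp_def reg_def by auto

lemma represents_tmp [simp]: "represents (X(tmp d := c)) s \<longleftrightarrow> represents X s"
  unfolding represents_def by (auto simp: array_address_neq)

lemma represents_set_var: "represents X s \<Longrightarrow> represents (X(reg x := c)) (set_var x c s)"
  unfolding represents_def by (auto simp: array_address_neq)

lemma represents_set_arr:
  "represents X s \<Longrightarrow> 2 \<le> a \<Longrightarrow> a < 32 \<Longrightarrow> represents (X(32 * i + a := c)) (set_arr a i c s)"
  unfolding represents_def by (simp add: array_address_neq array_address_eq)

lemma length_addr_code [simp]: "length (addr_code a d) = 7"
  by (simp add: addr_code_def)

lemma addr_code_correct:
  assumes "embedded P q (addr_code a d)" "represents X s"
  shows "\<exists>X'. reaches P (q, X, ins, outs) 7 (q + 7, X', ins, outs) \<and> represents X' s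
    \<and> X' (tmp d) = 32 * X (tmp d) + a \<and> (\<forall>e<d. X' (tmp e) = X (tmp e))"
proof -
  have seven: "(7 :: nat) = Suc (Suc (Suc (Suc (Suc (Suc (Suc 0))))))" by simp
  have emb: "embedded P q [Add (tmp d) (tmp d) (tmp d)]"
    "embedded P (Suc q) [Add (tmp d) (tmp d) (tmp d)]"
    "embedded P (Suc (Suc q)) [Add (tmp d) (tmp d) (tmp d)]"
    "embedded P (Suc (Suc (Suc q))) [Add (tmp d) (tmp d) (tmp d)]"
    "embedded P (Suc (Suc (Suc (Suc q)))) [Add (tmp d) (tmp d) (tmp d)]"
    "embedded P (Suc (Suc (Suc (Suc (Suc q))))) [Const (tmp (Suc d)) a]"
    "embedded P (Suc (Suc (Suc (Suc (Suc (Suc q)))))) [Add (tmp d) (tmp d) (tmp (Suc d))]"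
    using assms(1) by (simp_all add: addr_code_def embedded_Cons)
  show ?thesis
    unfolding seven reaches_def using assms(2) by (simp add: emb[THEN step_embedded])
qed

lemma aexp_code_correct:
  assumes "embedded P q (aexp_code e d)" "represents X s" "arrays_ok_exp e"
  shows "\<exists>X'. reaches P (q, X, ins, outs) (length (aexp_code e d)) (q + length (aexp_code e d), X', ins, outs)
    \<and> represents X' s \<and> X' (tmp d) = aval e s \<and> (\<forall>d'<d. X' (tmp d') = X (tmp d'))"
  using assms
proof (induction e arbitrary: q d X)
  case (Num c)
  then show ?case by (simp add: reaches_def step_embedded)
next
  case (Var x)
  then have "embedded P q [Const (tmp d) 0]" "embedded P (Suc q) [Add (tmp d) (tmp d) (reg x)]"
    by (simp_all add: embedded_Cons)
  then show ?case using Var(2) by (simp add: reaches_def step_embedded) (simp add: represents_def)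
next
  case (Arr a e)
  let ?n = "length (aexp_code e d)"
  have emb: "embedded P q (aexp_code e d)" "embedded P (q + ?n) (addr_code a d)"
    "embedded P (q + ?n + 7) [Load (tmp d) (tmp d)]"
    using Arr.prems(1) by (simp_all add: embedded_append add.assoc)
  obtain X1 where X1: "reaches P (q, X, ins, outs) ?n (q + ?n, X1, ins, outs)" "represents X1 s"
    "X1 (tmp d) = aval e s" "\<forall>d'<d. X1 (tmp d') = X (tmp d')"
    using Arr.IH[OF emb(1) Arr.prems(2)] Arr.prems(3) by auto
  obtain X2 where X2: "reaches P (q + ?n, X1, ins, outs) 7 (q + ?n + 7, X2, ins, outs)" "represents X2 s"
    "X2 (tmp d) = 32 * X1 (tmp d) + a" "\<forall>d'<d. X2 (tmp d') = X1 (tmp d')"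
    using addr_code_correct[OF emb(2) X1(2)] by blast
  define Y where "Y = X2(tmp d := X2 (X2 (tmp d)))"
  have "reaches P (q + ?n + 7, X2, ins, outs) 1 (q + ?n + 8, Y, ins, outs)"
    using emb(3) by (simp add: reaches_def step_embedded Y_def)
  then have "reaches P (q, X, ins, outs) (?n + 7 + 1) (q + ?n + 8, Y, ins, outs)"
    using reaches_trans[OF reaches_trans[OF X1(1) X2(1)]] by blast
  moreover have "Y (tmp d) = arrs s a (aval e s)"
    using X2(2,3) X1(3) Arr.prems(3) by (simp add: represents_def Y_def)
  moreover have "represents Y s" "\<forall>d'<d. Y (tmp d') = X (tmp d')"
    using X1(4) X2(2,4) by (simp_all add: Y_def)
  ultimately show ?case by (intro exI[of _ Y]) (simp add: add_ac)
next
  case (Plus e f)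
  let ?n = "length (aexp_code e d)" and ?m = "length (aexp_code f (Suc d))"
  have emb: "embedded P q (aexp_code e d)" "embedded P (q + ?n) (aexp_code f (Suc d))"
    "embedded P (q + ?n + ?m) [Add (tmp d) (tmp d) (tmp (Suc d))]"
    using Plus.prems(1) by (simp_all add: embedded_append add.assoc)
  obtain X1 where X1: "reaches P (q, X, ins, outs) ?n (q + ?n, X1, ins, outs)" "represents X1 s"
    "X1 (tmp d) = aval e s" "\<forall>d'<d. X1 (tmp d') = X (tmp d')"
    using Plus.IH(1)[OF emb(1) Plus.prems(2)] Plus.prems(3) by auto
  obtain X2 where X2: "reaches P (q + ?n, X1, ins, outs) ?m (q + ?n + ?m, X2, ins, outs)" "represents X2 s"
    "X2 (tmp (Suc d)) = aval f s" "\<forall>d'<Suc d. X2 (tmp d') = X1 (tmp d')"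
    using Plus.IH(2)[OF emb(2) X1(2)] Plus.prems(3) by auto
  define Y where "Y = X2(tmp d := X2 (tmp d) + X2 (tmp (Suc d)))"
  have "reaches P (q + ?n + ?m, X2, ins, outs) 1 (q + ?n + ?m + 1, Y, ins, outs)"
    using emb(3) by (simp add: reaches_def step_embedded Y_def)
  then have "reaches P (q, X, ins, outs) (?n + ?m + 1) (q + ?n + ?m + 1, Y, ins, outs)"
    using reaches_trans[OF reaches_trans[OF X1(1) X2(1)]] by blast
  moreover have "represents Y s" "Y (tmp d) = aval (Plus e f) s" "\<forall>d'<d. Y (tmp d') = X (tmp d')"
    using X1(3,4) X2(2,3,4) by (simp_all add: Y_def)
  ultimately show ?case by (intro exI[of _ Y]) (simp add: add_ac)
next
  case (Minus e f)
  let ?n = "length (aexp_code e d)" and ?m = "length (aexp_code f (Suc d))"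
  have emb: "embedded P q (aexp_code e d)" "embedded P (q + ?n) (aexp_code f (Suc d))"
    "embedded P (q + ?n + ?m) [Sub (tmp d) (tmp d) (tmp (Suc d))]"
    using Minus.prems(1) by (simp_all add: embedded_append add.assoc)
  obtain X1 where X1: "reaches P (q, X, ins, outs) ?n (q + ?n, X1, ins, outs)" "represents X1 s"
    "X1 (tmp d) = aval e s" "\<forall>d'<d. X1 (tmp d') = X (tmp d')"
    using Minus.IH(1)[OF emb(1) Minus.prems(2)] Minus.prems(3) by auto
  obtain X2 where X2: "reaches P (q + ?n, X1, ins, outs) ?m (q + ?n + ?m, X2, ins, outs)" "represents X2 s"
    "X2 (tmp (Suc d)) = aval f s" "\<forall>d'<Suc d. X2 (tmp d') = X1 (tmp d')"
    using Minus.IH(2)[OF emb(2) X1(2)] Minus.prems(3) by auto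
  define Y where "Y = X2(tmp d := X2 (tmp d) - X2 (tmp (Suc d)))"
  have "reaches P (q + ?n + ?m, X2, ins, outs) 1 (q + ?n + ?m + 1, Y, ins, outs)"
    using emb(3) by (simp add: reaches_def step_embedded Y_def)
  then have "reaches P (q, X, ins, outs) (?n + ?m + 1) (q + ?n + ?m + 1, Y, ins, outs)"
    using reaches_trans[OF reaches_trans[OF X1(1) X2(1)]] by blast
  moreover have "represents Y s" "Y (tmp d) = aval (Minus e f) s" "\<forall>d'<d. Y (tmp d') = X (tmp d')"
    using X1(3,4) X2(2,3,4) by (simp_all add: Y_def)
  ultimately show ?case by (intro exI[of _ Y]) (simp add: add_ac)
qed

lemma com_code_correct:
  assumes "embedded P q (com_code q c)" "represents X s" "com_ok c"
  shows "\<exists>X'. reaches P (q, X, inp s, outp s) (run_time c s)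
      (q + com_size c, X', inp (sem c s), outp (sem c s)) \<and> represents X' (sem c s)"
  using assms
proof (induction c arbitrary: q X s)
  case (Assign x e)
  let ?n = "length (aexp_code e 0)"
  have emb: "embedded P q (aexp_code e 0)" "embedded P (q + ?n) [Const (tmp 1) 0]"
    "embedded P (Suc (q + ?n)) [Add (reg x) (tmp 0) (tmp 1)]"
    using Assign.prems(1) by (simp_all add: embedded_append embedded_Cons)
  obtain X1 where X1: "reaches P (q, X, inp s, outp s) ?n (q + ?n, X1, inp s, outp s)" "represents X1 s"
    "X1 (tmp 0) = aval e s"
    using aexp_code_correct[OF emb(1) Assign.prems(2)] Assign.prems(3) by auto
  define Y where "Y = X1(tmp 1 := 0, reg x := aval e s)"
  have "reaches P (q + ?n, X1, inp s, outp s) 2 (q + ?n + 2, Y, inp s, outp s)"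
    using emb X1(3) by (simp add: reaches_def step_embedded eval_nat_numeral Y_def)
  then have "reaches P (q, X, inp s, outp s) (?n + 2) (q + ?n + 2, Y, inp s, outp s)"
    using reaches_trans[OF X1(1)] by blast
  moreover have "represents Y (set_var x (aval e s) s)"
    unfolding Y_def by (intro represents_set_var) (simp add: X1)
  ultimately show ?case by (intro exI[of _ Y]) (simp add: add_ac)
next
  case (Update a e f)
  let ?n = "length (aexp_code e 0)" and ?m = "length (aexp_code f 1)"
  have emb: "embedded P q (aexp_code e 0)" "embedded P (q + ?n) (addr_code a 0)"
    "embedded P (q + ?n + 7) (aexp_code f 1)" "embedded P (q + ?n + 7 + ?m) [Store (tmp 0) (tmp 1)]"
    using Update.prems(1) by (simp_all add: embedded_append add.assoc)
  obtain X1 where X1: "reaches P (q, X, inp s, outp s) ?n (q + ?n, X1, inp s, outp s)" "represents X1 s"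
    "X1 (tmp 0) = aval e s"
    using aexp_code_correct[OF emb(1) Update.prems(2)] Update.prems(3) by auto
  obtain X2 where X2: "reaches P (q + ?n, X1, inp s, outp s) 7 (q + ?n + 7, X2, inp s, outp s)" "represents X2 s"
    "X2 (tmp 0) = 32 * X1 (tmp 0) + a"
    using addr_code_correct[OF emb(2) X1(2)] by blast
  obtain X3 where X3: "reaches P (q + ?n + 7, X2, inp s, outp s) ?m (q + ?n + 7 + ?m, X3, inp s, outp s)"
    "represents X3 s" "X3 (tmp 1) = aval f s" "X3 (tmp 0) = X2 (tmp 0)"
    using aexp_code_correct[OF emb(3) X2(2)] Update.prems(3) by auto
  define Y where "Y = X3(32 * aval e s + a := aval f s)"
  have "reaches P (q + ?n + 7 + ?m, X3, inp s, outp s) 1 (q + ?n + 7 + ?m + 1, Y, inp s, outp s)"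
    using emb X1 X2 X3 by (simp add: reaches_def step_embedded Y_def)
  then have "reaches P (q, X, inp s, outp s) (?n + 7 + ?m + 1) (q + ?n + 7 + ?m + 1, Y, inp s, outp s)"
    using reaches_trans[OF reaches_trans[OF reaches_trans[OF X1(1) X2(1)] X3(1)]] by blast
  moreover have "represents Y (set_arr a (aval e s) (aval f s) s)"
    unfolding Y_def by (intro represents_set_arr) (use X3 Update.prems(3) in auto)
  ultimately show ?case by (intro exI[of _ Y]) (simp add: algebra_simps)
next
  case (Input x)
  let ?v = "case inp s of [] \<Rightarrow> 0 | c # _ \<Rightarrow> c"
  have "represents X (s\<lparr>inp := tl (inp s)\<rparr>)" using Input.prems(2) by (simp add: represents_def)
  then have "represents (X(reg x := ?v)) (set_var x ?v (s\<lparr>inp := tl (inp s)\<rparr>))"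
    by (rule represents_set_var)
  then show ?case using Input.prems(1) by (simp add: reaches_def step_embedded)
next
  case (Output e)
  let ?n = "length (aexp_code e 0)"
  have emb: "embedded P q (aexp_code e 0)" "embedded P (q + ?n) [Print (tmp 0)]"
    using Output.prems(1) by (simp_all add: embedded_append)
  obtain X1 where X1: "reaches P (q, X, inp s, outp s) ?n (q + ?n, X1, inp s, outp s)" "represents X1 s"
    "X1 (tmp 0) = aval e s"
    using aexp_code_correct[OF emb(1) Output.prems(2)] Output.prems(3) by auto
  have "reaches P (q + ?n, X1, inp s, outp s) 1 (q + ?n + 1, X1, inp s, outp s @ [aval e s])"
    using emb X1(3) by (simp add: reaches_def step_embedded)
  then have "reaches P (q, X, inp s, outp s) (?n + 1) (q + ?n + 1, X1, inp s, outp s @ [aval e s])"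
    using reaches_trans[OF X1(1)] by blast
  moreover have "represents X1 (s\<lparr>outp := outp s @ [aval e s]\<rparr>)"
    using X1(2) by (simp add: represents_def)
  ultimately show ?case by (intro exI[of _ X1]) (simp add: add_ac)
next
  case (Seq c d)
  have emb: "embedded P q (com_code q c)" "embedded P (q + com_size c) (com_code (q + com_size c) d)"
    using Seq.prems(1) by (simp_all add: embedded_append)
  obtain X1 where X1: "reaches P (q, X, inp s, outp s) (run_time c s)
      (q + com_size c, X1, inp (sem c s), outp (sem c s))" "represents X1 (sem c s)"
    using Seq.IH(1)[OF emb(1) Seq.prems(2)] Seq.prems(3) by auto
  obtain X2 where X2: "reaches P (q + com_size c, X1, inp (sem c s), outp (sem c s)) (run_time d (sem c s))
      (q + com_size c + com_size d, X2, inp (sem d (sem c s)), outp (sem d (sem c s)))"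
      "represents X2 (sem d (sem c s))"
    using Seq.IH(2)[OF emb(2) X1(2)] Seq.prems(3) by auto
  show ?case using reaches_trans[OF X1(1) X2(1)] X2(2) by (auto simp: add_ac)
next
  case (Cond e c d)
  let ?n = "length (aexp_code e 0)"
  define q1 where "q1 = q + ?n + 1"
  define q2 where "q2 = q1 + com_size d + 2"
  have emb: "embedded P q (aexp_code e 0)" "embedded P (q + ?n) [Jump_pos (tmp 0) q2]"
    "embedded P q1 (com_code q1 d)" "embedded P (q1 + com_size d) [Const (tmp 0) 1]"
    "embedded P (Suc (q1 + com_size d)) [Jump_pos (tmp 0) (q2 + com_size c)]"
    "embedded P q2 (com_code q2 c)"
    using Cond.prems(1)
    by (simp_all add: embedded_append embedded_Cons Let_def q1_def q2_def)
  obtain X1 where X1: "reaches P (q, X, inp s, outp s) ?n (q + ?n, X1, inp s, outp s)" "represents X1 s"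
    "X1 (tmp 0) = aval e s"
    using aexp_code_correct[OF emb(1) Cond.prems(2)] Cond.prems(3) by auto
  show ?case
  proof (cases "0 < aval e s")
    case True
    have "reaches P (q + ?n, X1, inp s, outp s) 1 (q2, X1, inp s, outp s)"
      using emb(2) X1(3) True by (simp add: reaches_def step_embedded)
    note r = reaches_trans[OF X1(1) this]
    obtain X2 where X2: "reaches P (q2, X1, inp s, outp s) (run_time c s)
        (q2 + com_size c, X2, inp (sem c s), outp (sem c s))" "represents X2 (sem c s)"
      using Cond.IH(1)[OF emb(6) X1(2)] Cond.prems(3) by auto
    have "q2 + com_size c = q + com_size (Cond e c d)" by (simp add: q2_def q1_def)
    then show ?thesis using reaches_trans[OF r X2(1)] X2(2) True by (auto simp: add_ac)
  next
    case False
    have "reaches P (q + ?n, X1, inp s, outp s) 1 (q1, X1, inp s, outp s)"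
      using emb(2) X1(3) False by (simp add: reaches_def step_embedded q1_def)
    note r = reaches_trans[OF X1(1) this]
    obtain X2 where X2: "reaches P (q1, X1, inp s, outp s) (run_time d s)
        (q1 + com_size d, X2, inp (sem d s), outp (sem d s))" "represents X2 (sem d s)"
      using Cond.IH(2)[OF emb(3) X1(2)] Cond.prems(3) by auto
    define Y where "Y = X2(tmp 0 := 1)"
    have "reaches P (q1 + com_size d, X2, inp (sem d s), outp (sem d s)) 2
        (q2 + com_size c, Y, inp (sem d s), outp (sem d s))"
      using emb(4,5) by (simp add: reaches_def step_embedded eval_nat_numeral Y_def)
    note r' = reaches_trans[OF reaches_trans[OF r X2(1)] this]
    have "q2 + com_size c = q + com_size (Cond e c d)" by (simp add: q2_def q1_def)
    moreover have "represents Y (sem d s)" unfolding Y_def using X2(2) by simp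
    ultimately show ?thesis
      using r' False by (intro exI[of _ Y]) (simp add: add_ac)
  qed
next
  case (For i b c)
  define q1 where "q1 = q + 1"
  define q5 where "q5 = q + 5"
  define q' where "q' = q + com_size c + 8"
  have emb: "embedded P q [Const (reg i) 0]" "embedded P q1 [Sub (tmp 0) (reg b) (reg i)]"
    "embedded P (Suc q1) [Jump_pos (tmp 0) q5]" "embedded P (Suc (Suc q1)) [Const (tmp 0) 1]"
    "embedded P (Suc (Suc (Suc q1))) [Jump_pos (tmp 0) q']"
    "embedded P q5 (com_code q5 c)" "embedded P (q5 + com_size c) [Const (tmp 0) 1]"
    "embedded P (Suc (q5 + com_size c)) [Add (reg i) (reg i) (tmp 0)]"
    "embedded P (Suc (Suc (q5 + com_size c))) [Jump_pos (tmp 0) q1]"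
    using For.prems(1)
    by (simp_all add: embedded_append q1_def q5_def q'_def eval_nat_numeral embedded_Cons)
  let ?body = "\<lambda>s. set_var i (Suc (vars s i)) (sem c s)"
  let ?t = "\<lambda>j. (?body ^^ j) (set_var i 0 s)"
  have ok: "i \<noteq> b" "i \<notin> var_writes c" "b \<notin> var_writes c" "com_ok c" using For.prems(3) by auto
  have vars_t: "vars (?t j) i = j" "vars (?t j) b = vars s b" for j
    by (induction j) (use ok in \<open>auto simp: sem_vars\<close>)
  \<comment> \<open>Address \<open>q1\<close> is the loop test, where control stands after the
    initialisation and again after every round.\<close>
  have loop: "j \<le> vars s b \<Longrightarrow> \<exists>X'. reaches P (q, X, inp s, outp s) (1 + (\<Sum>j<j. run_time c (?t j) + 5))
      (q1, X', inp (?t j), outp (?t j)) \<and> represents X' (?t j)" for j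
  proof (induction j)
    case 0
    show ?case using represents_set_var[OF For.prems(2)] emb(1)
      by (simp add: reaches_def step_embedded q1_def)
  next
    case (Suc j)
    let ?s = "?t j"
    obtain X1 where X1: "reaches P (q, X, inp s, outp s) (1 + (\<Sum>j<j. run_time c (?t j) + 5))
      (q1, X1, inp ?s, outp ?s)" "represents X1 ?s" using Suc by auto
    have v: "X1 (reg b) - X1 (reg i) > 0"
      using X1(2) vars_t[of j] Suc.prems by (simp add: represents_def)
    let ?X1 = "X1(tmp 0 := X1 (reg b) - X1 (reg i))"
    have r1: "reaches P (q1, X1, inp ?s, outp ?s) 2 (q5, ?X1, inp ?s, outp ?s)"
      using emb(2,3) v by (simp add: reaches_def step_embedded eval_nat_numeral)
    have "represents ?X1 ?s" using X1(2) by simp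
    then obtain X2 where X2: "reaches P (q5, ?X1, inp ?s, outp ?s) (run_time c ?s)
        (q5 + com_size c, X2, inp (sem c ?s), outp (sem c ?s))" "represents X2 (sem c ?s)"
      using For.IH[OF emb(6)] ok(4) by blast
    define Y where "Y = X2(tmp 0 := 1, reg i := Suc j)"
    have "X2 (reg i) = j" using X2(2) vars_t[of j] sem_vars[OF ok(2)] by (simp add: represents_def)
    then have r3: "reaches P (q5 + com_size c, X2, inp (sem c ?s), outp (sem c ?s)) 3
        (q1, Y, inp (sem c ?s), outp (sem c ?s))"
      using emb(7,8,9) by (simp add: reaches_def step_embedded eval_nat_numeral Y_def)
    have "represents Y (set_var i (Suc j) (sem c ?s))"
      unfolding Y_def by (intro represents_set_var) (simp add: X2(2))
    moreover have "?t (Suc j) = set_var i (Suc j) (sem c ?s)" using vars_t[of j] by simp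
    ultimately show ?case
      using reaches_trans[OF reaches_trans[OF reaches_trans[OF X1(1) r1] X2(1)] r3]
      by (intro exI[of _ Y]) (simp add: algebra_simps)
  qed
  let ?s = "?t (vars s b)"
  obtain X1 where X1: "reaches P (q, X, inp s, outp s) (1 + (\<Sum>j<vars s b. run_time c (?t j) + 5))
      (q1, X1, inp ?s, outp ?s)" "represents X1 ?s" using loop[OF order_refl] by blast
  have "X1 (reg b) - X1 (reg i) = 0"
    using X1(2) vars_t[of "vars s b"] by (simp add: represents_def)
  moreover define Y where "Y = X1(tmp 0 := 0, tmp 0 := 1)"
  ultimately have "reaches P (q1, X1, inp ?s, outp ?s) 4 (q', Y, inp ?s, outp ?s)"
    using emb(2-5) by (simp add: reaches_def step_embedded eval_nat_numeral)
  note r = reaches_trans[OF X1(1) this]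
  have "represents Y ?s" unfolding Y_def using X1(2) by simp
  then show ?case
    using r by (intro exI[of _ Y]) (simp add: q'_def algebra_simps)
qed

section \<open>Running time from loop bounds and nesting depth\<close>

fun loop_bounds :: "com \<Rightarrow> nat set" where
  "loop_bounds (c ;; d) = loop_bounds c \<union> loop_bounds d"
| "loop_bounds (Cond e c d) = loop_bounds c \<union> loop_bounds d"
| "loop_bounds (For i b c) = insert b (loop_bounds c)"
| "loop_bounds _ = {}"

fun depth :: "com \<Rightarrow> nat" where
  "depth (c ;; d) = max (depth c) (depth d)"
| "depth (Cond e c d) = max (depth c) (depth d)"
| "depth (For i b c) = Suc (depth c)"
| "depth _ = 0"

text \<open>As no bounding variable is written anywhere in \<open>c\<close>, the initial values
  govern all loops, including inner ones. The loop case charges for \<open>Suc B\<close> rounds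
  while at most \<open>B\<close> occur; the spare one pays for the steps outside the rounds.\<close>

lemma run_time_le:
  assumes "\<And>b. b \<in> loop_bounds c \<Longrightarrow> b \<notin> var_writes c \<and> vars s b \<le> B"
  shows "run_time c s \<le> com_size c * Suc B ^ depth c"
  using assms
proof (induction c arbitrary: s)
  case (Seq c d)
  have "run_time c s \<le> com_size c * Suc B ^ depth c" using Seq.prems by (intro Seq.IH) auto
  also have "\<dots> \<le> com_size c * Suc B ^ max (depth c) (depth d)"
    by (intro mult_left_mono power_increasing) auto
  finally have 1: "run_time c s \<le> com_size c * Suc B ^ max (depth c) (depth d)" .
  have "run_time d (sem c s) \<le> com_size d * Suc B ^ depth d"
    using Seq.prems by (intro Seq.IH) (auto simp: sem_vars)
  also have "\<dots> \<le> com_size d * Suc B ^ max (depth c) (depth d)"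
    by (intro mult_left_mono power_increasing) auto
  finally show ?case using 1 by (simp add: distrib_right)
next
  case (Cond e c d)
  let ?Q = "Suc B ^ max (depth c) (depth d)"
  have "run_time c s \<le> com_size c * Suc B ^ depth c" using Cond.prems by (intro Cond.IH) auto
  also have "\<dots> \<le> com_size c * ?Q"
    by (intro mult_left_mono power_increasing) auto
  finally have 1: "run_time c s \<le> com_size c * ?Q" .
  have "run_time d s \<le> com_size d * Suc B ^ depth d"
    using Cond.prems by (intro Cond.IH) auto
  also have "\<dots> \<le> com_size d * ?Q"
    by (intro mult_left_mono power_increasing) auto
  finally have 2: "run_time d s \<le> com_size d * ?Q" .
  have "(length (aexp_code e 0) + 3) * 1 \<le> (length (aexp_code e 0) + 3) * ?Q"
    by (intro mult_left_mono) auto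
  then have 3: "length (aexp_code e 0) + 3 \<le> length (aexp_code e 0) * ?Q + 3 * ?Q"
    by (simp add: distrib_right)
  have "com_size (Cond e c d) * ?Q = length (aexp_code e 0) * ?Q + com_size d * ?Q + com_size c * ?Q + 3 * ?Q"
    by (simp add: distrib_right)
  then show ?case using 1 2 3 by (auto simp del: com_size.simps)
next
  case (For i b c)
  let ?t = "\<lambda>j. ((\<lambda>s. set_var i (Suc (vars s i)) (sem c s)) ^^ j) (set_var i 0 s)"
  let ?Q = "Suc B ^ depth c"
  have frame: "x \<noteq> i \<Longrightarrow> x \<notin> var_writes c \<Longrightarrow> vars (?t j) x = vars s x" for x j
    by (induction j) (auto simp: sem_vars)
  have it: "run_time c (?t j) \<le> com_size c * ?Q" for j
    using For.prems by (intro For.IH) (auto simp: frame)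
  have Q: "1 \<le> ?Q" by simp
  have "(\<Sum>j<vars s b. run_time c (?t j) + 5) \<le> (\<Sum>j<vars s b. com_size c * ?Q + 5 * ?Q)"
    by (intro sum_mono add_mono it) simp
  also have "\<dots> = vars s b * ((com_size c + 5) * ?Q)" by (simp add: distrib_right)
  also have "\<dots> \<le> B * ((com_size c + 5) * ?Q)" using For.prems by (intro mult_right_mono) auto
  finally have S: "(\<Sum>j<vars s b. run_time c (?t j) + 5) \<le> B * ((com_size c + 5) * ?Q)" .
  have "5 * 1 \<le> (com_size c + 5) * ?Q" by (intro mult_mono) (use Q in auto)
  then have "run_time (For i b c) s \<le> (com_size c + 5) * ?Q + B * ((com_size c + 5) * ?Q)"
    unfolding run_time.simps mult_1_right using S by (rule add_mono)
  also have "\<dots> = (com_size c + 5) * Suc B ^ Suc (depth c)" by (simp add: algebra_simps)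
  also have "\<dots> \<le> com_size (For i b c) * Suc B ^ depth (For i b c)" by simp
  finally show ?case .
qed simp_all

text \<open>The program counter ends just behind the code, where the configuration is a fixed point;
  so the exact time may be padded to any larger \<open>t\<close>.\<close>

lemma ram_outputs_com_code:
  assumes "com_ok c" "run_time c \<lparr>vars = \<lambda>_. 0, arrs = \<lambda>_ _. 0, inp = xs, outp = []\<rparr> \<le> t"
  shows "ram_outputs (com_code 0 c) xs (outp (sem c \<lparr>vars = \<lambda>_. 0, arrs = \<lambda>_ _. 0, inp = xs, outp = []\<rparr>)) t"
proof -
  let ?s = "\<lparr>vars = \<lambda>_. 0, arrs = \<lambda>_ _. 0, inp = xs, outp = []\<rparr>" and ?P = "com_code 0 c"
  have "embedded ?P 0 ?P" unfolding embedded_def by (intro exI[of _ "[]"]) simp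
  moreover have "represents (\<lambda>_. 0) ?s" by (simp add: represents_def)
  ultimately obtain X where X: "reaches ?P (0, \<lambda>_. 0, xs, []) (run_time c ?s)
      (com_size c, X, inp (sem c ?s), outp (sem c ?s))"
    using com_code_correct[of ?P 0 c "\<lambda>_. 0" ?s] assms(1) by auto
  have "reaches ?P (com_size c, X, inp (sem c ?s), outp (sem c ?s)) n
      (com_size c, X, inp (sem c ?s), outp (sem c ?s))" for n
    unfolding reaches_def by (induction n) (simp_all add: step_def)
  from reaches_trans[OF X this[of "t - run_time c ?s"]] show ?thesis
    using assms(2) unfolding ram_outputs_def reaches_def by auto
qed

section \<open>Data layout, tests on bits, and the stages of the computation\<close>

section \<open>The program\<close>

text \<open>The machine cannot multiply, so the row offsets of the matrices \<open>aADJ\<close> and \<open>aR\<close>, which have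
  \<open>vM = 2 * n\<close> columns, are tabulated in \<open>aROW\<close>. The colour lists are stored consecutively: entry \<open>q\<close>
  consists of its vertex \<open>aOWN\<close>, its colour \<open>aCOL\<close> and its status \<open>aST\<close>, which is 1 while the colour
  is unprocessed, 2 if the vertex received it, and 0 if not or if there is no such entry.\<close>

abbreviation (input) "vN \<equiv> 2 :: nat"
abbreviation (input) "vK \<equiv> 3 :: nat"
abbreviation (input) "vNK \<equiv> 4 :: nat"
abbreviation (input) "vT \<equiv> 5 :: nat"
abbreviation (input) "vM \<equiv> 6 :: nat"
abbreviation (input) "vM1 \<equiv> 7 :: nat"
abbreviation (input) "vI \<equiv> 8 :: nat"
abbreviation (input) "vJ \<equiv> 9 :: nat"
abbreviation (input) "vH \<equiv> 10 :: nat"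
abbreviation (input) "vX \<equiv> 11 :: nat"
abbreviation (input) "vL \<equiv> 12 :: nat"
abbreviation (input) "vP \<equiv> 13 :: nat"
abbreviation (input) "vC \<equiv> 14 :: nat"
abbreviation (input) "vF \<equiv> 15 :: nat"
abbreviation (input) "vR \<equiv> 16 :: nat"
abbreviation (input) "vQ \<equiv> 17 :: nat"

abbreviation (input) "aROW \<equiv> 2 :: nat"
abbreviation (input) "aADJ \<equiv> 3 :: nat"
abbreviation (input) "aR \<equiv> 4 :: nat"
abbreviation (input) "aCOL \<equiv> 5 :: nat"
abbreviation (input) "aOWN \<equiv> 6 :: nat"
abbreviation (input) "aST \<equiv> 7 :: nat"
abbreviation (input) "aRANK \<equiv> 8 :: nat"
abbreviation (input) "aPAR \<equiv> 9 :: nat"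
abbreviation (input) "aW \<equiv> 10 :: nat"
abbreviation (input) "aKER \<equiv> 11 :: nat"
abbreviation (input) "aCNT \<equiv> 12 :: nat"

text \<open>The language has no empty command. Variable 0 serves as a dump, as the named program
  variables start at 2.\<close>

definition skip :: com where "skip = Assign 0 (Num 0)"
definition cell_index :: "aexp \<Rightarrow> aexp \<Rightarrow> aexp" where "cell_index e f = Plus (Arr aROW e) f"
text \<open>Conjunction of two bits: positive iff both are 1.\<close>

definition both :: "aexp \<Rightarrow> aexp \<Rightarrow> aexp" where "both e f = Minus (Plus e f) (Num 1)"
text \<open>With truncated subtraction, the two differences add up to the distance of the two
  values.\<close>

definition equal_exp :: "aexp \<Rightarrow> aexp \<Rightarrow> aexp" where
  "equal_exp e f = Minus (Num 1) (Plus (Minus e f) (Minus f e))"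

lemma skip_simps [simp]:
  "vars (sem skip s) x = (if x = 0 then 0 else vars s x)" "arrs (sem skip s) = arrs s"
  "inp (sem skip s) = inp s" "outp (sem skip s) = outp s"
  "var_writes skip = {0}" "arr_writes skip = {}" "\<not> reads skip" "\<not> writes skip"
  "com_ok skip" "loop_bounds skip = {}"
  by (simp_all add: skip_def)

lemma aval_simps [simp]:
  "aval (cell_index e f) s = arrs s aROW (aval e s) + aval f s"
  "aval (both e f) s = aval e s + aval f s - 1"
  "0 < aval (equal_exp e f) s \<longleftrightarrow> aval e s = aval f s"
  by (auto simp: cell_index_def both_def equal_exp_def)

lemma arrays_ok_simps [simp]:
  "arrays_ok_exp (cell_index e f) \<longleftrightarrow> arrays_ok_exp e \<and> arrays_ok_exp f"
  "arrays_ok_exp (both e f) \<longleftrightarrow> arrays_ok_exp e \<and> arrays_ok_exp f"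
  "arrays_ok_exp (equal_exp e f) \<longleftrightarrow> arrays_ok_exp e \<and> arrays_ok_exp f"
  by (auto simp: cell_index_def both_def equal_exp_def)

lemma cell_eq:
  assumes "y < m" "y' < m"
  shows "x * m + y = x' * m + y' \<longleftrightarrow> x = x' \<and> y = (y' :: nat)"
proof
  assume eq: "x * m + y = x' * m + y'"
  have "x = (x * m + y) div m" using assms by simp
  also have "\<dots> = x'" unfolding eq using assms by simp
  finally show "x = x' \<and> y = y'" using eq by simp
qed simp

text \<open>The third value, \<open>2 * n + 1\<close>, is the number of possible ranks and hence of
  kernel phases.\<close>

definition layout :: "nat \<Rightarrow> state \<Rightarrow> bool" where
  "layout n s \<longleftrightarrow> vars s vN = n \<and> vars s vM = 2 * n \<and> vars s vM1 = Suc (2 * n)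
     \<and> (\<forall>x<2 * n. arrs s aROW x = x * (2 * n))"

lemma layoutD:
  assumes "layout n s"
  shows "vars s vN = n" "vars s vM = 2 * n" "vars s vM1 = Suc (2 * n)"
    "x < 2 * n \<Longrightarrow> arrs s aROW x = x * (2 * n)"
  using assms unfolding layout_def by auto

lemma layout_agree:
  assumes "agree_outside i c s t" "layout n s" "{vN, vM, vM1} \<inter> insert i (var_writes c) = {}" "aROW \<notin> arr_writes c"
  shows "layout n t"
  using assms unfolding layout_def agree_outside_def by auto

lemma layout_sem:
  assumes "layout n s" "{vN, vM, vM1} \<inter> var_writes c = {}" "aROW \<notin> arr_writes c"
  shows "layout n (sem c s)"
  using assms unfolding layout_def by (auto simp: sem_frame)

lemma layout_set_var:
  assumes "layout n s" "x \<noteq> vN" "x \<noteq> vM" "x \<noteq> vM1"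
  shows "layout n (set_var x c s)"
  using assms unfolding layout_def by auto

text \<open>Rows have width \<open>2 * n\<close> although \<open>n\<close> columns carry data, so
  that one table of row offsets serves this matrix and the closure matrix.\<close>

definition adjacency :: "nat rel \<Rightarrow> nat \<Rightarrow> state \<Rightarrow> bool" where
  "adjacency A n s \<longleftrightarrow> (\<forall>u<n. \<forall>v<n. arrs s aADJ (u * (2 * n) + v) = of_bool ((u, v) \<in> A))"

subsection \<open>Transitive closure\<close>

text \<open>Row and column \<open>x < n\<close> of the closure matrix stand for \<open>(x, False)\<close>, the others for
  \<open>(x - n, True)\<close>.\<close>

definition cover_node :: "nat \<Rightarrow> nat \<Rightarrow> nat \<times> bool" where
  "cover_node n x = (if x < n then (x, False) else (x - n, True))"

definition cover_matrix :: "nat \<Rightarrow> (nat \<times> bool) rel \<Rightarrow> (nat \<Rightarrow> nat) \<Rightarrow> bool" where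
  "cover_matrix n r f \<longleftrightarrow> (\<forall>x<2 * n. \<forall>y<2 * n.
     f (x * (2 * n) + y) = of_bool ((cover_node n x, cover_node n y) \<in> r))"

text \<open>Round \<open>h\<close> overwrites the matrix in place, in row order; this is its content
  just before cell \<open>(i, j)\<close> is visited.\<close>

definition warshall_partial :: "nat \<Rightarrow> (nat \<times> bool) rel \<Rightarrow> nat \<Rightarrow> nat \<Rightarrow> nat \<Rightarrow> (nat \<Rightarrow> nat) \<Rightarrow> bool" where
  "warshall_partial n r h i j f \<longleftrightarrow> (\<forall>x<2 * n. \<forall>y<2 * n. f (x * (2 * n) + y) = of_bool
     ((cover_node n x, cover_node n y) \<in> r \<or>
      (x < i \<or> x = i \<and> y < j) \<and> (cover_node n x, cover_node n h) \<in> r \<and> (cover_node n h, cover_node n y) \<in> r))"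

definition warshall_row :: com where
  "warshall_row =
     For vJ vM (Cond (both (Arr aR (cell_index (Var vI) (Var vH))) (Arr aR (cell_index (Var vH) (Var vJ))))
       (Update aR (cell_index (Var vI) (Var vJ)) (Num 1)) skip)"

lemma warshall_row_writes:
  "var_writes warshall_row = {vJ, 0}" "arr_writes warshall_row = {aR}" "\<not> reads warshall_row" "\<not> writes warshall_row"
  by (simp_all add: warshall_row_def)

lemma warshall_row_correct:
  assumes "layout n s" "vars s vI = i" "vars s vH = h" "i < 2 * n" "h < 2 * n"
    "warshall_partial n r h i 0 (arrs s aR)"
  shows "warshall_partial n r h i (2 * n) (arrs (sem warshall_row s) aR)"
proof -
  let ?c = "Cond (both (Arr aR (cell_index (Var vI) (Var vH))) (Arr aR (cell_index (Var vH) (Var vJ))))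
       (Update aR (cell_index (Var vI) (Var vJ)) (Num 1)) skip"
  have "warshall_partial n r h i (vars s vM) (arrs (sem (For vJ vM ?c) s) aR)"
  proof (rule For_invariant[where I = "\<lambda>j t. warshall_partial n r h i j (arrs t aR)"])
    fix j t assume j: "j < vars s vM" and inv: "warshall_partial n r h i j (arrs t aR)"
      and tj: "vars t vJ = j" and F: "agree_outside vJ ?c s t"
    have lay: "layout n t" by (rule layout_agree[OF F assms(1)]) simp_all
    have v: "vars t vI = i" "vars t vH = h" using agree_outsideD(1)[OF F] assms(2,3) by simp_all
    have j': "j < 2 * n" using j layoutD(2)[OF assms(1)] by simp
    have inv': "\<And>x y. x < 2 * n \<Longrightarrow> y < 2 * n \<Longrightarrow> arrs t aR (x * (2 * n) + y) = of_bool
     ((cover_node n x, cover_node n y) \<in> r \<or>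
      (x < i \<or> x = i \<and> y < j) \<and> (cover_node n x, cover_node n h) \<in> r \<and> (cover_node n h, cover_node n y) \<in> r)"
      using inv unfolding warshall_partial_def by blast
    \<comment> \<open>Round \<open>h\<close> leaves row \<open>h\<close> and column \<open>h\<close>
      as they were: there the added disjunct already implies the old entry. So in-place reads give
      the values from before the round.\<close>
    have e1: "arrs t aR (i * (2 * n) + h) = of_bool ((cover_node n i, cover_node n h) \<in> r)"
      and e2: "arrs t aR (h * (2 * n) + j) = of_bool ((cover_node n h, cover_node n j) \<in> r)"
      using inv'[OF assms(4,5)] inv'[OF assms(5) j'] by auto
    have guard: "0 < aval (both (Arr aR (cell_index (Var vI) (Var vH))) (Arr aR (cell_index (Var vH) (Var vJ)))) t
        \<longleftrightarrow> (cover_node n i, cover_node n h) \<in> r \<and> (cover_node n h, cover_node n j) \<in> r"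
      using assms(4,5) v tj e1 e2 layoutD(4)[OF lay] by simp
    show "warshall_partial n r h i (Suc j) (arrs (set_var vJ (Suc j) (sem ?c t)) aR)"
    proof (cases "(cover_node n i, cover_node n h) \<in> r \<and> (cover_node n h, cover_node n j) \<in> r")
      case True
      then show ?thesis unfolding warshall_partial_def
        using guard v tj layoutD(4)[OF lay assms(4)] j' assms(4)
        by (auto simp: inv' cell_eq less_Suc_eq)
    next
      case False
      then show ?thesis unfolding warshall_partial_def
        using guard by (auto simp: inv' less_Suc_eq)
    qed
  qed (use assms(6) in simp_all)
  then show ?thesis unfolding warshall_row_def layoutD(2)[OF assms(1)] .
qed

definition warshall_round :: com where
  "warshall_round = For vI vM warshall_row"

lemma warshall_round_writes:
  "var_writes warshall_round = {vI, vJ, 0}" "arr_writes warshall_round = {aR}"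
  "\<not> reads warshall_round" "\<not> writes warshall_round"
  by (simp_all add: warshall_round_def warshall_row_writes)

lemma warshall_round_correct:
  assumes "layout n s" "vars s vH = h" "h < 2 * n" "cover_matrix n r (arrs s aR)"
  shows "cover_matrix n (warshall_step (cover_node n h) r) (arrs (sem warshall_round s) aR)"
proof -
  have "warshall_partial n r h (vars s vM) 0 (arrs (sem (For vI vM warshall_row) s) aR)"
  proof (rule For_invariant[where I = "\<lambda>i t. warshall_partial n r h i 0 (arrs t aR)"])
    fix i t assume i: "i < vars s vM" and inv: "warshall_partial n r h i 0 (arrs t aR)"
      and ti: "vars t vI = i" and F: "agree_outside vI warshall_row s t"
    have lay: "layout n t" by (rule layout_agree[OF F assms(1)]) (simp_all add: warshall_row_writes)
    have "vars t vH = h" using agree_outsideD(1)[OF F] assms(2) by (simp add: warshall_row_writes)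
    then have "warshall_partial n r h i (2 * n) (arrs (sem warshall_row t) aR)"
      using warshall_row_correct[OF lay ti] i layoutD(2)[OF assms(1)] assms(3) inv by simp
    then show "warshall_partial n r h (Suc i) 0 (arrs (set_var vI (Suc i) (sem warshall_row t)) aR)"
      unfolding warshall_partial_def by (auto simp: less_Suc_eq)
  qed (use assms(4) in \<open>simp_all add: warshall_row_writes cover_matrix_def warshall_partial_def\<close>)
  then show ?thesis
    unfolding warshall_round_def layoutD(2)[OF assms(1)] warshall_partial_def cover_matrix_def warshall_step_def
    by auto
qed

definition closure_com :: com where
  "closure_com = For vH vM warshall_round"

lemma closure_com_writes:
  "var_writes closure_com = {vH, vI, vJ, 0}" "arr_writes closure_com = {aR}"
  "\<not> reads closure_com" "\<not> writes closure_com"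
  by (simp_all add: closure_com_def warshall_round_writes)

lemma closure_com_correct:
  assumes "layout n s" "cover_matrix n r (arrs s aR)" "Field r \<subseteq> {..<n} \<times> UNIV"
  shows "cover_matrix n (r\<^sup>+) (arrs (sem closure_com s) aR)"
proof -
  have "cover_matrix n (fold warshall_step (map (cover_node n) [0..<vars s vM]) r)
      (arrs (sem (For vH vM warshall_round) s) aR)"
  proof (rule For_invariant[where I = "\<lambda>h t.
        cover_matrix n (fold warshall_step (map (cover_node n) [0..<h]) r) (arrs t aR)"])
    fix h t assume h: "h < vars s vM"
      and inv: "cover_matrix n (fold warshall_step (map (cover_node n) [0..<h]) r) (arrs t aR)"
      and th: "vars t vH = h" and F: "agree_outside vH warshall_round s t"
    have lay: "layout n t" by (rule layout_agree[OF F assms(1)]) (simp_all add: warshall_round_writes)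
    show "cover_matrix n (fold warshall_step (map (cover_node n) [0..<Suc h]) r)
        (arrs (set_var vH (Suc h) (sem warshall_round t)) aR)"
      using warshall_round_correct[OF lay th _ inv] h layoutD(2)[OF assms(1)] by simp
  qed (use assms(2) in \<open>simp_all add: warshall_round_writes\<close>)
  moreover have "Field r \<subseteq> set (map (cover_node n) [0..<2 * n])"
  proof
    fix z assume "z \<in> Field r"
    then have "fst z < n" using assms(3) by auto
    then have "z = cover_node n (if snd z then fst z + n else fst z)"
      by (cases z) (auto simp: cover_node_def)
    moreover have "(if snd z then fst z + n else fst z) < 2 * n" using \<open>fst z < n\<close> by simp
    ultimately show "z \<in> set (map (cover_node n) [0..<2 * n])"
      by (metis atLeast0LessThan image_eqI lessThan_iff set_map set_upt)
  qed
  ultimately show ?thesis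
    unfolding closure_com_def layoutD(2)[OF assms(1)] by (simp add: warshall)
qed

text \<open>Ones on the diagonal make the transitive closure reflexive on the first \<open>n\<close>
  vertices. Elsewhere only the right-hand side is reflexive for sure, hence the restriction on
  \<open>x\<close>.\<close>

lemma reflexive_cover_trancl:
  assumes "fst x < n"
  shows "(x, y) \<in> (double_cover A \<union> Id_on ({..<n} \<times> UNIV))\<^sup>+ \<longleftrightarrow> (x, y) \<in> (double_cover A)\<^sup>*"
proof
  let ?I = "Id_on ({..<n} \<times> (UNIV :: bool set))"
  assume "(x, y) \<in> (double_cover A \<union> ?I)\<^sup>+"
  then have "(x, y) \<in> (double_cover A \<union> ?I)\<^sup>*" by (rule trancl_into_rtrancl)
  moreover have "(double_cover A \<union> ?I)\<^sup>* \<subseteq> ((double_cover A)\<^sup>*)\<^sup>*"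
    by (rule rtrancl_mono) auto
  ultimately show "(x, y) \<in> (double_cover A)\<^sup>*" by auto
next
  let ?I = "Id_on ({..<n} \<times> (UNIV :: bool set))"
  assume "(x, y) \<in> (double_cover A)\<^sup>*"
  then consider "x = y" | "(x, y) \<in> (double_cover A)\<^sup>+" by (metis rtranclD)
  then show "(x, y) \<in> (double_cover A \<union> ?I)\<^sup>+"
  proof cases
    case 1
    then have "(x, y) \<in> ?I" using assms by (cases x) auto
    then show ?thesis by (intro r_into_trancl) simp
  next
    case 2
    moreover have "(double_cover A)\<^sup>+ \<subseteq> (double_cover A \<union> ?I)\<^sup>+"
      by (rule trancl_mono_subset) auto
    ultimately show ?thesis by blast
  qed
qed

lemma cover_node_simps [simp]:
  "x < n \<Longrightarrow> cover_node n x = (x, False)" "cover_node n (n + x) = (x, True)"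
  by (simp_all add: cover_node_def)

lemma cover_matrix_closure:
  assumes "cover_matrix n ((double_cover A \<union> Id_on ({..<n} \<times> UNIV))\<^sup>+) f"
  shows "cover_matrix n ((double_cover A)\<^sup>*) f"
proof -
  have "fst (cover_node n x) < n" if "x < 2 * n" for x using that by (auto simp: cover_node_def)
  then show ?thesis using assms unfolding cover_matrix_def by (simp add: reflexive_cover_trancl)
qed

lemma cover_matrixD:
  assumes "cover_matrix n r f" "u < n" "v < n"
  shows "f (u * (2 * n) + v) = of_bool (((u, False), (v, False)) \<in> r)"
    "f (u * (2 * n) + (n + v)) = of_bool (((u, False), (v, True)) \<in> r)"
proof -
  have M: "f (x * (2 * n) + y) = of_bool ((cover_node n x, cover_node n y) \<in> r)" if "x < 2 * n" "y < 2 * n" for x y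
    using assms(1) that unfolding cover_matrix_def by blast
  show "f (u * (2 * n) + v) = of_bool (((u, False), (v, False)) \<in> r)"
    using M[of u v] assms(2,3) by simp
  show "f (u * (2 * n) + (n + v)) = of_bool (((u, False), (v, True)) \<in> r)"
    using M[of u "n + v"] assms(2,3) by simp
qed

lemma sum_cover_row:
  assumes "cover_matrix n ((double_cover A)\<^sup>*) f" "A \<subseteq> {..<n} \<times> {..<n}" "u < n"
  shows "(\<Sum>y<2 * n. f (u * (2 * n) + y)) = reach_rank ((double_cover A)\<^sup>*) u"
proof -
  let ?R = "(double_cover A)\<^sup>*"
  have "(\<Sum>y<2 * n. f (u * (2 * n) + y)) = (\<Sum>y<2 * n. of_bool (((u, False), cover_node n y) \<in> ?R))"
    using assms(1,3) unfolding cover_matrix_def by (intro sum.cong) auto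
  also have "\<dots> = card {y \<in> {..<2 * n}. ((u, False), cover_node n y) \<in> ?R}"
    by (simp add: Int_def)
  also have "\<dots> = card (cover_node n ` {y \<in> {..<2 * n}. ((u, False), cover_node n y) \<in> ?R})"
    by (rule card_image[symmetric]) (auto simp: inj_on_def cover_node_def split: if_splits)
  also have "cover_node n ` {y \<in> {..<2 * n}. ((u, False), cover_node n y) \<in> ?R} = {z. ((u, False), z) \<in> ?R}"
  proof (intro equalityI subsetI)
    fix z assume z: "z \<in> {z. ((u, False), z) \<in> ?R}"
    then have "fst z < n" using double_cover_rtrancl_fst[OF _ assms(2), of "(u, False)" z] assms(3) by simp
    then have "z = cover_node n (if snd z then n + fst z else fst z)" "(if snd z then n + fst z else fst z) < 2 * n"
      by (cases z; simp)+
    with z show "z \<in> cover_node n ` {y \<in> {..<2 * n}. ((u, False), cover_node n y) \<in> ?R}"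
      by (intro image_eqI[of _ _ "if snd z then n + fst z else fst z"]) simp_all
  qed auto
  finally show ?thesis unfolding reach_rank_def .
qed

section \<open>Ranks and parities from the closure matrix\<close>

definition row_sum :: com where
  "row_sum = For vJ vM (Assign vC (Plus (Var vC) (Arr aR (cell_index (Var vI) (Var vJ)))))"

lemma row_sum_writes:
  "var_writes row_sum = {vJ, vC}" "arr_writes row_sum = {}" "\<not> reads row_sum" "\<not> writes row_sum"
  by (auto simp: row_sum_def)

lemma row_sum_correct:
  assumes "layout n s" "vars s vI = u" "u < 2 * n" "vars s vC = 0"
  shows "vars (sem row_sum s) vC = (\<Sum>y<2 * n. arrs s aR (u * (2 * n) + y))"
proof -
  let ?c = "Assign vC (Plus (Var vC) (Arr aR (cell_index (Var vI) (Var vJ))))"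
  have "vars (sem (For vJ vM ?c) s) vC = (\<Sum>y<vars s vM. arrs s aR (u * (2 * n) + y))"
  proof (rule For_invariant[where I = "\<lambda>j t. vars t vC = (\<Sum>y<j. arrs s aR (u * (2 * n) + y))"])
    fix j t assume inv: "vars t vC = (\<Sum>y<j. arrs s aR (u * (2 * n) + y))"
      and tj: "vars t vJ = j" and F: "agree_outside vJ ?c s t"
    have lay: "layout n t" by (rule layout_agree[OF F assms(1)]) simp_all
    show "vars (set_var vJ (Suc j) (sem ?c t)) vC = (\<Sum>y<Suc j. arrs s aR (u * (2 * n) + y))"
      using inv tj assms(2,3) layoutD(4)[OF lay] by (simp add: agree_outsideD[OF F])
  qed (use assms(4) in simp_all)
  then show ?thesis unfolding row_sum_def layoutD(2)[OF assms(1)] .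
qed

definition rank_com :: com where
  "rank_com = For vI vN (Assign vC (Num 0) ;; row_sum ;; Update aRANK (Var vI) (Var vC))"

lemma rank_com_writes:
  "var_writes rank_com = {vI, vJ, vC}" "arr_writes rank_com = {aRANK}" "\<not> reads rank_com" "\<not> writes rank_com"
  by (auto simp: rank_com_def row_sum_writes)

lemma rank_com_correct:
  assumes "layout n s" "v < n"
  shows "arrs (sem rank_com s) aRANK v = (\<Sum>y<2 * n. arrs s aR (v * (2 * n) + y))"
proof -
  let ?c = "Assign vC (Num 0) ;; row_sum ;; Update aRANK (Var vI) (Var vC)"
  have "\<forall>v<vars s vN. arrs (sem (For vI vN ?c) s) aRANK v = (\<Sum>y<2 * n. arrs s aR (v * (2 * n) + y))"
  proof (rule For_invariant[where I = "\<lambda>j t. \<forall>v<j. arrs t aRANK v = (\<Sum>y<2 * n. arrs s aR (v * (2 * n) + y))"])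
    fix j t assume j: "j < vars s vN"
      and inv: "\<forall>v<j. arrs t aRANK v = (\<Sum>y<2 * n. arrs s aR (v * (2 * n) + y))"
      and tj: "vars t vI = j" and F: "agree_outside vI ?c s t"
    have lay: "layout n (set_var vC 0 t)"
      by (rule layout_set_var[OF layout_agree[OF F assms(1)]]) (simp_all add: row_sum_writes)
    have "vars (sem row_sum (set_var vC 0 t)) vC = (\<Sum>y<2 * n. arrs s aR (j * (2 * n) + y))"
      using row_sum_correct[OF lay, of j] j layoutD(1)[OF assms(1)] tj
      by (simp add: agree_outsideD[OF F] row_sum_writes)
    then show "\<forall>v<Suc j. arrs (set_var vI (Suc j) (sem ?c t)) aRANK v = (\<Sum>y<2 * n. arrs s aR (v * (2 * n) + y))"
      using inv tj by (auto simp: less_Suc_eq sem_frame row_sum_writes)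
  qed (simp_all add: row_sum_writes)
  then show ?thesis using assms(2) unfolding rank_com_def layoutD(1)[OF assms(1)] by blast
qed

lemma reach_par_snoc:
  "reach_par R (us @ [u]) v =
     (if mutual R True u v then True else if mutual R False u v then False else reach_par R us v)"
  by (simp add: reach_par_def)

definition par_even :: com where
  "par_even = Cond (both (Arr aR (cell_index (Var vI) (Var vJ))) (Arr aR (cell_index (Var vJ) (Var vI))))
     (Update aPAR (Var vJ) (Num 0)) skip"

definition par_odd :: com where
  "par_odd = Cond (both (Arr aR (cell_index (Var vI) (Plus (Var vN) (Var vJ)))) (Arr aR (cell_index (Var vJ) (Plus (Var vN) (Var vI)))))
     (Update aPAR (Var vJ) (Num 1)) skip"

text \<open>The odd test comes second so that it overrides the even one, in agreement with the order
  of the cases in \<open>reach_par\<close>.\<close>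

definition par_body :: com where "par_body = par_even ;; par_odd"

lemma par_body_writes:
  "var_writes par_body = {0}" "arr_writes par_body = {aPAR}" "\<not> reads par_body" "\<not> writes par_body"
  by (simp_all add: par_body_def par_even_def par_odd_def)

lemma par_body_correct:
  assumes "layout n s" "vars s vI = u" "vars s vJ = v" "u < n" "v < n" "cover_matrix n R (arrs s aR)"
    "arrs s aPAR v = of_bool p"
  shows "arrs (sem par_body s) aPAR = (arrs s aPAR)(v :=
    of_bool (if mutual R True u v then True else if mutual R False u v then False else p))"
proof -
  let ?s = "sem par_even s"
  note M = cover_matrixD[OF assms(6,4,5)] cover_matrixD[OF assms(6,5,4)]
  have even: "arrs ?s aPAR = (arrs s aPAR)(v := of_bool (if mutual R False u v then False else p))"
    using assms(2-5,7) layoutD(4)[OF assms(1)] M(1,3) unfolding par_even_def mutual_def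
    by (auto simp: fun_eq_iff)
  have same: "vars ?s vI = u" "vars ?s vJ = v" "vars ?s vN = n" "arrs ?s aR = arrs s aR" "arrs ?s aROW = arrs s aROW"
    using assms(2,3) layoutD(1)[OF assms(1)] by (simp_all add: par_even_def)
  have "arrs (sem par_odd ?s) aPAR = (arrs ?s aPAR)(v := of_bool (if mutual R True u v then True else arrs ?s aPAR v > 0))"
    using same assms(4,5) layoutD(4)[OF assms(1)] M(2,4) even unfolding par_odd_def mutual_def
    by (auto simp: fun_eq_iff)
  then show ?thesis using even unfolding par_body_def by (auto simp: fun_eq_iff)
qed

definition par_row :: com where "par_row = For vJ vN par_body"

lemma par_row_writes:
  "var_writes par_row = {vJ, 0}" "arr_writes par_row = {aPAR}" "\<not> reads par_row" "\<not> writes par_row"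
  by (simp_all add: par_row_def par_body_writes)

lemma par_row_correct:
  assumes "layout n s" "vars s vI = u" "u < n" "cover_matrix n R (arrs s aR)"
    "\<forall>v<n. arrs s aPAR v = of_bool (p v)"
  shows "\<forall>v<n. arrs (sem par_row s) aPAR v =
    of_bool (if mutual R True u v then True else if mutual R False u v then False else p v)"
proof -
  let ?q = "\<lambda>v. if mutual R True u v then True else if mutual R False u v then False else p v"
  have "\<forall>v<n. arrs (sem (For vJ vN par_body) s) aPAR v = of_bool (if v < vars s vN then ?q v else p v)"
  proof (rule For_invariant[where I = "\<lambda>j t. \<forall>v<n. arrs t aPAR v = of_bool (if v < j then ?q v else p v)"])
    fix j t assume j: "j < vars s vN" and inv: "\<forall>v<n. arrs t aPAR v = of_bool (if v < j then ?q v else p v)"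
      and tj: "vars t vJ = j" and F: "agree_outside vJ par_body s t"
    have lay: "layout n t" by (rule layout_agree[OF F assms(1)]) (simp_all add: par_body_writes)
    have j': "j < n" using j layoutD(1)[OF assms(1)] by simp
    have "arrs (sem par_body t) aPAR = (arrs t aPAR)(j := of_bool (?q j))"
      using lay tj assms(2-4) j' inv
      by (intro par_body_correct[where n = n]) (simp_all add: agree_outsideD[OF F] par_body_writes)
    then show "\<forall>v<n. arrs (set_var vJ (Suc j) (sem par_body t)) aPAR v = of_bool (if v < Suc j then ?q v else p v)"
      using inv by (auto simp: less_Suc_eq)
  qed (use assms(5) in \<open>simp_all add: par_body_writes\<close>)
  then show ?thesis unfolding par_row_def layoutD(1)[OF assms(1)] by simp
qed

definition par_com :: com where "par_com = For vI vN par_row"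

lemma par_com_writes:
  "var_writes par_com = {vI, vJ, 0}" "arr_writes par_com = {aPAR}" "\<not> reads par_com" "\<not> writes par_com"
  by (simp_all add: par_com_def par_row_writes)

lemma par_com_correct:
  assumes "layout n s" "cover_matrix n R (arrs s aR)" "\<forall>v<n. arrs s aPAR v = 0"
  shows "\<forall>v<n. arrs (sem par_com s) aPAR v = of_bool (reach_par R [0..<n] v)"
proof -
  have "\<forall>v<n. arrs (sem (For vI vN par_row) s) aPAR v = of_bool (reach_par R [0..<vars s vN] v)"
  proof (rule For_invariant[where I = "\<lambda>u t. \<forall>v<n. arrs t aPAR v = of_bool (reach_par R [0..<u] v)"])
    fix u t assume u: "u < vars s vN" and inv: "\<forall>v<n. arrs t aPAR v = of_bool (reach_par R [0..<u] v)"
      and tu: "vars t vI = u" and F: "agree_outside vI par_row s t"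
    have lay: "layout n t" by (rule layout_agree[OF F assms(1)]) (simp_all add: par_row_writes)
    have u': "u < n" using u layoutD(1)[OF assms(1)] by simp
    have "cover_matrix n R (arrs t aR)" using assms(2) by (simp add: agree_outsideD[OF F] par_row_writes)
    from par_row_correct[OF lay tu u' this inv]
    show "\<forall>v<n. arrs (set_var vI (Suc u) (sem par_row t)) aPAR v = of_bool (reach_par R [0..<Suc u] v)"
      by (simp add: reach_par_snoc)
  qed (use assms(3) in \<open>simp_all add: par_row_writes reach_par_def\<close>)
  then show ?thesis unfolding par_com_def layoutD(1)[OF assms(1)] .
qed

subsection \<open>Kernels\<close>

definition set_array :: "nat \<Rightarrow> nat set \<Rightarrow> (nat \<Rightarrow> nat) \<Rightarrow> bool" where
  "set_array n A f \<longleftrightarrow> (\<forall>v<n. f v = of_bool (v \<in> A))"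

definition kernel_env :: "nat \<Rightarrow> nat rel \<Rightarrow> (nat \<Rightarrow> nat) \<Rightarrow> (nat \<Rightarrow> bool) \<Rightarrow> state \<Rightarrow> bool" where
  "kernel_env n A rank par s \<longleftrightarrow> layout n s \<and> adjacency A n s \<and> (\<forall>v<n. arrs s aRANK v = rank v)
     \<and> (\<forall>v<n. arrs s aPAR v = of_bool (par v))"

lemma kernel_env_agree:
  assumes "agree_outside i c s t" "kernel_env n A rank par s"
    "{vN, vM, vM1} \<inter> insert i (var_writes c) = {}" "{aROW, aADJ, aRANK, aPAR} \<inter> arr_writes c = {}"
  shows "kernel_env n A rank par t"
proof -
  have "arrs t aADJ = arrs s aADJ" "arrs t aRANK = arrs s aRANK" "arrs t aPAR = arrs s aPAR"
    using assms(4) by (auto intro!: agree_outsideD(2)[OF assms(1)])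
  moreover have "layout n t" using layout_agree[OF assms(1)] assms(2-4) unfolding kernel_env_def by blast
  ultimately show ?thesis using assms(2) unfolding kernel_env_def adjacency_def by simp
qed

lemma kernel_env_sem:
  assumes "kernel_env n A rank par s"
    "{vN, vM, vM1} \<inter> var_writes c = {}" "{aROW, aADJ, aRANK, aPAR} \<inter> arr_writes c = {}"
  shows "kernel_env n A rank par (sem c s)"
proof -
  have "arrs (sem c s) aADJ = arrs s aADJ" "arrs (sem c s) aRANK = arrs s aRANK" "arrs (sem c s) aPAR = arrs s aPAR"
    using assms(3) by (auto intro!: sem_arrs)
  moreover have "layout n (sem c s)" using layout_sem assms unfolding kernel_env_def by blast
  ultimately show ?thesis using assms(1) unfolding kernel_env_def adjacency_def by simp
qed

text \<open>The loop starts from the value that \<open>vF\<close> already has. The caller puts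
  membership in \<open>W\<close> there, so the result is the new membership in the kernel.\<close>

definition flag_com :: com where
  "flag_com = For vJ vN (Cond (both (Arr aADJ (cell_index (Var vI) (Var vJ))) (Arr aKER (Var vJ))) (Assign vF (Num 0)) skip)"

lemma flag_com_writes:
  "var_writes flag_com = {vJ, vF, 0}" "arr_writes flag_com = {}" "\<not> reads flag_com" "\<not> writes flag_com"
  by (auto simp: flag_com_def)

lemma flag_com_correct:
  assumes "kernel_env n A rank par s" "vars s vI = v" "v < n" "set_array n K (arrs s aKER)"
    "vars s vF = of_bool p" "A \<subseteq> {..<n} \<times> {..<n}"
  shows "vars (sem flag_com s) vF = of_bool (p \<and> A `` {v} \<inter> K = {})"
proof -
  let ?c = "Cond (both (Arr aADJ (cell_index (Var vI) (Var vJ))) (Arr aKER (Var vJ))) (Assign vF (Num 0)) skip"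
  have lay_s: "layout n s" using assms(1) unfolding kernel_env_def by blast
  have "vars (sem (For vJ vN ?c) s) vF = of_bool (p \<and> A `` {v} \<inter> K \<inter> {..<vars s vN} = {})"
  proof (rule For_invariant[where I = "\<lambda>j t. vars t vF = of_bool (p \<and> A `` {v} \<inter> K \<inter> {..<j} = {})"])
    fix j t assume j: "j < vars s vN" and inv: "vars t vF = of_bool (p \<and> A `` {v} \<inter> K \<inter> {..<j} = {})"
      and tj: "vars t vJ = j" and F: "agree_outside vJ ?c s t"
    have lay: "layout n t" by (rule layout_agree[OF F lay_s]) simp_all
    have j': "j < n" using j layoutD(1)[OF lay_s] by simp
    have "arrs t aADJ (v * (2 * n) + j) = of_bool ((v, j) \<in> A)"
      using assms(1,3) j' unfolding kernel_env_def adjacency_def by (simp add: agree_outsideD[OF F])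
    moreover have "arrs t aKER j = of_bool (j \<in> K)"
      using assms(4) j' unfolding set_array_def by (simp add: agree_outsideD[OF F])
    ultimately have guard: "0 < aval (both (Arr aADJ (cell_index (Var vI) (Var vJ))) (Arr aKER (Var vJ))) t
        \<longleftrightarrow> (v, j) \<in> A \<and> j \<in> K"
      using tj assms(2,3) layoutD(4)[OF lay, of v] by (simp add: agree_outsideD[OF F])
    have "A `` {v} \<inter> K \<inter> {..<Suc j} = {} \<longleftrightarrow> A `` {v} \<inter> K \<inter> {..<j} = {} \<and> \<not> ((v, j) \<in> A \<and> j \<in> K)"
      by (auto simp: lessThan_Suc)
    then show "vars (set_var vJ (Suc j) (sem ?c t)) vF = of_bool (p \<and> A `` {v} \<inter> K \<inter> {..<Suc j} = {})"
      using guard inv by auto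
  qed (use assms(5) in simp_all)
  moreover have "A `` {v} \<inter> K \<inter> {..<n} = A `` {v} \<inter> K" using assms(6) by auto
  ultimately show ?thesis unfolding flag_com_def layoutD(1)[OF lay_s] by simp
qed

definition kernel_update_com :: com where
  "kernel_update_com = Cond (equal_exp (Arr aRANK (Var vI)) (Var vR))
     (Assign vF (Arr aW (Var vI)) ;; flag_com ;; Update aKER (Var vI) (Var vF)) skip"

lemma kernel_update_com_writes:
  "var_writes kernel_update_com = {vJ, vF, 0}" "arr_writes kernel_update_com = {aKER}"
  "\<not> reads kernel_update_com" "\<not> writes kernel_update_com"
  by (auto simp: kernel_update_com_def flag_com_writes)

lemma kernel_update_com_correct:
  assumes "kernel_env n A rank par s" "vars s vI = v" "v < n" "vars s vR = r"
    "set_array n K (arrs s aKER)" "set_array n W (arrs s aW)" "A \<subseteq> {..<n} \<times> {..<n}"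
  shows "set_array n (if rank v = r then kernel_update A W v K else K) (arrs (sem kernel_update_com s) aKER)"
proof (cases "rank v = r")
  case True
  have rank: "arrs s aRANK v = rank v" using assms(1,3) unfolding kernel_env_def by blast
  let ?s = "set_var vF (arrs s aW v) s"
  have "kernel_env n A rank par ?s"
    using kernel_env_sem[OF assms(1), of "Assign vF (Arr aW (Var vI))"] assms(2) by simp
  then have "vars (sem flag_com ?s) vF = of_bool (v \<in> W \<and> A `` {v} \<inter> K = {})"
    using assms(2,3,5-7) by (intro flag_com_correct[where n = n]) (auto simp: set_array_def)
  then show ?thesis
    using True rank assms(2-5) unfolding kernel_update_com_def set_array_def kernel_update_def
    by (auto simp: sem_frame flag_com_writes)
next
  case False
  have "arrs s aRANK v = rank v" using assms(1,3) unfolding kernel_env_def by blast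
  then show ?thesis using False assms(2-5) by (simp add: kernel_update_com_def)
qed

definition kernel_sweep_com :: com where "kernel_sweep_com = For vI vN kernel_update_com"

lemma kernel_sweep_com_writes:
  "var_writes kernel_sweep_com = {vI, vJ, vF, 0}" "arr_writes kernel_sweep_com = {aKER}"
  "\<not> reads kernel_sweep_com" "\<not> writes kernel_sweep_com"
  by (auto simp: kernel_sweep_com_def kernel_update_com_writes)

lemma kernel_sweep_com_correct:
  assumes "kernel_env n A rank par s" "vars s vR = r"
    "set_array n K (arrs s aKER)" "set_array n W (arrs s aW)" "A \<subseteq> {..<n} \<times> {..<n}"
  shows "set_array n (kernel_sweep A rank W [0..<n] r K) (arrs (sem kernel_sweep_com s) aKER)"
proof -
  have N: "vars s vN = n" using assms(1) layoutD(1) unfolding kernel_env_def by blast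
  have "set_array n (kernel_sweep A rank W [0..<vars s vN] r K) (arrs (sem (For vI vN kernel_update_com) s) aKER)"
  proof (rule For_invariant[where I = "\<lambda>j t. set_array n (kernel_sweep A rank W [0..<j] r K) (arrs t aKER)"])
    fix j t assume j: "j < vars s vN" and inv: "set_array n (kernel_sweep A rank W [0..<j] r K) (arrs t aKER)"
      and tj: "vars t vI = j" and F: "agree_outside vI kernel_update_com s t"
    have env: "kernel_env n A rank par t"
      by (rule kernel_env_agree[OF F assms(1)]) (simp_all add: kernel_update_com_writes)
    show "set_array n (kernel_sweep A rank W [0..<Suc j] r K) (arrs (set_var vI (Suc j) (sem kernel_update_com t)) aKER)"
      using kernel_update_com_correct[OF env tj _ _ inv, of r W] j N assms(2,4,5)
      unfolding kernel_sweep_def by (simp add: agree_outsideD[OF F] kernel_update_com_writes)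
  qed (use assms(3) in \<open>simp_all add: kernel_update_com_writes kernel_sweep_def\<close>)
  then show ?thesis unfolding kernel_sweep_com_def N .
qed

definition kernel_phase_com :: com where "kernel_phase_com = For vH vN kernel_sweep_com"

lemma kernel_phase_com_writes:
  "var_writes kernel_phase_com = {vH, vI, vJ, vF, 0}" "arr_writes kernel_phase_com = {aKER}"
  "\<not> reads kernel_phase_com" "\<not> writes kernel_phase_com"
  by (auto simp: kernel_phase_com_def kernel_sweep_com_writes)

lemma kernel_phase_com_correct:
  assumes "kernel_env n A rank par s" "vars s vR = r"
    "set_array n K (arrs s aKER)" "set_array n W (arrs s aW)" "A \<subseteq> {..<n} \<times> {..<n}"
  shows "set_array n ((kernel_sweep A rank W [0..<n] r ^^ n) K) (arrs (sem kernel_phase_com s) aKER)"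
proof -
  have N: "vars s vN = n" using assms(1) layoutD(1) unfolding kernel_env_def by blast
  have "set_array n ((kernel_sweep A rank W [0..<n] r ^^ vars s vN) K) (arrs (sem (For vH vN kernel_sweep_com) s) aKER)"
  proof (rule For_invariant[where I = "\<lambda>j t. set_array n ((kernel_sweep A rank W [0..<n] r ^^ j) K) (arrs t aKER)"])
    fix j t assume inv: "set_array n ((kernel_sweep A rank W [0..<n] r ^^ j) K) (arrs t aKER)"
      and F: "agree_outside vH kernel_sweep_com s t"
    have env: "kernel_env n A rank par t"
      by (rule kernel_env_agree[OF F assms(1)]) (simp_all add: kernel_sweep_com_writes)
    show "set_array n ((kernel_sweep A rank W [0..<n] r ^^ Suc j) K) (arrs (set_var vH (Suc j) (sem kernel_sweep_com t)) aKER)"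
      using kernel_sweep_com_correct[OF env _ inv, of r W] assms(2,4,5)
      by (simp add: agree_outsideD[OF F] kernel_sweep_com_writes)
  qed (use assms(3) in \<open>simp_all add: kernel_sweep_com_writes\<close>)
  then show ?thesis unfolding kernel_phase_com_def N .
qed

definition kernel_start_com :: com where
  "kernel_start_com = For vI vN (Cond (Arr aW (Var vI)) (Update aKER (Var vI) (Arr aPAR (Var vI))) (Update aKER (Var vI) (Num 0)))"

lemma kernel_start_com_writes:
  "var_writes kernel_start_com = {vI}" "arr_writes kernel_start_com = {aKER}"
  "\<not> reads kernel_start_com" "\<not> writes kernel_start_com"
  by (auto simp: kernel_start_com_def)

lemma kernel_start_com_correct:
  assumes "kernel_env n A rank par s" "set_array n W (arrs s aW)"
  shows "set_array n {v \<in> W. par v} (arrs (sem kernel_start_com s) aKER)"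
proof -
  have N: "vars s vN = n" using assms(1) layoutD(1) unfolding kernel_env_def by blast
  let ?c = "Cond (Arr aW (Var vI)) (Update aKER (Var vI) (Arr aPAR (Var vI))) (Update aKER (Var vI) (Num 0))"
  have "set_array (vars s vN) {v \<in> W. par v} (arrs (sem (For vI vN ?c) s) aKER)"
  proof (rule For_invariant[where I = "\<lambda>j t. set_array j {v \<in> W. par v} (arrs t aKER)"])
    fix j t assume j: "j < vars s vN" and inv: "set_array j {v \<in> W. par v} (arrs t aKER)"
      and tj: "vars t vI = j" and F: "agree_outside vI ?c s t"
    have "arrs t aW j = of_bool (j \<in> W)" "arrs t aPAR j = of_bool (par j)"
      using assms j N unfolding set_array_def kernel_env_def by (simp_all add: agree_outsideD[OF F])
    then show "set_array (Suc j) {v \<in> W. par v} (arrs (set_var vI (Suc j) (sem ?c t)) aKER)"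
      using inv tj unfolding set_array_def by (auto simp: less_Suc_eq)
  qed (simp_all add: set_array_def)
  then show ?thesis unfolding kernel_start_com_def N .
qed

definition kernel_com :: com where
  "kernel_com = kernel_start_com ;; For vR vM1 kernel_phase_com"

lemma kernel_com_writes:
  "var_writes kernel_com = {vR, vH, vI, vJ, vF, 0}" "arr_writes kernel_com = {aKER}"
  "\<not> reads kernel_com" "\<not> writes kernel_com"
  by (auto simp: kernel_com_def kernel_phase_com_writes kernel_start_com_writes)

lemma kernel_com_correct:
  assumes "kernel_env n A rank par s" "set_array n W (arrs s aW)" "A \<subseteq> {..<n} \<times> {..<n}"
  shows "set_array n (kernel_iter A rank par [0..<n] (Suc (2 * n)) W) (arrs (sem kernel_com s) aKER)"
proof -
  let ?s = "sem kernel_start_com s"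
  have env: "kernel_env n A rank par ?s"
    by (rule kernel_env_sem[OF assms(1)]) (simp_all add: kernel_start_com_writes)
  have M1: "vars ?s vM1 = Suc (2 * n)" using env layoutD(3) unfolding kernel_env_def by blast
  have W: "set_array n W (arrs ?s aW)" using assms(2) by (simp add: sem_frame kernel_start_com_writes)
  have "set_array n (kernel_iter A rank par [0..<n] (vars ?s vM1) W) (arrs (sem (For vR vM1 kernel_phase_com) ?s) aKER)"
  proof (rule For_invariant[where I = "\<lambda>r t. set_array n (kernel_iter A rank par [0..<n] r W) (arrs t aKER)"])
    fix r t assume inv: "set_array n (kernel_iter A rank par [0..<n] r W) (arrs t aKER)"
      and tr: "vars t vR = r" and F: "agree_outside vR kernel_phase_com ?s t"
    have env': "kernel_env n A rank par t"
      by (rule kernel_env_agree[OF F env]) (simp_all add: kernel_phase_com_writes)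
    show "set_array n (kernel_iter A rank par [0..<n] (Suc r) W) (arrs (set_var vR (Suc r) (sem kernel_phase_com t)) aKER)"
      using kernel_phase_com_correct[OF env' tr inv, of W] W assms(3)
      by (simp add: agree_outsideD[OF F] kernel_phase_com_writes kernel_iter_def)
  qed (use kernel_start_com_correct[OF assms(1,2)] in \<open>simp_all add: kernel_phase_com_writes kernel_iter_def\<close>)
  then show ?thesis unfolding kernel_com_def M1 by simp
qed

subsection \<open>Colouring\<close>

text \<open>\<open>vT\<close> is only an upper bound for the number of entries, because loop bounds
  are computed from \<open>n\<close> and \<open>k\<close> before the lists are read.\<close>

definition entries :: "(nat \<times> nat) list \<Rightarrow> nat \<Rightarrow> nat \<Rightarrow> state \<Rightarrow> bool" where
  "entries F n k s \<longleftrightarrow> length F \<le> vars s vT \<and> vars s vK = k \<and> vars s vN = n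
     \<and> (\<forall>q<length F. arrs s aOWN q = fst (F ! q) \<and> arrs s aCOL q = snd (F ! q) \<and> fst (F ! q) < n)"

definition entry_status :: "(nat \<times> nat) list \<Rightarrow> (nat \<Rightarrow> nat set) \<times> nat set \<Rightarrow> nat \<Rightarrow> nat" where
  "entry_status F CP q =
     (if q < length F then
        if snd (F ! q) \<notin> snd CP then 1 else if snd (F ! q) \<in> fst CP (fst (F ! q)) then 2 else 0
      else 0)"

text \<open>The set of processed colours is never stored as such; it is visible only in the statuses
  of the entries.\<close>

definition colour_state :: "(nat \<times> nat) list \<Rightarrow> nat \<Rightarrow> (nat \<Rightarrow> nat set) \<times> nat set \<Rightarrow> state \<Rightarrow> bool" where
  "colour_state F n CP s \<longleftrightarrow> (\<forall>q<vars s vT. arrs s aST q = entry_status F CP q)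
     \<and> (\<forall>v<n. arrs s aCNT v = card (fst CP v))"

lemma entries_agree:
  assumes "agree_outside i c s t" "entries F n k s" "{vN, vK, vT} \<inter> insert i (var_writes c) = {}"
    "{aOWN, aCOL} \<inter> arr_writes c = {}"
  shows "entries F n k t"
proof -
  have "vars t vN = vars s vN" "vars t vK = vars s vK" "vars t vT = vars s vT"
    using assms(3) by (auto intro!: agree_outsideD(1)[OF assms(1)])
  moreover have "arrs t aOWN = arrs s aOWN" "arrs t aCOL = arrs s aCOL"
    using assms(4) by (auto intro!: agree_outsideD(2)[OF assms(1)])
  ultimately show ?thesis using assms(2) unfolding entries_def by simp
qed

lemma entries_sem:
  assumes "entries F n k s" "{vN, vK, vT} \<inter> var_writes c = {}" "{aOWN, aCOL} \<inter> arr_writes c = {}"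
  shows "entries F n k (sem c s)"
proof -
  have "vars (sem c s) vN = vars s vN" "vars (sem c s) vK = vars s vK" "vars (sem c s) vT = vars s vT"
    using assms(2) by (auto intro!: sem_vars)
  moreover have "arrs (sem c s) aOWN = arrs s aOWN" "arrs (sem c s) aCOL = arrs s aCOL"
    using assms(3) by (auto intro!: sem_arrs)
  ultimately show ?thesis using assms(1) unfolding entries_def by simp
qed

definition clear_com :: com where "clear_com = For vI vN (Update aW (Var vI) (Num 0))"

lemma clear_com_writes:
  "var_writes clear_com = {vI}" "arr_writes clear_com = {aW}" "\<not> reads clear_com" "\<not> writes clear_com"
  by (simp_all add: clear_com_def)

lemma clear_com_correct:
  assumes "vars s vN = n"
  shows "set_array n {} (arrs (sem clear_com s) aW)"
proof -
  let ?c = "Update aW (Var vI) (Num 0)"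
  have "set_array (vars s vN) {} (arrs (sem (For vI vN ?c) s) aW)"
  proof (rule For_invariant[where I = "\<lambda>j t. set_array j {} (arrs t aW)"])
    fix j and t :: state assume "set_array j {} (arrs t aW)" "vars t vI = j"
    then show "set_array (Suc j) {} (arrs (set_var vI (Suc j) (sem ?c t)) aW)"
      by (simp add: set_array_def less_Suc_eq)
  qed (simp_all add: set_array_def)
  then show ?thesis using assms unfolding clear_com_def by simp
qed

definition mark_com :: com where
  "mark_com = For vI vT
     (Cond (equal_exp (Arr aST (Var vI)) (Num 1))
       (Cond (equal_exp (Arr aCOL (Var vI)) (Var vC))
         (Cond (Minus (Var vK) (Arr aCNT (Arr aOWN (Var vI)))) (Update aW (Arr aOWN (Var vI)) (Num 1)) skip) skip) skip)"

lemma mark_com_writes: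
  "var_writes mark_com = {vI, 0}" "arr_writes mark_com = {aW}" "\<not> reads mark_com" "\<not> writes mark_com"
  by (simp_all add: mark_com_def)

lemma mark_com_correct:
  assumes "entries F n k s" "colour_state F n CP s" "vars s vC = c" "set_array n {} (arrs s aW)"
    and S: "\<And>v c. v < n \<Longrightarrow> c \<in> S v \<longleftrightarrow> (v, c) \<in> set F"
  shows "set_array n (colour_class {..<n} k S c CP) (arrs (sem mark_com s) aW)"
proof -
  obtain C P where CP: "CP = (C, P)" by (cases CP)
  let ?c = "Cond (equal_exp (Arr aST (Var vI)) (Num 1))
       (Cond (equal_exp (Arr aCOL (Var vI)) (Var vC))
         (Cond (Minus (Var vK) (Arr aCNT (Arr aOWN (Var vI)))) (Update aW (Arr aOWN (Var vI)) (Num 1)) skip) skip) skip"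
  let ?W = "\<lambda>j. {v. card (C v) < k \<and> c \<notin> P \<and> (\<exists>q<j. q < length F \<and> F ! q = (v, c))}"
  have "set_array n (?W (vars s vT)) (arrs (sem (For vI vT ?c) s) aW)"
  proof (rule For_invariant[where I = "\<lambda>j t. set_array n (?W j) (arrs t aW)"])
    fix j t assume j: "j < vars s vT" and inv: "set_array n (?W j) (arrs t aW)"
      and tj: "vars t vI = j" and F: "agree_outside vI ?c s t"
    have ent: "entries F n k t" by (rule entries_agree[OF F assms(1)]) simp_all
    have st: "arrs t aST j = entry_status F CP j"
      using assms(2) j unfolding colour_state_def by (simp add: agree_outsideD[OF F])
    have cnt: "arrs t aCNT v = card (C v)" if "v < n" for v
      using assms(2) that unfolding colour_state_def CP by (simp add: agree_outsideD[OF F])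
    have vc: "vars t vC = c" "vars t vK = k" using assms(3) ent by (simp_all add: agree_outsideD[OF F] entries_def)
    show "set_array n (?W (Suc j)) (arrs (set_var vI (Suc j) (sem ?c t)) aW)"
    proof (cases "j < length F \<and> snd (F ! j) = c \<and> c \<notin> P \<and> card (C (fst (F ! j))) < k")
      case True
      then have own: "arrs t aOWN j = fst (F ! j)" "arrs t aCOL j = c" "fst (F ! j) < n"
        using ent unfolding entries_def by auto
      then have "arrs (sem ?c t) aW = (arrs t aW)(fst (F ! j) := 1)"
        using True st vc tj cnt by (simp add: entry_status_def CP)
      moreover have "?W (Suc j) = insert (fst (F ! j)) (?W j)"
        using True by (auto simp: less_Suc_eq prod_eq_iff)
      ultimately show ?thesis using inv unfolding set_array_def by auto
    next
      case False
      have "arrs (sem ?c t) aW = arrs t aW"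
      proof (cases "j < length F")
        case True
        then have "arrs t aOWN j = fst (F ! j)" "arrs t aCOL j = snd (F ! j)" "fst (F ! j) < n"
          using ent unfolding entries_def by auto
        then show ?thesis using False True st vc tj cnt by (auto simp: entry_status_def CP)
      next
        case jF: False
        then show ?thesis using st tj by (simp add: entry_status_def)
      qed
      moreover have "?W (Suc j) = ?W j" using False by (auto simp: less_Suc_eq)
      ultimately show ?thesis using inv by simp
    qed
  qed (use assms(4) in simp_all)
  moreover have "v \<in> ?W (vars s vT) \<longleftrightarrow> v \<in> colour_class {..<n} k S c CP" if "v < n" for v
  proof -
    have "length F \<le> vars s vT" using assms(1) unfolding entries_def by simp
    then have "(\<exists>q<vars s vT. q < length F \<and> F ! q = (v, c)) \<longleftrightarrow> (v, c) \<in> set F"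
      unfolding in_set_conv_nth by (meson less_le_trans)
    then show ?thesis using S[OF that] that unfolding colour_class_def CP by auto
  qed
  ultimately show ?thesis unfolding mark_com_def set_array_def by simp
qed

definition award_com :: com where
  "award_com = For vI vT
     (Cond (equal_exp (Arr aST (Var vI)) (Num 1))
       (Cond (equal_exp (Arr aCOL (Var vI)) (Var vC))
         (Cond (Arr aKER (Arr aOWN (Var vI)))
           (Update aST (Var vI) (Num 2) ;;
            Update aCNT (Arr aOWN (Var vI)) (Plus (Arr aCNT (Arr aOWN (Var vI))) (Num 1)))
           (Update aST (Var vI) (Num 0))) skip) skip)"

lemma award_com_writes:
  "var_writes award_com = {vI, 0}" "arr_writes award_com = {aST, aCNT}" "\<not> reads award_com" "\<not> writes award_com"
  by (auto simp: award_com_def)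

text \<open>Since \<open>K\<close> lies in the colour class, each of its vertices has an entry with
  colour \<open>c\<close>; since \<open>F\<close> is distinct it has just one, so its counter goes
  up exactly once.\<close>

lemma award_com_correct:
  assumes "entries F n k s" "colour_state F n (C, P) s" "vars s vC = c" "set_array n K (arrs s aKER)"
    and S: "\<And>v c. v < n \<Longrightarrow> c \<in> S v \<longleftrightarrow> (v, c) \<in> set F"
    and K: "K \<subseteq> colour_class {..<n} k S c (C, P)"
    and CP: "\<And>v. v < n \<Longrightarrow> C v \<subseteq> P" "\<And>v. v < n \<Longrightarrow> finite (C v)"
    and "distinct F"
  shows "colour_state F n (\<lambda>v. if v \<in> K then insert c (C v) else C v, insert c P) (sem award_com s)"
proof -
  let ?c = "Cond (equal_exp (Arr aST (Var vI)) (Num 1))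
       (Cond (equal_exp (Arr aCOL (Var vI)) (Var vC))
         (Cond (Arr aKER (Arr aOWN (Var vI)))
           (Update aST (Var vI) (Num 2) ;;
            Update aCNT (Arr aOWN (Var vI)) (Plus (Arr aCNT (Arr aOWN (Var vI))) (Num 1)))
           (Update aST (Var vI) (Num 0))) skip) skip"
  let ?CP' = "(\<lambda>v. if v \<in> K then insert c (C v) else C v, insert c P)"
  let ?hit = "\<lambda>j v. v \<in> K \<and> (\<exists>q<j. q < length F \<and> F ! q = (v, c))"
  let ?I = "\<lambda>j t. (\<forall>q<vars s vT. arrs t aST q = entry_status F (if q < j then ?CP' else (C, P)) q)
      \<and> (\<forall>v<n. arrs t aCNT v = card (C v) + of_bool (?hit j v))"
  have KP: "c \<notin> P" "v < n" "(v, c) \<in> set F" if "v \<in> K" for v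
    using that K S unfolding colour_class_def by auto
  have "?I (vars s vT) (sem (For vI vT ?c) s)"
  proof (rule For_invariant[where I = ?I])
    fix j t assume j: "j < vars s vT" and inv: "?I j t"
      and tj: "vars t vI = j" and F: "agree_outside vI ?c s t"
    have ent: "entries F n k t" by (rule entries_agree[OF F assms(1)]) simp_all
    have st: "arrs t aST j = entry_status F (C, P) j" using inv j by auto
    have vc: "vars t vC = c" using assms(3) by (simp add: agree_outsideD[OF F])
    have ker: "arrs t aKER v = of_bool (v \<in> K)" if "v < n" for v
      using assms(4) that unfolding set_array_def by (simp add: agree_outsideD[OF F])
    show "?I (Suc j) (set_var vI (Suc j) (sem ?c t))"
    proof (cases "j < length F \<and> snd (F ! j) = c \<and> c \<notin> P")
      case True
      define v where "v = fst (F ! j)"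
      have Fj: "F ! j = (v, c)" using True by (auto simp: v_def prod_eq_iff)
      have own: "arrs t aOWN j = v" "arrs t aCOL j = c" "v < n"
        using ent True unfolding entries_def v_def by auto
      have guard: "arrs t aST j = 1" using st True by (simp add: entry_status_def)
      have notC: "c \<notin> C v" using CP(1)[OF own(3)] True by blast
      have new: "entry_status F ?CP' j = (if v \<in> K then 2 else 0)"
        using True notC unfolding entry_status_def Fj by simp
      have first: "\<not> (\<exists>q<j. q < length F \<and> F ! q = (v, c))"
        using nth_eq_iff_index_eq[OF \<open>distinct F\<close>] True Fj by (metis less_irrefl)
      have hit: "?hit (Suc j) w \<longleftrightarrow> ?hit j w \<or> w = v \<and> v \<in> K" for w
        using True Fj by (auto simp: less_Suc_eq)
      have ST: "arrs (sem ?c t) aST = (arrs t aST)(j := if v \<in> K then 2 else 0)"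
        and CNT: "arrs (sem ?c t) aCNT = (if v \<in> K then (arrs t aCNT)(v := arrs t aCNT v + 1) else arrs t aCNT)"
        using guard own tj vc ker[OF own(3)] by simp_all
      show ?thesis
        using inv new first hit j unfolding set_var_simps ST CNT by (auto simp: less_Suc_eq)
    next
      case False
      have same: "arrs (sem ?c t) = arrs t"
      proof (cases "j < length F")
        case True
        then have "arrs t aCOL j = snd (F ! j)" using ent unfolding entries_def by auto
        then show ?thesis using False True st vc tj by (auto simp: entry_status_def)
      qed (use st tj in \<open>simp add: entry_status_def\<close>)
      \<comment> \<open>If \<open>c\<close> was processed before, its class and therefore
        \<open>K\<close> is empty, and inserting \<open>c\<close> into \<open>P\<close> changes
        nothing.\<close>
      have "c \<in> P \<Longrightarrow> K = {}" using KP(1) by blast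
      then have "entry_status F ?CP' j = entry_status F (C, P) j"
        using False by (auto simp: entry_status_def)
      moreover have "?hit (Suc j) w \<longleftrightarrow> ?hit j w" for w
        using False KP(1) by (auto simp: less_Suc_eq)
      ultimately show ?thesis using inv unfolding set_var_simps same by (auto simp: less_Suc_eq)
    qed
  qed (use assms(2) in \<open>auto simp: colour_state_def\<close>)
  moreover have "card (C v) + of_bool (?hit (vars s vT) v) = card (fst ?CP' v)" if "v < n" for v
  proof (cases "v \<in> K")
    case True
    have "length F \<le> vars s vT" using assms(1) unfolding entries_def by simp
    then have "?hit (vars s vT) v" using KP(3)[OF True] True unfolding in_set_conv_nth by (meson less_le_trans)
    moreover have "c \<notin> C v" using CP(1)[OF that] KP(1)[OF True] by blast
    ultimately show ?thesis using True CP(2)[OF that] by simp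
  qed simp
  moreover have "vars (sem award_com s) vT = vars s vT" by (simp add: sem_vars award_com_writes)
  ultimately show ?thesis unfolding colour_state_def award_com_def by simp
qed

definition colour_body :: com where
  "colour_body = Assign vC (Arr aCOL (Var vQ)) ;; clear_com ;; mark_com ;; kernel_com ;; award_com"

lemma colour_body_writes:
  "var_writes colour_body = {vC, vR, vH, vI, vJ, vF, 0}" "arr_writes colour_body = {aW, aKER, aST, aCNT}"
  "\<not> reads colour_body" "\<not> writes colour_body"
  by (auto simp: colour_body_def clear_com_writes mark_com_writes kernel_com_writes award_com_writes)

lemma colour_body_correct:
  assumes env: "kernel_env n A rank par s" and ent: "entries F n k s" and state: "colour_state F n CP s"
    and c: "arrs s aCOL (vars s vQ) = c"
    and S: "\<And>v c. v < n \<Longrightarrow> c \<in> S v \<longleftrightarrow> (v, c) \<in> set F"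
    and A: "A \<subseteq> {..<n} \<times> {..<n}"
    and K: "kernel_iter A rank par [0..<n] (Suc (2 * n)) (colour_class {..<n} k S c CP) \<subseteq> colour_class {..<n} k S c CP"
    and CP: "\<And>v. v < n \<Longrightarrow> fst CP v \<subseteq> snd CP" "\<And>v. v < n \<Longrightarrow> finite (fst CP v)"
    and "distinct F"
  shows "colour_state F n (colour_step (kernel_iter A rank par [0..<n] (Suc (2 * n))) {..<n} k S c CP) (sem colour_body s)"
proof -
  define s1 where "s1 = sem (Assign vC (Arr aCOL (Var vQ))) s"
  define s2 where "s2 = sem clear_com s1"
  define s3 where "s3 = sem mark_com s2"
  define s4 where "s4 = sem kernel_com s3"
  have env2: "kernel_env n A rank par s2"
    unfolding s2_def s1_def by (intro kernel_env_sem env) (simp_all add: clear_com_writes)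
  have ent2: "entries F n k s2"
    unfolding s2_def s1_def by (intro entries_sem ent) (simp_all add: clear_com_writes)
  have state2: "colour_state F n CP s2"
    using state unfolding colour_state_def s2_def s1_def by (simp add: sem_frame clear_com_writes)
  have c2: "vars s2 vC = c" unfolding s2_def s1_def using c by (simp add: sem_frame clear_com_writes)
  have "vars s1 vN = n" using ent unfolding s1_def entries_def by simp
  then have "set_array n {} (arrs s2 aW)" unfolding s2_def by (rule clear_com_correct)
  then have W3: "set_array n (colour_class {..<n} k S c CP) (arrs s3 aW)"
    unfolding s3_def by (rule mark_com_correct[OF ent2 state2 c2 _ S])
  have env3: "kernel_env n A rank par s3"
    unfolding s3_def by (intro kernel_env_sem env2) (simp_all add: mark_com_writes)
  have K4: "set_array n (kernel_iter A rank par [0..<n] (Suc (2 * n)) (colour_class {..<n} k S c CP)) (arrs s4 aKER)"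
    unfolding s4_def by (rule kernel_com_correct[OF env3 W3 A])
  have ent4: "entries F n k s4"
    unfolding s4_def s3_def by (intro entries_sem ent2) (simp_all add: mark_com_writes kernel_com_writes)
  have state4: "colour_state F n (fst CP, snd CP) s4"
    using state2 unfolding colour_state_def s4_def s3_def
    by (simp add: sem_frame mark_com_writes kernel_com_writes)
  have c4: "vars s4 vC = c" using c2 unfolding s4_def s3_def by (simp add: sem_frame mark_com_writes kernel_com_writes)
  have "colour_state F n (\<lambda>v. if v \<in> kernel_iter A rank par [0..<n] (Suc (2 * n)) (colour_class {..<n} k S c CP)
      then insert c (fst CP v) else fst CP v, insert c (snd CP)) (sem award_com s4)"
    using K CP \<open>distinct F\<close> by (intro award_com_correct[OF ent4 state4 c4 K4 S]) simp_all
  moreover have "sem colour_body s = sem award_com s4"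
    unfolding colour_body_def s4_def s3_def s2_def s1_def by simp
  ultimately show ?thesis unfolding colour_step_def by (simp add: split_beta)
qed

text \<open>The loop also visits the slots behind the stored entries. Whatever colour is found there
  is processed like any other, which is harmless because the invariant holds for every sequence of
  colours.\<close>

definition colour_com :: com where "colour_com = For vQ vT colour_body"

lemma colour_com_writes:
  "var_writes colour_com = {vQ, vC, vR, vH, vI, vJ, vF, 0}" "arr_writes colour_com = {aW, aKER, aST, aCNT}"
  "\<not> reads colour_com" "\<not> writes colour_com"
  by (auto simp: colour_com_def colour_body_writes)

lemma colour_com_correct:
  fixes S :: "nat \<Rightarrow> nat set"
  defines "run \<equiv> \<lambda>A rank par n k S cs.
    fold (colour_step (kernel_iter A rank par [0..<n] (Suc (2 * n))) {..<n} k S) cs (\<lambda>_. {}, {})"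
  assumes env: "kernel_env n A rank par s" and ent: "entries F n k s"
    and state: "colour_state F n (\<lambda>_. {}, {}) s"
    and S: "\<And>v c. v < n \<Longrightarrow> c \<in> S v \<longleftrightarrow> (v, c) \<in> set F"
    and A: "A \<subseteq> {..<n} \<times> {..<n}"
    and K: "\<And>W. W \<subseteq> {..<n} \<Longrightarrow> kernel_iter A rank par [0..<n] (Suc (2 * n)) W \<subseteq> W"
    and CP: "\<And>cs v. v < n \<Longrightarrow> fst (run A rank par n k S cs) v \<subseteq> S v \<inter> snd (run A rank par n k S cs)"
    and "distinct F"
  shows "colour_state F n (run A rank par n k S (map (arrs s aCOL) [0..<vars s vT])) (sem colour_com s)"
proof -
  have fin: "finite (S v)" if "v < n" for v
    by (rule finite_subset[of _ "snd ` set F"]) (use S[OF that] in force)+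
  let ?CP = "\<lambda>q. run A rank par n k S (map (arrs s aCOL) [0..<q])"
  have "colour_state F n (?CP (vars s vT)) (sem (For vQ vT colour_body) s)"
  proof (rule For_invariant[where I = "\<lambda>q t. colour_state F n (?CP q) t"])
    fix q t assume q: "q < vars s vT" and inv: "colour_state F n (?CP q) t"
      and tq: "vars t vQ = q" and G: "agree_outside vQ colour_body s t"
    have env': "kernel_env n A rank par t" by (rule kernel_env_agree[OF G env]) (simp_all add: colour_body_writes)
    have ent': "entries F n k t" by (rule entries_agree[OF G ent]) (simp_all add: colour_body_writes)
    have col: "arrs t aCOL (vars t vQ) = arrs s aCOL q"
      using tq by (simp add: agree_outsideD[OF G] colour_body_writes)
    have "colour_state F n (colour_step (kernel_iter A rank par [0..<n] (Suc (2 * n))) {..<n} k S (arrs s aCOL q) (?CP q))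
        (sem colour_body t)"
    proof (rule colour_body_correct[OF env' ent' inv col S A _ _ _ \<open>distinct F\<close>])
      show "kernel_iter A rank par [0..<n] (Suc (2 * n)) (colour_class {..<n} k S (arrs s aCOL q) (?CP q))
          \<subseteq> colour_class {..<n} k S (arrs s aCOL q) (?CP q)"
        by (rule K) (auto simp: colour_class_def)
      show "fst (?CP q) v \<subseteq> snd (?CP q)" if "v < n" for v using CP[OF that] by blast
      show "finite (fst (?CP q) v)" if "v < n" for v using CP[OF that] fin[OF that] finite_subset by blast
    qed
    moreover have "?CP (Suc q) = colour_step (kernel_iter A rank par [0..<n] (Suc (2 * n))) {..<n} k S (arrs s aCOL q) (?CP q)"
      unfolding run_def by simp
    ultimately show "colour_state F n (?CP (Suc q)) (set_var vQ (Suc q) (sem colour_body t))"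
      unfolding colour_state_def by simp
  qed (use state in \<open>simp_all add: colour_body_writes run_def colour_state_def\<close>)
  then show ?thesis unfolding colour_com_def .
qed

text \<open>Entries are stored vertex by vertex, so the awarded colours come out as the
  concatenation of the chosen lists.\<close>

definition output_com :: com where
  "output_com = For vI vT (Cond (equal_exp (Arr aST (Var vI)) (Num 2)) (Output (Arr aCOL (Var vI))) skip)"

lemma output_com_correct:
  assumes ent: "entries F n k s" and state: "colour_state F n (C, P) s" and P: "snd ` set F \<subseteq> P"
  shows "outp (sem output_com s) = outp s @ map snd (filter (\<lambda>(v, c). c \<in> C v) F)"
proof -
  let ?c = "Cond (equal_exp (Arr aST (Var vI)) (Num 2)) (Output (Arr aCOL (Var vI))) skip"
  have "outp (sem (For vI vT ?c) s) = outp s @ map snd (filter (\<lambda>(v, c). c \<in> C v) (take (vars s vT) F))"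
  proof (rule For_invariant[where I = "\<lambda>j t. outp t = outp s @ map snd (filter (\<lambda>(v, c). c \<in> C v) (take j F))"])
    fix j t assume j: "j < vars s vT" and inv: "outp t = outp s @ map snd (filter (\<lambda>(v, c). c \<in> C v) (take j F))"
      and tj: "vars t vI = j" and G: "agree_outside vI ?c s t"
    have st: "arrs t aST j = entry_status F (C, P) j"
      using state j unfolding colour_state_def by (simp add: agree_outsideD[OF G])
    show "outp (set_var vI (Suc j) (sem ?c t)) = outp s @ map snd (filter (\<lambda>(v, c). c \<in> C v) (take (Suc j) F))"
    proof (cases "j < length F")
      case True
      then have "arrs t aCOL j = snd (F ! j)"
        using ent unfolding entries_def by (simp add: agree_outsideD[OF G])
      moreover have "snd (F ! j) \<in> P" using P True by auto
      ultimately show ?thesis using st tj inv True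
        by (auto simp: entry_status_def take_Suc_conv_app_nth split_beta)
    next
      case False
      then show ?thesis using st tj inv by (simp add: entry_status_def)
    qed
  qed simp_all
  then show ?thesis using ent unfolding output_com_def entries_def by simp
qed

subsection \<open>Reading the input\<close>

definition rows_com :: com where
  "rows_com = For vI vM (Update aROW (Var vI) (Var vR) ;; Assign vR (Plus (Var vR) (Var vM)))"

lemma rows_com_writes:
  "var_writes rows_com = {vI, vR}" "arr_writes rows_com = {aROW}" "\<not> reads rows_com" "\<not> writes rows_com"
  by (simp_all add: rows_com_def)

lemma rows_com_correct:
  assumes "vars s vR = 0" "x < vars s vM"
  shows "arrs (sem rows_com s) aROW x = x * vars s vM"
proof -
  let ?c = "Update aROW (Var vI) (Var vR) ;; Assign vR (Plus (Var vR) (Var vM))"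
  let ?I = "\<lambda>j t. vars t vR = j * vars s vM \<and> (\<forall>x<j. arrs t aROW x = x * vars s vM)"
  have "?I (vars s vM) (sem (For vI vM ?c) s)"
  proof (rule For_invariant[where I = ?I])
    fix j t assume "?I j t" "vars t vI = j" and G: "agree_outside vI ?c s t"
    then show "?I (Suc j) (set_var vI (Suc j) (sem ?c t))"
      by (simp add: agree_outsideD[OF G] less_Suc_eq)
  qed (use assms(1) in simp_all)
  then show ?thesis using assms(2) unfolding rows_com_def by blast
qed

text \<open>The adjacency matrix of the double cover with ones on the diagonal. Each arc shows up
  once in each of the two off-diagonal blocks, since it changes the sheet.\<close>

definition base_matrix :: "nat \<Rightarrow> nat rel \<Rightarrow> (nat \<Rightarrow> nat) \<Rightarrow> bool" where
  "base_matrix n B f \<longleftrightarrow> (\<forall>x<2 * n. \<forall>y<2 * n. f (x * (2 * n) + y) = of_bool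
     (x = y \<or> x < n \<and> n \<le> y \<and> (x, y - n) \<in> B \<or> n \<le> x \<and> y < n \<and> (x - n, y) \<in> B))"

lemma base_matrix_cover_matrix:
  assumes "base_matrix n A f"
  shows "cover_matrix n (double_cover A \<union> Id_on ({..<n} \<times> UNIV)) f"
proof -
  have "(cover_node n x, cover_node n y) \<in> double_cover A \<union> Id_on ({..<n} \<times> UNIV) \<longleftrightarrow>
      x = y \<or> x < n \<and> n \<le> y \<and> (x, y - n) \<in> A \<or> n \<le> x \<and> y < n \<and> (x - n, y) \<in> A"
    if "x < 2 * n" "y < 2 * n" for x y
    using that unfolding double_cover_def cover_node_def by (auto split: if_splits)
  then show ?thesis using assms unfolding base_matrix_def cover_matrix_def by simp
qed

definition diagonal_com :: com where
  "diagonal_com = For vI vM (Update aR (cell_index (Var vI) (Var vI)) (Num 1))"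

lemma diagonal_com_writes:
  "var_writes diagonal_com = {vI}" "arr_writes diagonal_com = {aR}" "\<not> reads diagonal_com" "\<not> writes diagonal_com"
  by (simp_all add: diagonal_com_def)

lemma diagonal_com_correct:
  assumes "layout n s" "\<And>i. arrs s aR i = 0"
  shows "base_matrix n {} (arrs (sem diagonal_com s) aR)"
proof -
  let ?c = "Update aR (cell_index (Var vI) (Var vI)) (Num 1)"
  let ?I = "\<lambda>j t. \<forall>x<2 * n. \<forall>y<2 * n. arrs t aR (x * (2 * n) + y) = of_bool (x = y \<and> x < j)"
  have "?I (vars s vM) (sem (For vI vM ?c) s)"
  proof (rule For_invariant[where I = ?I])
    fix j t assume j: "j < vars s vM" and inv: "?I j t" and tj: "vars t vI = j" and G: "agree_outside vI ?c s t"
    have lay: "layout n t" by (rule layout_agree[OF G assms(1)]) simp_all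
    have j': "j < 2 * n" using j layoutD(2)[OF assms(1)] by simp
    show "?I (Suc j) (set_var vI (Suc j) (sem ?c t))"
      using inv tj j' layoutD(4)[OF lay j'] by (auto simp: cell_eq less_Suc_eq)
  qed (use assms(2) in simp_all)
  then show ?thesis unfolding diagonal_com_def base_matrix_def layoutD(2)[OF assms(1)] by simp
qed

definition read_arc :: com where
  "read_arc = Input vX ;; Update aADJ (cell_index (Var vI) (Var vJ)) (Var vX) ;;
     Update aR (cell_index (Var vI) (Plus (Var vN) (Var vJ))) (Var vX) ;;
     Update aR (cell_index (Plus (Var vN) (Var vI)) (Var vJ)) (Var vX)"

lemma read_arc_writes:
  "var_writes read_arc = {vX}" "arr_writes read_arc = {aADJ, aR}" "\<not> writes read_arc"
  by (auto simp: read_arc_def)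

definition graph_read :: "nat rel \<Rightarrow> nat \<Rightarrow> nat \<Rightarrow> nat \<Rightarrow> state \<Rightarrow> bool" where
  "graph_read A n u j t \<longleftrightarrow>
     (\<forall>x<n. \<forall>y<n. x < u \<or> x = u \<and> y < j \<longrightarrow> arrs t aADJ (x * (2 * n) + y) = of_bool ((x, y) \<in> A))
     \<and> base_matrix n {(x, y) \<in> A. x < u \<or> x = u \<and> y < j} (arrs t aR)"

lemma read_arc_correct:
  assumes "layout n s" "vars s vI = u" "vars s vJ = j" "u < n" "j < n" "graph_read A n u j s"
    "inp s = of_bool ((u, j) \<in> A) # rest"
  shows "graph_read A n u (Suc j) (sem read_arc s) \<and> inp (sem read_arc s) = rest"
proof -
  let ?b = "of_bool ((u, j) \<in> A) :: nat"
  have N: "vars s vN = n" by (rule layoutD(1)[OF assms(1)])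
  have row: "arrs s aROW u = u * (2 * n)" "arrs s aROW (n + u) = (n + u) * (2 * n)"
    using layoutD(4)[OF assms(1)] assms(4) by simp_all
  have adj: "arrs (sem read_arc s) aADJ = (arrs s aADJ)(u * (2 * n) + j := ?b)"
    using assms(2,3,7) row unfolding read_arc_def by simp
  have mat: "arrs (sem read_arc s) aR = (arrs s aR)(u * (2 * n) + (n + j) := ?b, (n + u) * (2 * n) + j := ?b)"
    using assms(2,3,7) N row unfolding read_arc_def by simp
  have inp: "inp (sem read_arc s) = rest" using assms(7) unfolding read_arc_def by simp
  have "arrs (sem read_arc s) aADJ (x * (2 * n) + y) = of_bool ((x, y) \<in> A)"
    if "x < n" "y < n" "x < u \<or> x = u \<and> y < Suc j" for x y
    using that assms(5,6) unfolding adj graph_read_def by (auto simp: cell_eq less_Suc_eq)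
  moreover have "base_matrix n {(x, y) \<in> A. x < u \<or> x = u \<and> y < Suc j} (arrs (sem read_arc s) aR)"
    unfolding base_matrix_def
  proof (intro allI impI)
    fix x y assume xy: "x < 2 * n" "y < 2 * n"
    have old: "arrs s aR (x * (2 * n) + y) = of_bool (x = y
        \<or> x < n \<and> n \<le> y \<and> (x, y - n) \<in> {(x, y) \<in> A. x < u \<or> x = u \<and> y < j}
        \<or> n \<le> x \<and> y < n \<and> (x - n, y) \<in> {(x, y) \<in> A. x < u \<or> x = u \<and> y < j})"
      using assms(6) xy unfolding graph_read_def base_matrix_def by blast
    have val: "arrs (sem read_arc s) aR (x * (2 * n) + y) =
        (if x = u \<and> y = n + j \<or> x = n + u \<and> y = j then ?b else arrs s aR (x * (2 * n) + y))"
      using xy assms(4,5) unfolding mat by (simp add: cell_eq)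
    show "arrs (sem read_arc s) aR (x * (2 * n) + y) = of_bool (x = y
        \<or> x < n \<and> n \<le> y \<and> (x, y - n) \<in> {(x, y) \<in> A. x < u \<or> x = u \<and> y < Suc j}
        \<or> n \<le> x \<and> y < n \<and> (x - n, y) \<in> {(x, y) \<in> A. x < u \<or> x = u \<and> y < Suc j})"
    proof (cases "x = u \<and> y = n + j \<or> x = n + u \<and> y = j")
      case True
      then show ?thesis unfolding val using assms(4,5) by auto
    next
      case False
      then have ne: "x < n \<and> n \<le> y \<Longrightarrow> \<not> (x = u \<and> y - n = j)" "n \<le> x \<and> y < n \<Longrightarrow> \<not> (x - n = u \<and> y = j)"
        by auto
      have "x < n \<and> n \<le> y \<and> (x, y - n) \<in> {(x, y) \<in> A. x < u \<or> x = u \<and> y < Suc j} \<longleftrightarrow>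
          x < n \<and> n \<le> y \<and> (x, y - n) \<in> {(x, y) \<in> A. x < u \<or> x = u \<and> y < j}"
        using ne(1) less_Suc_eq by blast
      moreover have "n \<le> x \<and> y < n \<and> (x - n, y) \<in> {(x, y) \<in> A. x < u \<or> x = u \<and> y < Suc j} \<longleftrightarrow>
          n \<le> x \<and> y < n \<and> (x - n, y) \<in> {(x, y) \<in> A. x < u \<or> x = u \<and> y < j}"
        using ne(2) less_Suc_eq by blast
      ultimately show ?thesis unfolding val old if_not_P[OF False] by (simp only:)
    qed
  qed
  ultimately show ?thesis using inp unfolding graph_read_def by blast
qed

definition read_row :: com where "read_row = For vJ vN read_arc"

lemma read_row_writes:
  "var_writes read_row = {vJ, vX}" "arr_writes read_row = {aADJ, aR}" "\<not> writes read_row"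
  by (auto simp: read_row_def read_arc_writes)

lemma read_row_correct:
  assumes "layout n s" "vars s vI = u" "u < n" "graph_read A n u 0 s"
    "inp s = map (\<lambda>v. of_bool ((u, v) \<in> A)) [0..<n] @ rest"
  shows "graph_read A n (Suc u) 0 (sem read_row s) \<and> inp (sem read_row s) = rest"
proof -
  let ?I = "\<lambda>j t. graph_read A n u j t \<and> inp t = map (\<lambda>v. of_bool ((u, v) \<in> A)) [j..<n] @ rest"
  have "?I (vars s vN) (sem (For vJ vN read_arc) s)"
  proof (rule For_invariant[where I = ?I])
    fix j t assume j: "j < vars s vN" and inv: "?I j t" and tj: "vars t vJ = j" and G: "agree_outside vJ read_arc s t"
    have lay: "layout n t" by (rule layout_agree[OF G assms(1)]) (simp_all add: read_arc_writes)
    have j': "j < n" using j layoutD(1)[OF assms(1)] by simp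
    have u: "vars t vI = u" using assms(2) by (simp add: agree_outsideD[OF G] read_arc_writes)
    have "inp t = of_bool ((u, j) \<in> A) # map (\<lambda>v. of_bool ((u, v) \<in> A)) [Suc j..<n] @ rest"
      using inv j' by (simp add: upt_conv_Cons)
    from read_arc_correct[OF lay u tj assms(3) j' _ this] inv
    show "?I (Suc j) (set_var vJ (Suc j) (sem read_arc t))" by (simp add: graph_read_def)
  qed (use assms(4,5) in \<open>simp_all add: read_arc_writes graph_read_def\<close>)
  then have I: "graph_read A n u n (sem read_row s)" "inp (sem read_row s) = rest"
    unfolding read_row_def layoutD(1)[OF assms(1)] by simp_all
  have "base_matrix n {(x, y) \<in> A. x < Suc u \<or> x = Suc u \<and> y < 0} f" 
    if "base_matrix n {(x, y) \<in> A. x < u \<or> x = u \<and> y < n} f" for f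
    using that unfolding base_matrix_def less_Suc_eq by (auto simp: of_bool_def)
  then have "graph_read A n (Suc u) 0 (sem read_row s)"
    using I(1) unfolding graph_read_def by (auto simp: less_Suc_eq)
  then show ?thesis using I(2) by blast
qed

definition read_graph :: com where "read_graph = For vI vN read_row"

lemma read_graph_writes:
  "var_writes read_graph = {vI, vJ, vX}" "arr_writes read_graph = {aADJ, aR}" "\<not> writes read_graph"
  by (auto simp: read_graph_def read_row_writes)

lemma read_graph_correct:
  assumes "layout n s" "base_matrix n {} (arrs s aR)" "A \<subseteq> {..<n} \<times> {..<n}"
    "inp s = concat (map (\<lambda>u. map (\<lambda>v. of_bool ((u, v) \<in> A)) [0..<n]) [0..<n]) @ rest"
  shows "adjacency A n (sem read_graph s) \<and> base_matrix n A (arrs (sem read_graph s) aR) \<and> inp (sem read_graph s) = rest"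
proof -
  let ?I = "\<lambda>u t. graph_read A n u 0 t
    \<and> inp t = concat (map (\<lambda>u. map (\<lambda>v. of_bool ((u, v) \<in> A)) [0..<n]) [u..<n]) @ rest"
  have "?I (vars s vN) (sem (For vI vN read_row) s)"
  proof (rule For_invariant[where I = ?I])
    fix u t assume u: "u < vars s vN" and inv: "?I u t" and tu: "vars t vI = u" and G: "agree_outside vI read_row s t"
    have lay: "layout n t" by (rule layout_agree[OF G assms(1)]) (simp_all add: read_row_writes)
    have u': "u < n" using u layoutD(1)[OF assms(1)] by simp
    have "inp t = map (\<lambda>v. of_bool ((u, v) \<in> A)) [0..<n]
        @ concat (map (\<lambda>u. map (\<lambda>v. of_bool ((u, v) \<in> A)) [0..<n]) [Suc u..<n]) @ rest"
      using inv u' by (simp add: upt_conv_Cons)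
    from read_row_correct[OF lay tu u' _ this] inv
    show "?I (Suc u) (set_var vI (Suc u) (sem read_row t))" by (simp add: graph_read_def)
  qed (use assms(2,4) in \<open>simp_all add: read_row_writes graph_read_def\<close>)
  then have I: "graph_read A n n 0 (sem read_graph s)" "inp (sem read_graph s) = rest"
    unfolding read_graph_def layoutD(1)[OF assms(1)] by simp_all
  have "{(x, y) \<in> A. x < n \<or> x = n \<and> y < 0} = A" using assms(3) by auto
  then show ?thesis using I unfolding graph_read_def adjacency_def by simp
qed

definition stored :: "(nat \<times> nat) list \<Rightarrow> state \<Rightarrow> bool" where
  "stored F s \<longleftrightarrow> vars s vP = length F
     \<and> (\<forall>q<length F. arrs s aOWN q = fst (F ! q) \<and> arrs s aCOL q = snd (F ! q))
     \<and> (\<forall>q. arrs s aST q = of_bool (q < length F))"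

lemma stored_set_var: "stored F (set_var x c s) \<longleftrightarrow> stored F s" if "x \<noteq> vP"
  using that by (simp add: stored_def)

definition push_com :: com where
  "push_com = Input vX ;; Update aCOL (Var vP) (Var vX) ;; Update aOWN (Var vP) (Var vI) ;;
     Update aST (Var vP) (Num 1) ;; Assign vP (Plus (Var vP) (Num 1))"

lemma push_com_writes:
  "var_writes push_com = {vX, vP}" "arr_writes push_com = {aCOL, aOWN, aST}" "\<not> writes push_com"
  by (auto simp: push_com_def)

lemma push_com_correct:
  assumes "stored F s" "inp s = c # rest" "vars s vI = v"
  shows "stored (F @ [(v, c)]) (sem push_com s) \<and> inp (sem push_com s) = rest"
  using assms by (auto simp: stored_def push_com_def nth_append less_Suc_eq)

text \<open>\<open>vL\<close> is overwritten for each list, so it cannot be a loop bound in the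
  sense of \<open>run_time_le\<close>. The loop makes \<open>n * k\<close> rounds instead, enough
  for every list, and idles after the end of the list.\<close>

definition read_list :: com where
  "read_list = For vJ vNK (Cond (Minus (Var vL) (Var vJ)) push_com skip)"

lemma read_list_writes:
  "var_writes read_list = {vJ, vX, vP, 0}" "arr_writes read_list = {aCOL, aOWN, aST}" "\<not> writes read_list"
  by (auto simp: read_list_def push_com_writes)

lemma read_list_correct:
  assumes "stored F s" "vars s vI = v" "vars s vL = length l" "length l \<le> vars s vNK" "inp s = l @ rest"
  shows "stored (F @ map (Pair v) l) (sem read_list s) \<and> inp (sem read_list s) = rest"
proof -
  let ?c = "Cond (Minus (Var vL) (Var vJ)) push_com skip"
  let ?I = "\<lambda>j t. stored (F @ map (Pair v) (take j l)) t \<and> inp t = drop j l @ rest"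
  have "?I (vars s vNK) (sem (For vJ vNK ?c) s)"
  proof (rule For_invariant[where I = ?I])
    fix j t assume inv: "?I j t" and tj: "vars t vJ = j" and G: "agree_outside vJ ?c s t"
    have v: "vars t vI = v" "vars t vL = length l"
      using assms(2,3) by (simp_all add: agree_outsideD[OF G] push_com_writes)
    show "?I (Suc j) (set_var vJ (Suc j) (sem ?c t))"
    proof (cases "j < length l")
      case True
      then have "inp t = l ! j # drop (Suc j) l @ rest" using inv by (simp add: Cons_nth_drop_Suc)
      from push_com_correct[OF conjunct1[OF inv] this v(1)] show ?thesis
        using True tj v by (simp add: stored_set_var take_Suc_conv_app_nth)
    next
      case False
      then show ?thesis using inv tj v by (simp add: stored_def)
    qed
  qed (use assms(1,5) in \<open>simp_all add: push_com_writes stored_set_var\<close>)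
  then show ?thesis using assms(4) unfolding read_list_def by simp
qed

definition read_lists :: com where
  "read_lists = For vI vN (Input vL ;; read_list)"

lemma read_lists_writes:
  "var_writes read_lists = {vI, vL, vJ, vX, vP, 0}" "arr_writes read_lists = {aCOL, aOWN, aST}" "\<not> writes read_lists"
  by (auto simp: read_lists_def read_list_writes)

definition list_entries :: "nat list list \<Rightarrow> (nat \<times> nat) list" where
  "list_entries L = concat (map (\<lambda>v. map (Pair v) (L ! v)) [0..<length L])"

lemma read_lists_correct:
  assumes "stored [] s" "vars s vN = length L" "\<forall>l\<in>set L. length l \<le> vars s vNK"
    "inp s = concat (map (\<lambda>l. length l # l) L)"
  shows "stored (list_entries L) (sem read_lists s)"
proof -
  let ?c = "Input vL ;; read_list"
  let ?I = "\<lambda>i t. stored (concat (map (\<lambda>v. map (Pair v) (L ! v)) [0..<i])) t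
    \<and> inp t = concat (map (\<lambda>l. length l # l) (drop i L))"
  have "?I (vars s vN) (sem (For vI vN ?c) s)"
  proof (rule For_invariant[where I = ?I])
    fix i t assume i: "i < vars s vN" and inv: "?I i t" and ti: "vars t vI = i" and G: "agree_outside vI ?c s t"
    define t' where "t' = sem (Input vL) t"
    have i': "i < length L" using i assms(2) by simp
    have "inp t = length (L ! i) # (L ! i) @ concat (map (\<lambda>l. length l # l) (drop (Suc i) L))"
      using inv Cons_nth_drop_Suc[OF i', symmetric] by simp
    then have t': "inp t' = (L ! i) @ concat (map (\<lambda>l. length l # l) (drop (Suc i) L))"
      "vars t' vL = length (L ! i)" "vars t' vI = i" "vars t' vNK = vars s vNK"
      "stored (concat (map (\<lambda>v. map (Pair v) (L ! v)) [0..<i])) t'"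
      using inv ti unfolding t'_def
      by (simp_all add: agree_outsideD[OF G] read_list_writes stored_def)
    moreover have "length (L ! i) \<le> vars t' vNK" using assms(3) i' t'(4) by simp
    ultimately have "stored (concat (map (\<lambda>v. map (Pair v) (L ! v)) [0..<i]) @ map (Pair i) (L ! i)) (sem read_list t')
        \<and> inp (sem read_list t') = concat (map (\<lambda>l. length l # l) (drop (Suc i) L))"
      by (intro read_list_correct) auto
    then show "?I (Suc i) (set_var vI (Suc i) (sem ?c t))"
      unfolding t'_def by (simp add: stored_set_var)
  qed (use assms(1,4) in \<open>simp_all add: read_list_writes stored_set_var\<close>)
  then show ?thesis unfolding read_lists_def list_entries_def assms(2) by simp
qed

subsection \<open>The whole program\<close>

definition main_com :: com where
  "main_com = rows_com ;; diagonal_com ;; read_graph ;; read_lists ;; closure_com ;; rank_com ;; par_com ;;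
     colour_com ;; output_com"

lemma mem_list_entries: "v < length L \<Longrightarrow> (v, c) \<in> set (list_entries L) \<longleftrightarrow> c \<in> set (L ! v)"
  by (auto simp: list_entries_def)

lemma fst_list_entries: "e \<in> set (list_entries L) \<Longrightarrow> fst e < length L"
  by (auto simp: list_entries_def)

lemma distinct_list_entries:
  assumes "\<forall>l\<in>set L. distinct l"
  shows "distinct (list_entries L)"
proof -
  have "distinct (concat (map (\<lambda>v. map (Pair v) (L ! v)) [0..<m]))" if "m \<le> length L" for m
    using that
  proof (induction m)
    case (Suc m)
    then show ?case using assms by (auto simp: distinct_map inj_on_def)
  qed simp
  then show ?thesis unfolding list_entries_def by blast
qed

lemma length_list_entries_le:
  assumes "\<forall>l\<in>set L. length l \<le> b"
  shows "length (list_entries L) \<le> length L * b"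
proof -
  have "length (concat (map (\<lambda>v. map (Pair v) (L ! v)) [0..<m])) \<le> m * b" if "m \<le> length L" for m
    using that
  proof (induction m)
    case (Suc m)
    then show ?case using assms by (simp add: add.commute add_mono)
  qed simp
  then show ?thesis unfolding list_entries_def by blast
qed

text \<open>An oriented graph has no loops, so outdegrees are below \<open>n\<close>. This justifies
  the number of rounds in \<open>read_list\<close>.\<close>

lemma choice_instance_list_length:
  assumes "pverts D = {..<n}" "length L = n" "\<forall>l\<in>set L. distinct l" "choice_instance D k (\<lambda>v. set (L ! v))"
  shows "\<forall>l\<in>set L. length l \<le> n * k"
proof
  fix l assume "l \<in> set L"
  then obtain v where v: "v < n" "l = L ! v" using assms(2) by (auto simp: in_set_conv_nth)
  interpret pair_digraph D using assms(4) unfolding choice_instance_def oriented_graph_def by simp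
  have "(v, v) \<notin> parcs D"
    using assms(4) unfolding choice_instance_def oriented_graph_def by (auto dest: asymD)
  then have "parcs D `` {v} \<subseteq> {..<n} - {v}" using in_arcsD2 assms(1) by auto
  then have "card (parcs D `` {v}) \<le> card ({..<n} - {v})" by (intro card_mono) auto
  then have deg: "out_degree (with_proj D) v + 1 \<le> n" using v(1) by (simp add: out_degree_with_proj)
  have "length l = k * (out_degree (with_proj D) v + 1)"
    using assms(1,3,4) v \<open>l \<in> set L\<close> distinct_card[of l] unfolding choice_instance_def by auto
  also have "\<dots> \<le> n * k" using deg by (metis mult.commute mult_le_mono1)
  finally show "length l \<le> n * k" .
qed

text \<open>The interface between the preamble, which computes all loop bounds, and
  \<open>main_com\<close>, which never writes them. This separation makes \<open>run_time_le\<close>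
  applicable to \<open>main_com\<close> as a whole.\<close>

definition bounds_state :: "nat \<Rightarrow> nat \<Rightarrow> nat list \<Rightarrow> state \<Rightarrow> bool" where
  "bounds_state n k xs s \<longleftrightarrow> vars s vN = n \<and> vars s vK = k \<and> vars s vNK = n * k \<and> vars s vT = n * (n * k)
     \<and> vars s vM = 2 * n \<and> vars s vM1 = Suc (2 * n) \<and> vars s vR = 0 \<and> vars s vP = 0
     \<and> (\<forall>a i. arrs s a i = 0) \<and> inp s = xs \<and> outp s = []"

lemma main_com_correct:
  assumes inst: "pverts D = {..<n}" "length L = n" "\<forall>l\<in>set L. distinct l" "choice_instance D k (\<lambda>v. set (L ! v))"
    and start: "bounds_state n k (concat (map (\<lambda>u. map (\<lambda>v. of_bool ((u, v) \<in> parcs D)) [0..<n]) [0..<n])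
        @ concat (map (\<lambda>l. length l # l) L)) s"
  shows "\<exists>C. proper_choice D k (\<lambda>v. set (L ! v)) C
    \<and> outp (sem main_com s) = map snd (filter (\<lambda>(v, c). c \<in> C v) (list_entries L))"
proof -
  interpret pair_digraph D using inst(4) unfolding choice_instance_def oriented_graph_def by simp
  have vars: "vars s vN = n" "vars s vK = k" "vars s vNK = n * k" "vars s vT = n * (n * k)" "vars s vM = 2 * n"
      "vars s vM1 = Suc (2 * n)" "vars s vR = 0" "vars s vP = 0"
    and arrs: "\<And>a i. arrs s a i = 0"
    and inp: "inp s = concat (map (\<lambda>u. map (\<lambda>v. of_bool ((u, v) \<in> parcs D)) [0..<n]) [0..<n])
        @ concat (map (\<lambda>l. length l # l) L)"
    and outp: "outp s = []"
    using start unfolding bounds_state_def by simp_all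
  define A where "A = parcs D"
  define R where "R = (double_cover A)\<^sup>*"
  define F where "F = list_entries L"
  define S where "S = (\<lambda>v. set (L ! v))"
  have A: "A \<subseteq> {..<n} \<times> {..<n}" unfolding A_def using in_arcsD1 in_arcsD2 inst(1) by auto
  note short = choice_instance_list_length[OF inst]
  define s1 where "s1 = sem rows_com s"
  define s2 where "s2 = sem diagonal_com s1"
  define s3 where "s3 = sem read_graph s2"
  define s4 where "s4 = sem read_lists s3"
  define s5 where "s5 = sem closure_com s4"
  define s6 where "s6 = sem rank_com s5"
  define s7 where "s7 = sem par_com s6"
  define s8 where "s8 = sem colour_com s7"
  note writes = rows_com_writes diagonal_com_writes read_graph_writes read_lists_writes closure_com_writes
    rank_com_writes par_com_writes colour_com_writes
  have lay1: "layout n s1"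
    using vars rows_com_correct[OF vars(7)] unfolding layout_def s1_def by (simp add: sem_frame writes)
  have lay2: "layout n s2" unfolding s2_def by (rule layout_sem[OF lay1]) (simp_all add: writes)
  have lay3: "layout n s3" unfolding s3_def by (rule layout_sem[OF lay2]) (simp_all add: writes)
  have lay4: "layout n s4" unfolding s4_def by (rule layout_sem[OF lay3]) (simp_all add: writes)
  have lay5: "layout n s5" unfolding s5_def by (rule layout_sem[OF lay4]) (simp_all add: writes)
  have lay6: "layout n s6" unfolding s6_def by (rule layout_sem[OF lay5]) (simp_all add: writes)
  have lay7: "layout n s7" unfolding s7_def by (rule layout_sem[OF lay6]) (simp_all add: writes)
  have "base_matrix n {} (arrs s2 aR)"
    unfolding s2_def by (rule diagonal_com_correct[OF lay1]) (simp add: s1_def sem_frame writes arrs)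
  moreover have "inp s2 = concat (map (\<lambda>u. map (\<lambda>v. of_bool ((u, v) \<in> A)) [0..<n]) [0..<n])
      @ concat (map (\<lambda>l. length l # l) L)"
    using inp unfolding s2_def s1_def A_def by (simp add: sem_frame writes)
  ultimately have g3: "adjacency A n s3" "base_matrix n A (arrs s3 aR)" "inp s3 = concat (map (\<lambda>l. length l # l) L)"
    unfolding s3_def using read_graph_correct[OF lay2 _ A] by blast+
  have "stored [] s3"
    unfolding stored_def s3_def s2_def s1_def using vars(8) arrs by (simp add: sem_frame writes)
  moreover have "vars s3 vN = length L" "\<forall>l\<in>set L. length l \<le> vars s3 vNK"
    unfolding s3_def s2_def s1_def using vars inst(2) short by (simp_all add: sem_frame writes)
  ultimately have st4: "stored F s4" unfolding s4_def F_def by (rule read_lists_correct[OF _ _ _ g3(3)])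
  have "cover_matrix n (double_cover A \<union> Id_on ({..<n} \<times> UNIV)) (arrs s4 aR)"
    using base_matrix_cover_matrix[OF g3(2)] unfolding s4_def by (simp add: sem_frame writes)
  moreover have "Field (double_cover A \<union> Id_on ({..<n} \<times> (UNIV :: bool set))) \<subseteq> {..<n} \<times> UNIV"
    using A unfolding Field_def double_cover_def by auto
  ultimately have m5: "cover_matrix n R (arrs s5 aR)"
    unfolding s5_def R_def by (intro cover_matrix_closure closure_com_correct[OF lay4])
  have "\<forall>v<n. arrs s6 aRANK v = reach_rank R v"
    using rank_com_correct[OF lay5] sum_cover_row[OF m5[unfolded R_def] A] unfolding s6_def R_def by simp
  then have rank7: "\<forall>v<n. arrs s7 aRANK v = reach_rank R v" unfolding s7_def by (simp add: sem_frame writes)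
  have m6: "cover_matrix n R (arrs s6 aR)" using m5 unfolding s6_def by (simp add: sem_frame writes)
  have "\<forall>v<n. arrs s6 aPAR v = 0"
    unfolding s6_def s5_def s4_def s3_def s2_def s1_def by (simp add: sem_frame writes arrs)
  then have par7: "\<forall>v<n. arrs s7 aPAR v = of_bool (reach_par R [0..<n] v)"
    unfolding s7_def by (rule par_com_correct[OF lay6 m6])
  have "adjacency A n s7" using g3(1) unfolding adjacency_def s7_def s6_def s5_def s4_def by (simp add: sem_frame writes)
  then have env: "kernel_env n A (reach_rank R) (reach_par R [0..<n]) s7"
    using lay7 rank7 par7 unfolding kernel_env_def by blast
  have vars7: "vars s7 vT = n * (n * k)" "vars s7 vK = k" "vars s7 vN = n"
    unfolding s7_def s6_def s5_def s4_def s3_def s2_def s1_def using vars by (simp_all add: sem_frame writes)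
  have st7: "\<forall>q<length F. arrs s7 aOWN q = fst (F ! q) \<and> arrs s7 aCOL q = snd (F ! q)"
    "\<forall>q. arrs s7 aST q = of_bool (q < length F)"
    using st4 unfolding stored_def s7_def s6_def s5_def by (simp_all add: sem_frame writes)
  have "length F \<le> n * (n * k)" unfolding F_def using length_list_entries_le[OF short] inst(2) by simp
  then have ent: "entries F n k s7"
    using vars7 st7(1) fst_list_entries[of _ L] inst(2) unfolding entries_def F_def by simp
  have cnt7: "arrs s7 aCNT v = 0" for v
    unfolding s7_def s6_def s5_def s4_def s3_def s2_def s1_def by (simp add: sem_frame writes arrs)
  have state: "colour_state F n (\<lambda>_. {}, {}) s7"
    unfolding colour_state_def entry_status_def using st7(2) cnt7 by simp
  define ker where "ker = kernel_iter A (reach_rank R) (reach_par R [0..<n]) [0..<n] (Suc (2 * n))"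
  have ker: "ker = reach_kernel A [0..<n]" unfolding ker_def reach_kernel_def R_def Let_def by simp
  have no: "no_odd_cycle D" using inst(4) unfolding choice_instance_def by blast
  have kernel: "is_kernel A W (ker W)" if "W \<subseteq> {..<n}" for W
    unfolding ker A_def using that inst(1)
    by (intro is_kernel_reach_kernel[OF pair_wf_digraph_axioms no]) auto
  have inv: "colour_inv D k S (fold (colour_step ker {..<n} k S) cs (\<lambda>_. {}, {}))"
    and seen: "snd (fold (colour_step ker {..<n} k S) cs (\<lambda>_. {}, {})) = set cs" for cs
    using colour_inv_fold[OF pair_wf_digraph_axioms, of ker S k cs] kernel inst(1) unfolding A_def S_def by auto
  \<comment> \<open>One colour for each slot, with repetitions and the content of empty slots; what
    matters is that every listed colour occurs.\<close>
  define cs where "cs = map (arrs s7 aCOL) [0..<n * (n * k)]"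
  obtain C P where CP: "fold (colour_step ker {..<n} k S) cs (\<lambda>_. {}, {}) = (C, P)" by (meson surj_pair)
  have S: "c \<in> S v \<longleftrightarrow> (v, c) \<in> set F" if "v < n" for v c
    unfolding S_def F_def using mem_list_entries[of v L c] that inst(2) by simp
  have "colour_state F n (C, P) s8"
    unfolding s8_def CP[symmetric] cs_def ker_def vars7(1)[symmetric]
  proof (rule colour_com_correct[OF env ent state S A])
    show "kernel_iter A (reach_rank R) (reach_par R [0..<n]) [0..<n] (Suc (2 * n)) W \<subseteq> W" if "W \<subseteq> {..<n}" for W
      using kernel[OF that] unfolding is_kernel_def ker_def by blast
    show "distinct F" unfolding F_def by (rule distinct_list_entries[OF inst(3)])
    fix cs v assume "v < n"
    then show "fst (fold (colour_step (kernel_iter A (reach_rank R) (reach_par R [0..<n]) [0..<n] (Suc (2 * n)))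
        {..<n} k S) cs (\<lambda>_. {}, {})) v
      \<subseteq> S v \<inter> snd (fold (colour_step (kernel_iter A (reach_rank R) (reach_par R [0..<n]) [0..<n] (Suc (2 * n)))
        {..<n} k S) cs (\<lambda>_. {}, {}))"
      using inv[of cs] inst(1) unfolding colour_inv_def ker_def by (auto simp: split_beta)
  qed
  moreover have "entries F n k s8" unfolding s8_def by (rule entries_sem[OF ent]) (simp_all add: writes)
  moreover have FP: "snd ` set F \<subseteq> P"
  proof
    fix c assume "c \<in> snd ` set F"
    then obtain q where "q < length F" "c = snd (F ! q)" by (auto simp: in_set_conv_nth)
    then have "c = arrs s7 aCOL q" "q < n * (n * k)" using st7(1) \<open>length F \<le> n * (n * k)\<close> by auto
    then show "c \<in> P" using seen[of cs] CP unfolding cs_def by auto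
  qed
  ultimately have "outp (sem output_com s8) = outp s8 @ map snd (filter (\<lambda>(v, c). c \<in> C v) F)"
    by (intro output_com_correct)
  moreover have "outp s8 = []"
    unfolding s8_def s7_def s6_def s5_def s4_def s3_def s2_def s1_def using outp by (simp add: sem_frame writes)
  moreover have "sem main_com s = sem output_com s8"
    unfolding main_com_def s8_def s7_def s6_def s5_def s4_def s3_def s2_def s1_def by simp
  moreover have "proper_choice D k S C"
  proof (rule colour_inv_proper_choice[OF inst(4)[folded S_def]])
    show "colour_inv D k S (C, P)" using inv[of cs] CP by simp
    show "\<forall>v\<in>pverts D. S v \<subseteq> P" using S FP inst(1) by force
  qed
  ultimately show ?thesis unfolding S_def F_def by auto
qed

section \<open>Computing the loop bounds, and the running time of the whole\<close>

definition product_com :: "nat \<Rightarrow> nat \<Rightarrow> com" where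
  "product_com x y = For vI vN (Assign x (Plus (Var x) (Var y)))"

lemma product_com_correct:
  assumes "x \<noteq> vI" "y \<noteq> vI" "x \<noteq> y" "vars s x = 0"
  shows "vars (sem (product_com x y) s) x = vars s vN * vars s y"
proof -
  let ?c = "Assign x (Plus (Var x) (Var y))"
  have "vars (sem (For vI vN ?c) s) x = vars s vN * vars s y"
  proof (rule For_invariant[where I = "\<lambda>j t. vars t x = j * vars s y"])
    fix j t assume "vars t x = j * vars s y" and G: "agree_outside vI ?c s t"
    moreover have "vars t y = vars s y" using agree_outsideD(1)[OF G, of y] assms by simp
    ultimately show "vars (set_var vI (Suc j) (sem ?c t)) x = Suc j * vars s y" using assms by simp
  qed (use assms in simp_all)
  then show ?thesis unfolding product_com_def .
qed

definition header_com :: com where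
  "header_com = Input vN ;; Input vK"

definition bounds_com :: com where
  "bounds_com = Assign vM (Plus (Var vN) (Var vN)) ;; Assign vM1 (Plus (Var vM) (Num 1))"

definition choice_com :: com where
  "choice_com = header_com ;; product_com vNK vK ;; product_com vT vNK ;; bounds_com ;; main_com"

lemmas main_com_defs = main_com_def rows_com_def diagonal_com_def read_graph_def read_row_def read_arc_def
  read_lists_def read_list_def push_com_def closure_com_def warshall_round_def warshall_row_def
  rank_com_def row_sum_def par_com_def par_row_def par_body_def par_even_def par_odd_def
  colour_com_def colour_body_def clear_com_def mark_com_def award_com_def
  kernel_com_def kernel_start_com_def kernel_phase_com_def kernel_sweep_com_def kernel_update_com_def flag_com_def
  output_com_def

lemma com_ok_choice_com: "com_ok choice_com"
  by (simp add: choice_com_def header_com_def product_com_def bounds_com_def main_com_defs)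

lemma loop_bounds_main_com: "loop_bounds main_com = {vN, vNK, vT, vM, vM1}"
  by (auto simp: main_com_defs)

lemma var_writes_main_com: "{vN, vNK, vT, vM, vM1} \<inter> var_writes main_com = {}"
  by (simp add: main_com_defs)

lemma choice_com_correct:
  fixes n k :: nat and xs :: "nat list"
  defines "s \<equiv> \<lparr>vars = \<lambda>_. 0, arrs = \<lambda>_ _. 0, inp = n # k # xs, outp = []\<rparr>"
  defines "c \<equiv> com_size choice_com" and "d \<equiv> Suc (depth main_com)"
  shows "\<exists>t. bounds_state n k xs t \<and> sem choice_com s = sem main_com t
    \<and> run_time choice_com s \<le> c * (3 * ((n + 1)\<^sup>2 * (k + 1))) ^ d"
proof -
  define s1 where "s1 = sem header_com s"
  define s2 where "s2 = sem (product_com vNK vK) s1"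
  define s3 where "s3 = sem (product_com vT vNK) s2"
  define s4 where "s4 = sem bounds_com s3"
  have v1: "vars s1 = (\<lambda>_. 0)(vN := n, vK := k)" "inp s1 = xs" "outp s1 = []" "arrs s1 = (\<lambda>_ _. 0)"
    unfolding s1_def s_def header_com_def by (simp_all add: fun_eq_iff)
  have w: "var_writes (product_com x y) = {vI, x}" "arr_writes (product_com x y) = {}"
    "\<not> reads (product_com x y)" "\<not> writes (product_com x y)" for x y
    by (simp_all add: product_com_def)
  have v2: "vars s2 vNK = n * k"
    unfolding s2_def by (subst product_com_correct) (simp_all add: v1)
  have v2': "vars s2 x = vars s1 x" if "x \<noteq> vI" "x \<noteq> vNK" for x
    unfolding s2_def using that by (simp add: sem_vars w)
  have v3: "vars s3 vT = n * (n * k)"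
    unfolding s3_def by (subst product_com_correct) (simp_all add: v2 v2' v1)
  have v3': "vars s3 x = vars s2 x" if "x \<noteq> vI" "x \<noteq> vT" for x
    unfolding s3_def using that by (simp add: sem_vars w)
  have rest: "arrs s3 = (\<lambda>_ _. 0)" "inp s3 = xs" "outp s3 = []"
    unfolding s3_def s2_def using v1 by (auto simp: sem_frame w fun_eq_iff)
  have bs: "bounds_state n k xs s4"
    unfolding bounds_state_def s4_def bounds_com_def using v3 v3' v2 v2' v1 rest by simp
  have sem: "sem choice_com s = sem main_com s4"
    unfolding choice_com_def s4_def s3_def s2_def s1_def by simp
  \<comment> \<open>\<open>E\<close> dominates \<open>n + 1\<close>, \<open>n * k\<close> and
    \<open>n * (n * k)\<close>. Doubling it covers the largest remaining bound
    \<open>2 * n + 1\<close>, and as \<open>E\<close> is positive, tripling it also covers the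
    successor in \<open>Suc B\<close>.\<close>
  define E where "E = (n + 1)\<^sup>2 * (k + 1)"
  define B where "B = 2 * E"
  have "0 < E" unfolding E_def by simp
  then have pos: "1 \<le> E" by simp
  have E: "E = (n + 1) * ((n + 1) * (k + 1))" unfolding E_def power2_eq_square mult.assoc ..
  have "n * (n * k) \<le> E" unfolding E by (intro mult_mono) auto
  moreover have "1 * (n * k) \<le> E" unfolding E by (intro mult_mono) auto
  moreover have "(n + 1) * (1 * 1) \<le> E" unfolding E by (intro mult_mono) auto
  ultimately have B: "n \<le> B" "n * k \<le> B" "n * (n * k) \<le> B" "2 * n \<le> B" "Suc (2 * n) \<le> B"
    unfolding B_def by simp_all
  have SB: "Suc B \<le> 3 * E" unfolding B_def using pos by simp
  let ?Q = "3 * E"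
  have Q: "1 \<le> ?Q" using pos by simp
  have up: "Suc B ^ e \<le> ?Q ^ d" if "e \<le> d" for e
  proof -
    have "Suc B ^ e \<le> ?Q ^ e" using SB by (intro power_mono) auto
    also have "\<dots> \<le> ?Q ^ d" using that Q by (intro power_increasing) auto
    finally show ?thesis .
  qed
  \<comment> \<open>The successor in \<open>d\<close> guarantees that it is at least 1, the depth of
    \<open>product_com\<close>, without evaluating the depth of \<open>main_com\<close>.\<close>
  have prod: "run_time (product_com x y) t \<le> com_size (product_com x y) * ?Q ^ d" if "vars t vN = n" "x \<noteq> vN" for x y t
  proof -
    have "run_time (product_com x y) t \<le> com_size (product_com x y) * Suc B ^ depth (product_com x y)"
      using that B(1) by (intro run_time_le) (auto simp: product_com_def)
    also have "\<dots> \<le> com_size (product_com x y) * ?Q ^ d"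
      by (intro mult_left_mono up) (auto simp: product_com_def d_def)
    finally show ?thesis .
  qed
  have "run_time main_com s4 \<le> com_size main_com * Suc B ^ depth main_com"
    using bs B var_writes_main_com by (intro run_time_le) (auto simp: loop_bounds_main_com bounds_state_def)
  also have "\<dots> \<le> com_size main_com * ?Q ^ d" by (intro mult_left_mono up) (auto simp: d_def)
  finally have main: "run_time main_com s4 \<le> com_size main_com * ?Q ^ d" .
  have one: "1 \<le> ?Q ^ d" using Q by (rule one_le_power)
  have "run_time header_com s = com_size header_com * 1" by (simp add: header_com_def)
  also have "\<dots> \<le> com_size header_com * ?Q ^ d" using one by (intro mult_left_mono) auto
  finally have header: "run_time header_com s \<le> com_size header_com * ?Q ^ d" .
  have "run_time bounds_com s3 = com_size bounds_com * 1" by (simp add: bounds_com_def)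
  also have "\<dots> \<le> com_size bounds_com * ?Q ^ d" using one by (intro mult_left_mono) auto
  finally have bounds: "run_time bounds_com s3 \<le> com_size bounds_com * ?Q ^ d" .
  have "run_time choice_com s = run_time header_com s + (run_time (product_com vNK vK) s1
      + (run_time (product_com vT vNK) s2 + (run_time bounds_com s3 + run_time main_com s4)))"
    unfolding choice_com_def s4_def s3_def s2_def s1_def by simp
  also have "\<dots> \<le> com_size header_com * ?Q ^ d + (com_size (product_com vNK vK) * ?Q ^ d
      + (com_size (product_com vT vNK) * ?Q ^ d + (com_size bounds_com * ?Q ^ d + com_size main_com * ?Q ^ d)))"
    by (intro add_mono header bounds main prod) (simp_all add: v1 v2')
  also have "\<dots> = c * ?Q ^ d" unfolding c_def choice_com_def by (simp add: algebra_simps)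
  finally show ?thesis using bs sem unfolding E_def by blast
qed

theorem theorem3:
  shows "(\<forall>(D :: 'a pair_pre_digraph) (k :: nat) (S :: 'a \<Rightarrow> 'c set).
            choice_instance D k S \<longrightarrow> (\<exists>C. proper_choice D k S C))
       \<and> (\<exists>(P :: instr list) (p :: nat poly poly).
            \<forall>(D :: nat pair_pre_digraph) (n :: nat) (k :: nat) (L :: nat list list).
              pverts D = {..<n} \<and> length L = n \<and> (\<forall>l\<in>set L. distinct l) \<and>
              choice_instance D k (\<lambda>v. set (L ! v)) \<longrightarrow>
              (\<exists>M :: nat list list.
                 length M = n \<and> (\<forall>l\<in>set M. length l = k) \<and>
                 proper_choice D k (\<lambda>v. set (L ! v)) (\<lambda>v. set (M ! v)) \<and>
                 ram_outputs P (encode_instance n k D L) (concat M)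
                   (poly (poly p [:n:]) k)))"
proof (intro conjI allI impI)
  show "\<exists>C. proper_choice D k S C" if "choice_instance D k S"
    for D :: "'a pair_pre_digraph" and k and S :: "'a \<Rightarrow> 'c set"
    using that by (rule choice_instance_imp_proper_choice)
next
  define c where "c = com_size choice_com"
  define d where "d = Suc (depth main_com)"
  \<comment> \<open>The outer indeterminate stands for \<open>n\<close> and the inner one for
    \<open>k\<close>: \<open>[:1, 1:]\<close> becomes \<open>n + 1\<close>, and
    \<open>[:[:1, 1:]:]\<close> becomes \<open>k + 1\<close>.\<close>
  define p :: "nat poly poly" where "p = [:[:c:]:] * ([:[:3:]:] * ([:1, 1:]\<^sup>2 * [:[:1, 1:]:])) ^ d"
  have p: "poly (poly p [:n:]) k = c * (3 * ((n + 1)\<^sup>2 * (k + 1))) ^ d" for n k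
    unfolding p_def by (simp add: algebra_simps)
  show "\<exists>(P :: instr list) (p :: nat poly poly).
            \<forall>(D :: nat pair_pre_digraph) (n :: nat) (k :: nat) (L :: nat list list).
              pverts D = {..<n} \<and> length L = n \<and> (\<forall>l\<in>set L. distinct l) \<and>
              choice_instance D k (\<lambda>v. set (L ! v)) \<longrightarrow>
              (\<exists>M :: nat list list.
                 length M = n \<and> (\<forall>l\<in>set M. length l = k) \<and>
                 proper_choice D k (\<lambda>v. set (L ! v)) (\<lambda>v. set (M ! v)) \<and>
                 ram_outputs P (encode_instance n k D L) (concat M)
                   (poly (poly p [:n:]) k))"
  proof (intro exI[of _ "com_code 0 choice_com"] exI[of _ p] allI impI, elim conjE)
    fix D :: "nat pair_pre_digraph" and n k :: nat and L :: "nat list list"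
    assume inst: "pverts D = {..<n}" "length L = n" "\<forall>l\<in>set L. distinct l" "choice_instance D k (\<lambda>v. set (L ! v))"
    define xs where "xs = concat (map (\<lambda>u. map (\<lambda>v. of_bool ((u, v) \<in> parcs D)) [0..<n]) [0..<n])
        @ concat (map (\<lambda>l. length l # l) L)"
    have enc: "encode_instance n k D L = n # k # xs"
      unfolding encode_instance_def xs_def of_bool_def by simp
    let ?s = "\<lparr>vars = \<lambda>_. 0, arrs = \<lambda>_ _. 0, inp = n # k # xs, outp = []\<rparr>"
    obtain t where t: "bounds_state n k xs t" "sem choice_com ?s = sem main_com t"
      "run_time choice_com ?s \<le> poly (poly p [:n:]) k"
      using choice_com_correct[of n k xs] unfolding p c_def d_def by blast
    obtain C where C: "proper_choice D k (\<lambda>v. set (L ! v)) C"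
      "outp (sem main_com t) = map snd (filter (\<lambda>(v, c). c \<in> C v) (list_entries L))"
      using main_com_correct[OF inst t(1)[unfolded xs_def]] by blast
    \<comment> \<open>Filtering the given lists keeps the order in which the program prints the
      colours, so that \<open>concat M\<close> is literally the output.\<close>
    define M where "M = map (\<lambda>v. filter (\<lambda>c. c \<in> C v) (L ! v)) [0..<n]"
    have sub: "C v \<subseteq> set (L ! v)" "card (C v) = k" if "v < n" for v
      using C(1) that inst(1) unfolding proper_choice_def by auto
    have M: "set (M ! v) = C v" if "v < n" for v
      using sub(1)[OF that] that unfolding M_def by auto
    have "length l = k" if l: "l \<in> set M" for l
    proof -
      have "length M = n" by (simp add: M_def)
      then obtain v where v: "v < n" "l = M ! v" using l by (auto simp: in_set_conv_nth)
      have "distinct l" using v inst(2,3) unfolding M_def by simp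
      then show ?thesis using distinct_card[of l] M[OF v(1)] sub(2)[OF v(1)] v(2) by simp
    qed
    moreover have "proper_choice D k (\<lambda>v. set (L ! v)) (\<lambda>v. set (M ! v))"
      using C(1) M inst(1) unfolding proper_choice_def by simp
    moreover have "concat M = outp (sem choice_com ?s)"
      unfolding t(2) C(2) M_def list_entries_def inst(2)
      by (simp add: filter_concat map_concat comp_def filter_map)
    then have "ram_outputs (com_code 0 choice_com) (encode_instance n k D L) (concat M) (poly (poly p [:n:]) k)"
      using ram_outputs_com_code[OF com_ok_choice_com t(3)] unfolding enc by simp
    ultimately show "\<exists>M :: nat list list.
                 length M = n \<and> (\<forall>l\<in>set M. length l = k) \<and>
                 proper_choice D k (\<lambda>v. set (L ! v)) (\<lambda>v. set (M ! v)) \<and>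
                 ram_outputs (com_code 0 choice_com) (encode_instance n k D L) (concat M)
                   (poly (poly p [:n:]) k)"
      by (intro exI[of _ M]) (simp add: M_def)
  qed
qed

end
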